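(* Let $p$ be a prime, let $F$ be a finite extension of $\mathbb{Q}_p$ with ring of integers $\mathcal{O}$, let $k$ be an algebraically closed field of characteristic $p$, and let $G=\mathrm{GL}_2(F)$, $K=\mathrm{GL}_2(\mathcal{O})$, $Z$ the center of $G$. For any smooth irreducible representation $\sigma$ of $KZ$ over $k$, the universal supersingular representation $\mathrm{ind}_{KZ}^G\sigma/T(\mathrm{ind}_{KZ}^G\sigma)$ of $G$ is not admissible if $F\neq\mathbb{Q}_p$.
   Context: Notation. $\varpi$ is a fixed uniformizer of $F$, $k_F=\mathbb{F}_q$ is the residue field of $\mathcal{O}$ with $q=p^f$, and an embedding $\mathbb{F}_q\hookrightarrow k$ is fixed. $K_1$ is the kernel of the reduction map $K\to \mathrm{GL}_2(k_F)$. All representations are on $k$-vector spaces. For $\lambda\in\mathbb{F}_q$, $[\lambda]\in\mathcal{O}$ is its Teichmüller lift. A representation is smooth if every vector has open stabilizer; a smooth representation of $G$ is admissible if its space of $H$-invariants is finite-dimensional over $k$ for every open subgroup $H$ of $G$. Irreducible representations of $KZ$. For $\vec r=(r_0,\dots,r_{f-1})$ with $0\le r_j\le p-1$, let $\mathrm{Sym}^{\vec r}$ be the representation of $\mathrm{GL}_2(\mathbb{F}_q)$ with basis $x^{\vec r-\vec i}y^{\vec i}:=\otimes_{j=0}^{f-1}x_j^{r_j-i_j}y_j^{i_j}$, $\vec 0\le\vec i\le\vec r$ (componentwise order), and action $$\begin{pmatrix}a&b\\c&d\end{pmatrix}\cdot\otimes_j x_j^{r_j-i_j}y_j^{i_j}=\otimes_j(a^{p^j}x_j+c^{p^j}y_j)^{r_j-i_j}(b^{p^j}x_j+d^{p^j}y_j)^{i_j}.$$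 Every smooth irreducible representation $\sigma$ of $KZ$ is, restricted to $K$, isomorphic to the inflation (with $K_1$ acting trivially) of $(\chi\circ\det)\otimes\mathrm{Sym}^{\vec r}$ for a unique character $\chi:\mathbb{F}_q^\times\to k^\times$ and a unique $\vec r$, with $\begin{pmatrix}\varpi&0\\0&\varpi\end{pmatrix}$ acting by a scalar $\nu\in k^\times$; one identifies the space of $\sigma$ with that of $\mathrm{Sym}^{\vec r}$. Compact induction. $\mathrm{ind}_{KZ}^G\sigma$ is the space of functions $h:G\to\sigma$, compactly supported modulo $KZ$, with $h(\kappa g)=\kappa\cdot h(g)$ for all $\kappa\in KZ$, $g\in G$, with $G$ acting by right translation. For $g\in G$, $w\in\sigma$, $[g,w]$ is the element with $[g,w](g')=g'g\cdot w$ if $g'g\in KZ$ and $0$ otherwise; so $g'\cdot[g,w]=[g'g,w]$. Hecke operator. $T\in\mathrm{End}_G(\mathrm{ind}_{KZ}^G\sigma)$ is the $G$-equivariant endomorphism determined by $$T\Big(\Big[1,\sum_{\vec 0\le\vec i\le\vec r}u_{\vec i}x^{\vec r-\vec i}y^{\vec i}\Big]\Big)=\sum_{\lambda\in\mathbb{F}_q}\Big[\begin{pmatrix}\varpi&[\lambda]\\0&1\end{pmatrix},\Big(\sum_{\vec 0\le\vec i\le\vec r}u_{\vec i}(-\lambda)^{\vec i}\Big)x^{\vec r}\Big]+\Big[\begin{pmatrix}1&0\\0&\varpi\end{pmatrix},u_{\vec r}\,y^{\vec r}\Big],$$ where $u_{\vec i}\in k$ and $\lambda^{\vec i}:=\lambda^{\sum_j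 p^ji_j}$ (with $0^0=1$). *)

theory Defs
  imports
    "HOL-Algebra.Algebra"
    "HOL-Algebra.Algebraic_Closure_Type"
    "HOL-Analysis.Analysis"
begin

section \<open>Finite extensions of \<open>\<rat>\<^sub>p\<close>\<close>

definition padic_abs :: "nat \<Rightarrow> rat \<Rightarrow> real" where
  "padic_abs p x =
     (if x = 0 then 0
      else real p powi (int (multiplicity (int p) (snd (quotient_of x)))
                      - int (multiplicity (int p) (fst (quotient_of x)))))"

definition adist :: "('f::field_char_0 \<Rightarrow> real) \<Rightarrow> 'f \<Rightarrow> 'f \<Rightarrow> real" where
  "adist nrm x y = nrm (x - y)"

definition Qp :: "('f::field_char_0 \<Rightarrow> real) \<Rightarrow> 'f set" where
  "Qp nrm = (Metric_space.mtopology UNIV (adist nrm)) closure_of \<rat>"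

text \<open>
  A finite extension \<open>F\<close> of \<open>\<rat>\<^sub>p\<close>, given with its absolute value (the one extending the
  \<open>p\<close>-adic absolute value of \<open>\<rat>\<close>). The field \<open>\<rat>\<^sub>p\<close>, i.e. the completion of \<open>\<rat>\<close>, appears
  inside \<open>F\<close> as the closure of \<open>\<rat>\<close>, which is required to be complete.
\<close>

locale padic_field =
  fixes p :: nat and nrm :: "'f::field_char_0 \<Rightarrow> real"
  assumes prime_p: "Factorial_Ring.prime p"
    and nrm_nonneg: "0 \<le> nrm x"
    and nrm_eq_0_iff: "nrm x = 0 \<longleftrightarrow> x = 0"
    and nrm_mult: "nrm (x * y) = nrm x * nrm y"
    and nrm_add: "nrm (x + y) \<le> max (nrm x) (nrm y)"
    and nrm_of_rat: "nrm (of_rat a) = padic_abs p a"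
    and Qp_complete: "Metric_space.mcomplete (Qp nrm) (adist nrm)"
    and finite_over_Qp:
      "\<exists>B. finite B \<and> (\<forall>x. \<exists>c. (\<forall>b\<in>B. c b \<in> Qp nrm) \<and> x = (\<Sum>b\<in>B. c b * b))"

definition int_ring :: "('f::field_char_0 \<Rightarrow> real) \<Rightarrow> 'f ring" where
  "int_ring nrm = ring_of_type_algebra\<lparr>carrier := {x. nrm x \<le> 1}\<rparr>"

definition max_ideal :: "('f::field_char_0 \<Rightarrow> real) \<Rightarrow> 'f set" where
  "max_ideal nrm = {x. nrm x < 1}"

definition uniformizer :: "('f::field_char_0 \<Rightarrow> real) \<Rightarrow> 'f \<Rightarrow> bool" where
  "uniformizer nrm \<pi> \<longleftrightarrow>
     \<pi> \<in> carrier (int_ring nrm) \<and> max_ideal nrm = PIdl\<^bsub>int_ring nrm\<^esub> \<pi>"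

definition residue_field :: "('f::field_char_0 \<Rightarrow> real) \<Rightarrow> 'f set ring" where
  "residue_field nrm = int_ring nrm Quot max_ideal nrm"

definition res :: "('f::field_char_0 \<Rightarrow> real) \<Rightarrow> 'f \<Rightarrow> 'f set" where
  "res nrm x = max_ideal nrm +>\<^bsub>int_ring nrm\<^esub> x"

text \<open>
  The elements of the residue field are cosets in the ring of integers, so \<open>x \<in> l\<close>
  says that \<open>x\<close> is an integral lift of \<open>l\<close>.
\<close>

definition teichmueller :: "('f::field_char_0 \<Rightarrow> real) \<Rightarrow> 'f set \<Rightarrow> 'f" where
  "teichmueller nrm l = (THE x. x \<in> l \<and> x ^ card (carrier (residue_field nrm)) = x)"


section \<open>The groups\<close>

definition mat2 :: "'a::zero \<Rightarrow> 'a \<Rightarrow> 'a \<Rightarrow> 'a \<Rightarrow> 'a^2^2" where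
  "mat2 a b c d = vector [vector [a, b], vector [c, d]]"

definition GL2 :: "('f::field^2^2) monoid" where
  "GL2 = \<lparr>carrier = {g. invertible g}, monoid.mult = (**), one = mat 1\<rparr>"

definition GL2_int :: "('f::field_char_0 \<Rightarrow> real) \<Rightarrow> ('f^2^2) set" where
  "GL2_int nrm = {g \<in> carrier GL2. (\<forall>i j. nrm (g $ i $ j) \<le> 1) \<and> nrm (det g) = 1}"

definition GL2_center :: "('f::field^2^2) set" where
  "GL2_center = {z \<in> carrier GL2. \<forall>g \<in> carrier GL2. z ** g = g ** z}"

definition KZ :: "('f::field_char_0 \<Rightarrow> real) \<Rightarrow> ('f^2^2) set" where
  "KZ nrm = GL2_int nrm <#>\<^bsub>GL2\<^esub> GL2_center"

text \<open>The topology induced on \<open>GL\<^sub>2(F)\<close> by that of \<open>M\<^sub>2(F)\<close>; inversion is continuous for it.\<close>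

definition GL2_topology :: "('f::field_char_0 \<Rightarrow> real) \<Rightarrow> ('f^2^2) topology" where
  "GL2_topology nrm =
     Metric_space.mtopology (carrier GL2) (\<lambda>g h. Max {nrm (g $ i $ j - h $ i $ j) |i j. True})"


section \<open>Representations on \<open>k\<close>-vector spaces\<close>

text \<open>
  A \<open>k\<close>-vector space is a module over \<open>ring_of_type_algebra :: 'k ring\<close>. The record
  components \<open>mult\<close> and \<open>one\<close>, which records of modules inherit from rings, play no role.
\<close>

definition lin_maps :: "('k::field, 'v) module \<Rightarrow> ('k, 'w) module \<Rightarrow> ('v \<Rightarrow> 'w) set" where
  "lin_maps V W = {T \<in> carrier V \<rightarrow> carrier W.
     (\<forall>v\<in>carrier V. \<forall>w\<in>carrier V. T (v \<oplus>\<^bsub>V\<^esub> w) = T v \<oplus>\<^bsub>W\<^esub> T w) \<and>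
     (\<forall>c. \<forall>v\<in>carrier V. T (c \<odot>\<^bsub>V\<^esub> v) = c \<odot>\<^bsub>W\<^esub> T v)}"

definition representation ::
  "'g monoid \<Rightarrow> ('k::field, 'v) module \<Rightarrow> ('g \<Rightarrow> 'v \<Rightarrow> 'v) \<Rightarrow> bool" where
  "representation \<Gamma> V \<rho> \<longleftrightarrow>
     Module.module (ring_of_type_algebra :: 'k ring) V \<and>
     (\<forall>g\<in>carrier \<Gamma>. \<rho> g \<in> lin_maps V V) \<and>
     (\<forall>v\<in>carrier V. \<rho> \<one>\<^bsub>\<Gamma>\<^esub> v = v) \<and>
     (\<forall>g\<in>carrier \<Gamma>. \<forall>h\<in>carrier \<Gamma>. \<forall>v\<in>carrier V. \<rho> (g \<otimes>\<^bsub>\<Gamma>\<^esub> h) v = \<rho> g (\<rho> h v))"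

definition irreducible_rep ::
  "'g monoid \<Rightarrow> ('k::field, 'v) module \<Rightarrow> ('g \<Rightarrow> 'v \<Rightarrow> 'v) \<Rightarrow> bool" where
  "irreducible_rep \<Gamma> V \<rho> \<longleftrightarrow>
     representation \<Gamma> V \<rho> \<and> carrier V \<noteq> {\<zero>\<^bsub>V\<^esub>} \<and>
     (\<forall>W. submodule W (ring_of_type_algebra :: 'k ring) V \<and> (\<forall>g\<in>carrier \<Gamma>. \<rho> g ` W \<subseteq> W)
        \<longrightarrow> W = {\<zero>\<^bsub>V\<^esub>} \<or> W = carrier V)"

definition smooth_rep ::
  "('f::field_char_0 \<Rightarrow> real) \<Rightarrow> ('f^2^2) set \<Rightarrow> ('k::field, 'v) module
     \<Rightarrow> ('f^2^2 \<Rightarrow> 'v \<Rightarrow> 'v) \<Rightarrow> bool" where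
  "smooth_rep nrm S V \<rho> \<longleftrightarrow>
     (\<forall>v\<in>carrier V. openin (subtopology (GL2_topology nrm) S) {g \<in> S. \<rho> g v = v})"

definition fin_dim :: "('k::field, 'v) module \<Rightarrow> 'v set \<Rightarrow> bool" where
  "fin_dim V U \<longleftrightarrow>
     (\<exists>B. finite B \<and> B \<subseteq> U \<and> (\<forall>u\<in>U. \<exists>c. u = (\<Oplus>\<^bsub>V\<^esub>b\<in>B. c b \<odot>\<^bsub>V\<^esub> b)))"

definition invariants :: "'g set \<Rightarrow> ('k::field, 'v) module \<Rightarrow> ('g \<Rightarrow> 'v \<Rightarrow> 'v) \<Rightarrow> 'v set" where
  "invariants H V \<rho> = {v \<in> carrier V. \<forall>h\<in>H. \<rho> h v = v}"

text \<open>
  Admissibility of a smooth representation of \<open>GL\<^sub>2(F)\<close>. Smoothness is a precondition and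
  deliberately not a conjunct, so that the negation says that some open subgroup has an
  infinite-dimensional space of invariants.
\<close>

definition admissible ::
  "('f::field_char_0 \<Rightarrow> real) \<Rightarrow> ('k::field, 'v) module \<Rightarrow> ('f^2^2 \<Rightarrow> 'v \<Rightarrow> 'v) \<Rightarrow> bool" where
  "admissible nrm V \<rho> \<longleftrightarrow>
     (\<forall>H. subgroup H GL2 \<and> openin (GL2_topology nrm) H \<longrightarrow> fin_dim V (invariants H V \<rho>))"

definition quot_space :: "('k::field, 'v) module \<Rightarrow> 'v set \<Rightarrow> ('k, 'v set) module" where
  "quot_space V W =
     \<lparr>carrier = a_rcosets\<^bsub>V\<^esub> W, monoid.mult = undefined, one = undefined, ring.zero = W, add = set_add V,
      module.smult = (\<lambda>c A. \<Union>a\<in>A. W +>\<^bsub>V\<^esub> (c \<odot>\<^bsub>V\<^esub> a))\<rparr>"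

text \<open>For a stable subspace \<open>W\<close> and invertible \<open>g\<close>, the image of \<open>W + v\<close> is \<open>W + \<rho> g v\<close>.\<close>

definition quot_action :: "('g \<Rightarrow> 'v \<Rightarrow> 'v) \<Rightarrow> 'g \<Rightarrow> 'v set \<Rightarrow> 'v set" where
  "quot_action \<rho> g A = \<rho> g ` A"


section \<open>The representations \<open>Sym\<^sup>r\<close>\<close>

text \<open>
  Exponents \<open>(i\<^sub>0, \<dots>, i\<^bsub>f-1\<^esub>)\<close> are functions on \<open>nat\<close> that vanish from \<open>f\<close> on, ordered
  pointwise. An element of \<open>Sym\<^sup>r\<close> is its family of coefficients: \<open>u i\<close> is the coefficient
  of \<open>x\<^bsup>r-i\<^esup> y\<^sup>i\<close>.
\<close>

definition Sym :: "(nat \<Rightarrow> nat) \<Rightarrow> ('k::field, (nat \<Rightarrow> nat) \<Rightarrow> 'k) module" where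
  "Sym r =
     \<lparr>carrier = {u. \<forall>i. u i \<noteq> 0 \<longrightarrow> i \<le> r}, monoid.mult = undefined, one = undefined,
      ring.zero = (\<lambda>i. 0), add = (\<lambda>u v i. u i + v i), module.smult = (\<lambda>c u i. c * u i)\<rparr>"

definition monomial :: "(nat \<Rightarrow> nat) \<Rightarrow> (nat \<Rightarrow> nat) \<Rightarrow> 'k::field" where
  "monomial i = (\<lambda>l. if l = i then 1 else 0)"

text \<open>
  Setting \<open>x\<^sub>j = 1\<close>, the factor \<open>(a\<^bsup>p^j\<^esup> x\<^sub>j + c\<^bsup>p^j\<^esup> y\<^sub>j)\<^bsup>r\<^sub>j - i\<^sub>j\<^esup> (b\<^bsup>p^j\<^esup> x\<^sub>j + d\<^bsup>p^j\<^esup> y\<^sub>j)\<^bsup>i\<^sub>j\<^esup>\<close>,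
  which is homogeneous of degree \<open>r\<^sub>j\<close>, becomes a polynomial in \<open>y\<^sub>j\<close>; its coefficient in
  degree \<open>l\<^sub>j\<close> is that of \<open>x\<^sub>j\<^bsup>r\<^sub>j - l\<^sub>j\<^esup> y\<^sub>j\<^bsup>l\<^sub>j\<^esup>\<close>.
\<close>

definition sym_act ::
  "nat \<Rightarrow> nat \<Rightarrow> (nat \<Rightarrow> nat) \<Rightarrow> 'k::field^2^2 \<Rightarrow> ((nat \<Rightarrow> nat) \<Rightarrow> 'k) \<Rightarrow> (nat \<Rightarrow> nat) \<Rightarrow> 'k" where
  "sym_act p f r A u l =
     (if l \<le> r then
        \<Sum>i\<in>{..r}. u i *
          (\<Prod>j<f. Polynomial.coeff ([:(A$1$1) ^ (p^j), (A$2$1) ^ (p^j):] ^ (r j - i j)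
                      * [:(A$1$2) ^ (p^j), (A$2$2) ^ (p^j):] ^ (i j)) (l j))
      else 0)"

text \<open>
  The identification of the space of a representation \<open>\<rho>\<close> of \<open>KZ\<close> on \<open>V\<close> with that of
  \<open>Sym\<^sup>r\<close>: the linear isomorphism \<open>\<phi>\<close> takes \<open>\<rho>\<close> on \<open>K\<close> to the inflation of
  \<open>(\<eta> \<circ> det) \<otimes> Sym\<^sup>r\<close>, and the scalar matrix of the uniformizer \<open>\<pi>\<close> acts by \<open>\<nu>\<close>. The map
  \<open>\<iota>\<close> is the embedding of the residue field, of order \<open>p\<^sup>f\<close>, in \<open>k\<close>.
\<close>

definition sym_identification ::
  "nat \<Rightarrow> nat \<Rightarrow> ('f::field_char_0 \<Rightarrow> real) \<Rightarrow> 'f \<Rightarrow> ('f set \<Rightarrow> 'k::field)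
     \<Rightarrow> ('k, 'v) module \<Rightarrow> ('f^2^2 \<Rightarrow> 'v \<Rightarrow> 'v)
     \<Rightarrow> ('f set \<Rightarrow> 'k) \<Rightarrow> (nat \<Rightarrow> nat) \<Rightarrow> 'k \<Rightarrow> ('v \<Rightarrow> (nat \<Rightarrow> nat) \<Rightarrow> 'k) \<Rightarrow> bool" where
  "sym_identification p f nrm \<pi> \<iota> V \<rho> \<eta> r \<nu> \<phi> \<longleftrightarrow>
     \<eta> \<in> hom (units_of (residue_field nrm)) (units_of ring_of_type_algebra) \<and>
     (\<forall>j<f. r j \<le> p - 1) \<and> (\<forall>j\<ge>f. r j = 0) \<and> \<nu> \<noteq> 0 \<and>
     \<phi> \<in> lin_maps V (Sym r) \<and> bij_betw \<phi> (carrier V) (carrier (Sym r)) \<and>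
     (\<forall>\<kappa>\<in>GL2_int nrm. \<forall>v\<in>carrier V.
        \<phi> (\<rho> \<kappa> v) = \<eta> (res nrm (det \<kappa>)) \<odot>\<^bsub>Sym r\<^esub>
                     sym_act p f r (\<chi> a b. \<iota> (res nrm (\<kappa> $ a $ b))) (\<phi> v)) \<and>
     (\<forall>v\<in>carrier V. \<rho> (mat \<pi>) v = \<nu> \<odot>\<^bsub>V\<^esub> v)"


section \<open>Compact induction and the Hecke operator\<close>

text \<open>Functions on \<open>GL\<^sub>2(F)\<close> are extended by zero to all matrices.\<close>

definition cind ::
  "('f::field_char_0 \<Rightarrow> real) \<Rightarrow> ('k::field, 'v) module \<Rightarrow> ('f^2^2 \<Rightarrow> 'v \<Rightarrow> 'v)
     \<Rightarrow> ('k, 'f^2^2 \<Rightarrow> 'v) module" where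
  "cind nrm V \<rho> =
     \<lparr>carrier = {h. (\<forall>g. g \<notin> carrier GL2 \<longrightarrow> h g = \<zero>\<^bsub>V\<^esub>) \<and>
                    (\<forall>g\<in>carrier GL2. h g \<in> carrier V) \<and>
                    (\<forall>\<kappa>\<in>KZ nrm. \<forall>g\<in>carrier GL2. h (\<kappa> ** g) = \<rho> \<kappa> (h g)) \<and>
                    (\<exists>C. compactin (GL2_topology nrm) C \<and>
                         {g \<in> carrier GL2. h g \<noteq> \<zero>\<^bsub>V\<^esub>} \<subseteq> KZ nrm <#>\<^bsub>GL2\<^esub> C)},
      monoid.mult = undefined, one = undefined,
      ring.zero = (\<lambda>g. \<zero>\<^bsub>V\<^esub>), add = (\<lambda>h h' g. h g \<oplus>\<^bsub>V\<^esub> h' g), module.smult = (\<lambda>c h g. c \<odot>\<^bsub>V\<^esub> h g)\<rparr>"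

definition right_translation :: "'f::field^2^2 \<Rightarrow> ('f^2^2 \<Rightarrow> 'v) \<Rightarrow> 'f^2^2 \<Rightarrow> 'v" where
  "right_translation g h = (\<lambda>g'. h (g' ** g))"

definition std_fun ::
  "('f::field_char_0 \<Rightarrow> real) \<Rightarrow> ('k::field, 'v) module \<Rightarrow> ('f^2^2 \<Rightarrow> 'v \<Rightarrow> 'v)
     \<Rightarrow> 'f^2^2 \<Rightarrow> 'v \<Rightarrow> 'f^2^2 \<Rightarrow> 'v" where
  "std_fun nrm V \<rho> g w =
     (\<lambda>g'. if g' \<in> carrier GL2 \<and> g' ** g \<in> KZ nrm then \<rho> (g' ** g) w else \<zero>\<^bsub>V\<^esub>)"

text \<open>
  \<open>T\<close> is the \<open>G\<close>-endomorphism of the compact induction given by the formula on the functions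
  supported on \<open>KZ\<close>. Vectors \<open>v\<close> of \<open>V\<close> are written through the identification \<open>\<phi>\<close> with
  \<open>Sym\<^sup>r\<close>, so that \<open>u\<^sub>i = \<phi> v i\<close>. As these functions generate the induction, \<open>T\<close> is
  determined on it; values of \<open>T\<close> outside the induction are irrelevant.
\<close>

definition hecke_operator ::
  "nat \<Rightarrow> nat \<Rightarrow> ('f::field_char_0 \<Rightarrow> real) \<Rightarrow> 'f \<Rightarrow> ('f set \<Rightarrow> 'k::field)
     \<Rightarrow> ('k, 'v) module \<Rightarrow> ('f^2^2 \<Rightarrow> 'v \<Rightarrow> 'v) \<Rightarrow> (nat \<Rightarrow> nat) \<Rightarrow> ('v \<Rightarrow> (nat \<Rightarrow> nat) \<Rightarrow> 'k)
     \<Rightarrow> (('f^2^2 \<Rightarrow> 'v) \<Rightarrow> 'f^2^2 \<Rightarrow> 'v) \<Rightarrow> bool" where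
  "hecke_operator p f nrm \<pi> \<iota> V \<rho> r \<phi> T \<longleftrightarrow>
     T \<in> lin_maps (cind nrm V \<rho>) (cind nrm V \<rho>) \<and>
     (\<forall>g\<in>carrier GL2. \<forall>h\<in>carrier (cind nrm V \<rho>).
        T (right_translation g h) = right_translation g (T h)) \<and>
     (\<forall>v\<in>carrier V.
        T (std_fun nrm V \<rho> (mat 1) v) =
          (\<Oplus>\<^bsub>cind nrm V \<rho>\<^esub>l\<in>carrier (residue_field nrm).
             std_fun nrm V \<rho> (mat2 \<pi> (teichmueller nrm l) 0 1)
               (inv_into (carrier V) \<phi>
                  ((\<Sum>i\<in>{..r}. \<phi> v i * (- \<iota> l) ^ (\<Sum>j<f. p^j * i j)) \<odot>\<^bsub>Sym r\<^esub> monomial (\<lambda>_. 0))))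
          \<oplus>\<^bsub>cind nrm V \<rho>\<^esub>
          std_fun nrm V \<rho> (mat2 1 0 0 \<pi>)
            (inv_into (carrier V) \<phi> (\<phi> v r \<odot>\<^bsub>Sym r\<^esub> monomial r)))"

end

theory Submission
  imports Defs
begin

text \<open>
  Write \<open>\<pi>\<close> for the uniformizer. By the Iwasawa decomposition the vertices of the tree are the
  cosets of the matrices \<open>(\<pi>\<^sup>n, \<mu>; 0, 1)\<close>, and \<open>T\<close> moves level \<open>n\<close> to the levels \<open>n + 1\<close> and
  \<open>n - 1\<close>. The group \<open>H\<close> of matrices congruent to \<open>1\<close> modulo \<open>\<pi>\<^sup>2\<close> acts on functions of
  \<open>\<mu> \<in> \<O>\<close> on a level \<open>n \<ge> 0\<close> by Moebius transformations, that is, by translations up to higher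
  order.

  For every \<open>n \<ge> 2\<close> there is an element \<open>e\<^sub>n\<close> on level \<open>n\<close> which is invariant under \<open>H\<close> modulo
  the image of \<open>T\<close>: it is built from a digit of \<open>\<mu>\<close>, and the change of this digit under
  \<open>h \<in> H\<close> yields a function \<open>G\<close> on level \<open>n - 1\<close> such that \<open>h e\<^sub>n - e\<^sub>n\<close> is the part of \<open>T G\<close> on
  level \<open>n\<close>. The part of \<open>T G\<close> on level \<open>n - 2\<close> vanishes, either for trivial reasons depending on
  \<open>r\<close>, or because it is a corestriction, i.e. multiplication by \<open>q\<close> on an additive character of
  \<open>\<pi>\<^bsup>n-1\<^esup>\<O>/\<pi>\<^sup>n\<O>\<close>, and \<open>q/\<pi>\<close> is not a unit if \<open>F \<noteq> \<rat>\<^sub>p\<close>. Looking at the top level of a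
  preimage under \<open>T\<close> shows that the \<open>e\<^sub>n\<close> are linearly independent modulo the image of \<open>T\<close>.
\<close>

text \<open>Two demands on \<open>e\<^sub>n\<close> compete. On the vertices of level n next to a
  vertex of level n - 1, its change under \<open>h\<close> must be the value function on the residue
  field of a vector of \<open>Sym r\<close>, since this is all that \<open>T\<close> produces there;
  but \<open>e\<^sub>n\<close> itself must not arise in this way. Value functions are polynomials
  whose exponents have base p digits bounded by r. If r = 0, or if some r_j has room while another
  r_j' is positive, a power of the last digit of \<mu> with exponent just outside this range meets
  both demands. If r is maximal, every function is a value function, and \<open>e\<^sub>n\<close>
  takes values outside the line of x^r instead; the same shape serves f = 1 with r \<noteq> 0, where
  no second index is available. It involves the digit one place further, which carries can reach;
  for f = 1 the digits 0, ..., p - 1 are taken, whose carries are divisible by p, hence by \<pi>^2.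

  The congruence level is 2 because forming a carry costs one division by \<pi>, after which the
  second-order error of a Moebius transformation must still reduce to 0.\<close>

no_notation fps_nth (infixl \<open>$\<close> 75)

section \<open>Arithmetic of \<open>F\<close>\<close>

locale residue_embedding = padic_field p nrm
  for p :: nat and nrm :: "'f::field_char_0 \<Rightarrow> real" +
  fixes f :: nat and \<pi> :: 'f and \<iota> :: "'f set \<Rightarrow> 'k::field"
  assumes F_neq_Qp: "Qp nrm \<noteq> (UNIV :: 'f set)"
    and unif: "uniformizer nrm \<pi>"
    and res_card: "card (carrier (residue_field nrm)) = p ^ f"
    and char_k: "CHAR('k) = p"
    and embedding: "\<iota> \<in> ring_hom (residue_field nrm) (ring_of_type_algebra :: 'k ring)"
begin

abbreviation valint :: "'f \<Rightarrow> bool" where "valint x \<equiv> nrm x \<le> 1"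

text \<open>Reduction composed with the embedding \<open>\<iota>\<close>, so that all residue
  arithmetic takes place inside \<open>k\<close>. The image \<open>residues\<close> is the copy of
  the field with q elements in \<open>k\<close>.\<close>

definition red :: "'f \<Rightarrow> 'k" where "red x = \<iota> (res nrm x)"

definition residues :: "'k set" where "residues = red ` {x. valint x}"

lemma nrm_0 [simp]: "nrm 0 = 0"
  by (simp add: nrm_eq_0_iff)

lemma nrm_1 [simp]: "nrm 1 = 1"
proof -
  have "nrm 1 * nrm 1 = nrm 1" by (metis mult_1 nrm_mult)
  then show ?thesis using nrm_eq_0_iff[of 1] by simp
qed

lemma nrm_minus [simp]: "nrm (- x) = nrm x"
proof -
  have "nrm (-1) * nrm (-1) = 1" by (metis minus_mult_minus mult_1 nrm_1 nrm_mult)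
  then have "nrm (-1) = 1" using nrm_nonneg[of "-1"]
    by (metis abs_of_nonneg abs_square_eq_1 power2_eq_square)
  then show ?thesis by (metis mult_1 mult_minus_left nrm_mult)
qed

lemma nrm_diff: "nrm (x - y) \<le> max (nrm x) (nrm y)"
  using nrm_add[of x "- y"] by simp

lemma nrm_diff_commute: "nrm (x - y) = nrm (y - x)"
  by (metis minus_diff_eq nrm_minus)

lemma nrm_inverse: "nrm (inverse x) = inverse (nrm x)"
proof (cases "x = 0")
  case False
  then have "nrm x * nrm (inverse x) = 1" by (metis nrm_1 nrm_mult right_inverse)
  then show ?thesis by (metis inverse_unique)
qed simp

lemma nrm_divide: "nrm (x / y) = nrm x / nrm y"
  by (simp add: divide_inverse nrm_inverse nrm_mult)

lemma nrm_power: "nrm (x ^ n) = nrm x ^ n"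
  by (induction n) (auto simp: nrm_mult)

lemma nrm_power_int: "nrm (x powi n) = nrm x powi n"
  by (simp add: power_int_def nrm_power nrm_inverse)

lemma nrm_pos_iff: "0 < nrm x \<longleftrightarrow> x \<noteq> 0"
  using nrm_nonneg[of x] nrm_eq_0_iff[of x] by linarith

lemma nrm_of_nat: "valint (of_nat n)"
proof (induction n)
  case (Suc n)
  then show ?case using nrm_add[of "of_nat n" 1] by (simp add: add.commute)
qed simp

lemma nrm_p: "nrm (of_nat p) = 1 / real p"
proof -
  have "nrm (of_nat p) = padic_abs p (of_nat p)" using nrm_of_rat[of "of_nat p"] by simp
  also have "\<dots> = real p powi (- 1)"
    using prime_p by (auto simp: padic_abs_def quotient_of_int[of "int p", simplified])
  finally show ?thesis by (simp add: power_int_minus divide_inverse)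
qed

lemma nrm_p_less_1: "nrm (of_nat p) < 1"
  using prime_gt_1_nat[OF prime_p] by (simp add: nrm_p)

lemma valint_add [intro]: "valint x \<Longrightarrow> valint y \<Longrightarrow> valint (x + y)"
  using nrm_add[of x y] by simp

lemma valint_diff [intro]: "valint x \<Longrightarrow> valint y \<Longrightarrow> valint (x - y)"
  using nrm_diff[of x y] by simp

lemma valint_mult [intro]: "valint x \<Longrightarrow> valint y \<Longrightarrow> valint (x * y)"
  by (simp add: nrm_mult mult_le_one nrm_nonneg)

lemma valint_power [intro]: "valint x \<Longrightarrow> valint (x ^ n)"
  by (simp add: nrm_power nrm_nonneg power_le_one)

lemma valint_sum: "(\<And>a. a \<in> A \<Longrightarrow> valint (g a)) \<Longrightarrow> valint (sum g A)"
  by (induction A rule: infinite_finite_induct) (auto intro: valint_add)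

section \<open>Integers, residue field and reduction into \<open>k\<close>\<close>

lemma int_ring_simps [simp]:
  "carrier (int_ring nrm) = {x. valint x}"
  "x \<otimes>\<^bsub>int_ring nrm\<^esub> y = x * y" "x \<oplus>\<^bsub>int_ring nrm\<^esub> y = x + y"
  "\<one>\<^bsub>int_ring nrm\<^esub> = 1" "\<zero>\<^bsub>int_ring nrm\<^esub> = 0"
  by (simp_all add: int_ring_def ring_of_type_algebra_def)

lemma int_ring_cring: "cring (int_ring nrm)"
proof (rule cringI)
  show "abelian_group (int_ring nrm)"
  proof (rule abelian_groupI)
    fix x assume "x \<in> carrier (int_ring nrm)"
    then show "\<exists>y\<in>carrier (int_ring nrm). y \<oplus>\<^bsub>int_ring nrm\<^esub> x = \<zero>\<^bsub>int_ring nrm\<^esub>"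
      by (intro bexI[of _ "- x"]) auto
  qed (auto simp: algebra_simps)
  show "comm_monoid (int_ring nrm)"
    by (rule comm_monoidI) (auto simp: algebra_simps)
qed (auto simp: algebra_simps)

lemma max_ideal_ideal: "ideal (max_ideal nrm) (int_ring nrm)"
proof -
  interpret cring "int_ring nrm" by (rule int_ring_cring)
  show ?thesis using unif cgenideal_ideal unfolding uniformizer_def by metis
qed

lemma red_hom: "red \<in> ring_hom (int_ring nrm) (ring_of_type_algebra :: 'k ring)"
proof -
  have "\<iota> \<circ> res nrm \<in> ring_hom (int_ring nrm) (ring_of_type_algebra :: 'k ring)"
    using embedding ideal.rcos_ring_hom[OF max_ideal_ideal]
    unfolding residue_field_def res_def[abs_def] by (rule ring_hom_trans[rotated])
  then show ?thesis by (simp add: red_def[abs_def] comp_def)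
qed

lemma red_add: "valint x \<Longrightarrow> valint y \<Longrightarrow> red (x + y) = red x + red y"
  using ring_hom_add[OF red_hom, of x y] by (simp add: ring_of_type_algebra_def)

lemma red_mult: "valint x \<Longrightarrow> valint y \<Longrightarrow> red (x * y) = red x * red y"
  using ring_hom_mult[OF red_hom, of x y] by (simp add: ring_of_type_algebra_def)

lemma red_1 [simp]: "red 1 = 1"
  using ring_hom_one[OF red_hom] by (simp add: ring_of_type_algebra_def)

lemma red_0 [simp]: "red 0 = 0"
  using red_add[of 0 0] by (metis add_0 add_cancel_left_left nrm_0 zero_le_one)

lemma red_minus: "valint x \<Longrightarrow> red (- x) = - red x"
  using red_add[of x "- x"] by (simp add: eq_neg_iff_add_eq_0 add.commute)

lemma red_diff: "valint x \<Longrightarrow> valint y \<Longrightarrow> red (x - y) = red x - red y"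
  using red_add[of x "- y"] by (simp add: red_minus)

lemma red_sum: "(\<And>a. a \<in> A \<Longrightarrow> valint (g a)) \<Longrightarrow> red (sum g A) = (\<Sum>a\<in>A. red (g a))"
  by (induction A rule: infinite_finite_induct) (auto simp: red_add valint_sum)

lemma res_eq_iff: "valint x \<Longrightarrow> valint y \<Longrightarrow> res nrm x = res nrm y \<longleftrightarrow> nrm (x - y) < 1"
proof -
  assume xy: "valint x" "valint y"
  interpret ideal "max_ideal nrm" "int_ring nrm" by (rule max_ideal_ideal)
  have minus: "\<ominus>\<^bsub>int_ring nrm\<^esub> y = - y"
    using xy by (intro minus_equality) auto
  have "res nrm x = res nrm y \<longleftrightarrow> x \<ominus>\<^bsub>int_ring nrm\<^esub> y \<in> max_ideal nrm"
    using quotient_eq_iff_same_a_r_cos[OF max_ideal_ideal, of x y] xy by (simp add: res_def)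
  then show ?thesis using xy by (simp add: a_minus_def minus max_ideal_def)
qed

lemma mem_res_iff: "valint x \<Longrightarrow> y \<in> res nrm x \<longleftrightarrow> nrm (y - x) < 1"
proof -
  assume x: "valint x"
  have "y \<in> res nrm x \<longleftrightarrow> (\<exists>h. nrm h < 1 \<and> y = h + x)"
    using x by (auto simp: res_def a_r_coset_def' max_ideal_def)
  then show ?thesis by (metis add_diff_cancel_right' diff_add_cancel)
qed

lemma red_eq_0_iff: assumes "valint x" shows "red x = 0 \<longleftrightarrow> nrm x < 1"
proof
  assume "nrm x < 1"
  then have "res nrm x = res nrm 0" using assms res_eq_iff[of x 0] by simp
  then show "red x = 0" using red_0 by (simp add: red_def)
next
  assume *: "red x = 0"
  show "nrm x < 1"
  proof (rule ccontr)
    assume "\<not> nrm x < 1"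
    with assms have 1: "nrm x = 1" by simp
    then have "x \<noteq> 0" by auto
    then have "1 = red (x * inverse x)" by simp
    also have "\<dots> = 0" using 1 * by (subst red_mult) (auto simp: nrm_inverse)
    finally show False by simp
  qed
qed

lemma red_eq_iff: "valint x \<Longrightarrow> valint y \<Longrightarrow> red x = red y \<longleftrightarrow> nrm (x - y) < 1"
  using red_eq_0_iff[of "x - y"] by (auto simp: red_diff valint_diff)

lemma carrier_residue_field: "carrier (residue_field nrm) = res nrm ` {x. valint x}"
  by (auto simp: residue_field_def FactRing_def A_RCOSETS_def' res_def)

lemma bij_residues: "bij_betw \<iota> (carrier (residue_field nrm)) residues"
  unfolding bij_betw_def carrier_residue_field residues_def
  by (auto simp: inj_on_def res_eq_iff red_eq_iff[symmetric] image_image red_def)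

lemma card_residues: "card residues = p ^ f"
  using bij_betw_same_card[OF bij_residues] res_card by simp

lemma finite_residues [simp]: "finite residues"
  using card_residues prime_gt_0_nat[OF prime_p] by (intro card_ge_0_finite) simp

lemma finite_residue_field: "finite (carrier (residue_field nrm))"
  using bij_betw_finite[OF bij_residues] by simp

lemma red_in_residues [simp]: "valint x \<Longrightarrow> red x \<in> residues"
  by (auto simp: residues_def)

lemma residues_closed:
  "0 \<in> residues" "1 \<in> residues"
  "a \<in> residues \<Longrightarrow> b \<in> residues \<Longrightarrow> a + b \<in> residues"
  "a \<in> residues \<Longrightarrow> b \<in> residues \<Longrightarrow> a * b \<in> residues"
  "a \<in> residues \<Longrightarrow> - a \<in> residues"
  "a \<in> residues \<Longrightarrow> b \<in> residues \<Longrightarrow> a - b \<in> residues"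
proof -
  show "0 \<in> residues" using red_in_residues[of 0] by simp
  show "1 \<in> residues" using red_in_residues[of 1] by simp
  show "a \<in> residues \<Longrightarrow> b \<in> residues \<Longrightarrow> a + b \<in> residues"
    unfolding residues_def by (auto simp: red_add[symmetric])
  show "a \<in> residues \<Longrightarrow> b \<in> residues \<Longrightarrow> a * b \<in> residues"
    unfolding residues_def by (auto simp: red_mult[symmetric])
  show "a \<in> residues \<Longrightarrow> - a \<in> residues"
    unfolding residues_def by (auto simp: red_minus[symmetric])
  show "a \<in> residues \<Longrightarrow> b \<in> residues \<Longrightarrow> a - b \<in> residues"
    unfolding residues_def by (auto simp: red_diff[symmetric])
qed

lemma f_pos: "0 < f"
proof (rule ccontr)
  assume "\<not> 0 < f"
  then have "card residues = 1" using card_residues by simp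
  then obtain a where "residues = {a}" by (auto simp: card_1_singleton_iff)
  then show False using residues_closed(1,2) by (metis singletonD zero_neq_one)
qed

text \<open>Multiplication by \<open>a\<close> permutes the nonzero residues; compare the product of
  all of them before and after.\<close>

lemma residues_power_card:
  assumes "a \<in> residues" "a \<noteq> 0" shows "a ^ (p ^ f - 1) = 1"
proof -
  let ?U = "residues - {0}"
  have inj: "inj_on ((*) a) ?U" using assms by (auto simp: inj_on_def)
  have "(*) a ` ?U \<subseteq> ?U" using assms residues_closed by auto
  then have img: "(*) a ` ?U = ?U" using inj by (intro endo_inj_surj) auto
  have "(\<Prod>x\<in>?U. x) = (\<Prod>x\<in>(*) a ` ?U. x)" by (simp add: img)
  also have "\<dots> = (\<Prod>x\<in>?U. a * x)" using inj by (simp add: prod.reindex)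
  also have "\<dots> = a ^ card ?U * (\<Prod>x\<in>?U. x)" by (simp add: prod.distrib)
  finally have "a ^ card ?U = 1" by simp
  moreover have "card ?U = p ^ f - 1" using residues_closed(1) by (simp add: card_residues)
  ultimately show ?thesis by simp
qed

section \<open>The uniformizer and the discrete valuation\<close>

lemma \<pi>_integral: "valint \<pi>"
  using unif by (simp add: uniformizer_def)

lemma nrm_less_1_iff: "nrm x < 1 \<longleftrightarrow> (\<exists>y. valint y \<and> x = y * \<pi>)"
proof -
  have "max_ideal nrm = {y * \<pi> | y. valint y}"
    using unif by (auto simp: uniformizer_def cgenideal_def)
  then show ?thesis by (auto simp: max_ideal_def)
qed

lemma \<pi>_neq_0 [simp]: "\<pi> \<noteq> 0"
proof
  assume "\<pi> = 0"
  moreover obtain y where "(of_nat p :: 'f) = y * \<pi>" using nrm_p_less_1 nrm_less_1_iff by blast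
  ultimately show False using prime_p by auto
qed

lemma nrm_\<pi>: "0 < nrm \<pi>" "nrm \<pi> < 1"
  using nrm_pos_iff[of \<pi>] nrm_less_1_iff[of \<pi>] by (auto intro: exI[of _ 1])

text \<open>Discreteness of the value group: as \<pi> generates the maximal ideal, no norm lies
  strictly between that of \<pi> and 1.\<close>

lemma nrm_less_1_iff_le: "nrm x < 1 \<longleftrightarrow> nrm x \<le> nrm \<pi>"
proof
  assume "nrm x < 1"
  then show "nrm x \<le> nrm \<pi>" using nrm_\<pi>
    by (auto simp: nrm_less_1_iff nrm_mult mult_left_le_one_le nrm_nonneg)
qed (use nrm_\<pi> in simp)

lemma integral_powi_iff: "valint (\<pi> powi n) \<longleftrightarrow> 0 \<le> n"
proof
  assume *: "valint (\<pi> powi n)"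
  show "0 \<le> n"
  proof (rule ccontr)
    assume "\<not> 0 \<le> n"
    then have "1 < inverse (nrm \<pi>) ^ nat (- n)"
      using nrm_\<pi> by (intro one_less_power) (auto simp: one_less_inverse_iff)
    then show False using * \<open>\<not> 0 \<le> n\<close> by (simp add: nrm_power nrm_inverse power_int_def)
  qed
next
  assume "0 \<le> n"
  then show "valint (\<pi> powi n)" using \<pi>_integral by (simp add: power_int_def valint_power)
qed

lemma nrm_powi_eq_1_iff: "nrm (\<pi> powi n) = 1 \<longleftrightarrow> n = 0"
proof
  assume *: "nrm (\<pi> powi n) = 1"
  then have "nrm (\<pi> powi (- n)) = 1" by (simp add: power_int_minus nrm_inverse)
  with * have "0 \<le> n" "0 \<le> - n" by (simp_all only: integral_powi_iff[symmetric])
  then show "n = 0" by simp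
qed simp

text \<open>If the norm of \<open>x\<close> missed every power of the norm of \<pi>, discreteness
  would push it below each power in turn, hence down to 0.\<close>

lemma valuation_integral: assumes "x \<noteq> 0" "valint x" shows "\<exists>n::nat. nrm x = nrm \<pi> ^ n"
proof (rule ccontr)
  assume no: "\<not> ?thesis"
  have "nrm x \<le> nrm \<pi> ^ n" for n
  proof (induction n)
    case (Suc n)
    with no have "nrm x < nrm \<pi> ^ n" by (metis order_le_less)
    then have "nrm (x / \<pi> ^ n) < 1" using nrm_\<pi> by (simp add: nrm_divide nrm_power)
    then have "nrm x / nrm \<pi> ^ n \<le> nrm \<pi>"
      unfolding nrm_less_1_iff_le by (simp add: nrm_divide nrm_power)
    then show ?case using nrm_\<pi> by (simp add: pos_divide_le_eq mult.commute)
  qed (use assms in simp)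
  moreover obtain n where "nrm \<pi> ^ n < nrm x"
    using assms nrm_\<pi> real_arch_pow_inv[of "nrm x" "nrm \<pi>"] by (auto simp: nrm_pos_iff)
  ultimately show False using not_less by blast
qed

lemma valuation: assumes "x \<noteq> 0" shows "\<exists>n::int. nrm x = nrm \<pi> powi n"
proof (cases "valint x")
  case True
  then show ?thesis using valuation_integral[OF assms] by (metis power_int_of_nat)
next
  case False
  then have "valint (inverse x)" by (simp add: nrm_inverse inverse_le_1_iff)
  then obtain n where "nrm (inverse x) = nrm \<pi> ^ n" using valuation_integral assms by force
  then have "nrm x = nrm \<pi> powi (- int n)"
    by (metis inverse_inverse_eq nrm_inverse power_int_minus power_int_of_nat)
  then show ?thesis by blast
qed

section \<open>The size of q compared with that of the uniformizer\<close>

lemma red_of_nat: "red (of_nat n) = of_nat n"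
  by (induction n) (auto simp: red_add nrm_of_nat)

lemma inj_on_of_nat_p: "inj_on (of_nat :: nat \<Rightarrow> 'k) {..<p}"
proof (rule inj_onI)
  have *: "b \<le> a" if "(of_nat a :: 'k) = of_nat b" "b < p" for a b
  proof (rule ccontr)
    assume "\<not> b \<le> a"
    then have "(of_nat (b - a) :: 'k) = 0" using that(1) by (simp add: of_nat_diff)
    then have "p dvd b - a" by (simp add: of_nat_eq_0_iff_char_dvd char_k)
    then have "p \<le> b - a" using \<open>\<not> b \<le> a\<close> by (intro dvd_imp_le) auto
    then show False using that(2) by simp
  qed
  fix a b assume "a \<in> {..<p}" "b \<in> {..<p}" "(of_nat a :: 'k) = of_nat b"
  then show "a = b" using *[of a b] *[of b a] by simp
qed

text \<open>If \<open>q = p\<close> and \<open>p\<close> is a uniformizer, then expanding in powers of \<open>p\<close> with digits in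
  \<open>{0..<p}\<close> shows that the integers are dense in the ring of integers.\<close>

lemma Qp_eq_UNIV:
  assumes f1: "f = 1" and p: "nrm (of_nat p) = nrm \<pi>" shows "Qp nrm = (UNIV :: 'f set)"
proof -
  have p0: "of_nat p \<noteq> (0 :: 'f)" using nrm_\<pi> p prime_gt_0_nat[OF prime_p] by simp
  have digit: "\<exists>m. nrm (x - of_nat m) < 1" if "valint x" for x
  proof -
    have "inj_on (of_nat :: nat \<Rightarrow> 'k) {..<p}"
      using inj_on_of_nat_p by simp
    moreover have sub: "(of_nat :: nat \<Rightarrow> 'k) ` {..<p} \<subseteq> residues"
      using nrm_of_nat by (metis image_subsetI red_in_residues red_of_nat)
    ultimately have "(of_nat :: nat \<Rightarrow> 'k) ` {..<p} = residues"
      using card_residues f1 by (intro card_subset_eq) (auto simp: card_image)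
    then have "red x \<in> of_nat ` {..<p}" using that by simp
    then obtain m where "red x = of_nat m" by blast
    then have "red x = red (of_nat m)" by (simp add: red_of_nat)
    then have "nrm (x - of_nat m) < 1" using red_eq_iff[OF that nrm_of_nat] by simp
    then show ?thesis by blast
  qed
  have int: "\<exists>m::nat. nrm (x - of_nat m) \<le> nrm \<pi> ^ n" if "valint x" for x n
    using that
  proof (induction n arbitrary: x)
    case 0
    then show ?case by (intro exI[of _ 0]) simp
  next
    case (Suc n)
    obtain m where m: "nrm (x - of_nat m) < 1" using digit Suc.prems by blast
    then have "valint ((x - of_nat m) / of_nat p)"
      using p nrm_\<pi> by (simp add: nrm_divide nrm_less_1_iff_le)
    then obtain m' where m': "nrm ((x - of_nat m) / of_nat p - of_nat m') \<le> nrm \<pi> ^ n"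
      using Suc.IH by blast
    \<comment> \<open>Horner's scheme: \<open>m\<close> is the lowest digit and \<open>m'\<close>
      approximates the rest of the expansion.\<close>
    have "x - of_nat (m + p * m') = of_nat p * ((x - of_nat m) / of_nat p - of_nat m')"
      using p0 by (simp add: field_simps)
    then have "nrm (x - of_nat (m + p * m')) \<le> nrm \<pi> ^ Suc n"
      using m' nrm_\<pi> p by (simp only: nrm_mult) simp
    then show ?case by blast
  qed
  have approx: "\<exists>a\<in>\<rat>. nrm (x - a) < e" if "0 < e" for x e
  proof (cases "x = 0")
    case True
    then show ?thesis using that by (intro bexI[of _ 0]) auto
  next
    case False
    \<comment> \<open>Here p has the norm of a uniformizer, so a power of it clears the denominator
      of \<open>x\<close>.\<close>
    obtain k :: nat where k: "valint (x * of_nat p ^ k)"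
    proof -
      obtain k where "nrm \<pi> ^ k < inverse (nrm x)"
        using False nrm_\<pi> real_arch_pow_inv[of "inverse (nrm x)" "nrm \<pi>"]
        by (auto simp: nrm_pos_iff)
      then have "nrm \<pi> ^ k * nrm x < inverse (nrm x) * nrm x"
        using False by (intro mult_strict_right_mono) (auto simp: nrm_pos_iff)
      then have "nrm x * nrm \<pi> ^ k < 1"
        using False nrm_eq_0_iff[of x] by (simp add: mult.commute)
      then have "valint (x * of_nat p ^ k)" using p by (simp add: nrm_mult nrm_power)
      then show ?thesis by (rule that)
    qed
    obtain n where n: "nrm \<pi> ^ n < e * nrm \<pi> ^ k"
      using \<open>0 < e\<close> nrm_\<pi> real_arch_pow_inv[of "e * nrm \<pi> ^ k" "nrm \<pi>"] by auto
    obtain m :: nat where m: "nrm (x * of_nat p ^ k - of_nat m) \<le> nrm \<pi> ^ n"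
      using int[OF k] by blast
    have "x - of_nat m / of_nat p ^ k = (x * of_nat p ^ k - of_nat m) / of_nat p ^ k"
      using p0 by (simp add: field_simps)
    then have "nrm (x - of_nat m / of_nat p ^ k) = nrm (x * of_nat p ^ k - of_nat m) / nrm \<pi> ^ k"
      by (simp only: nrm_divide nrm_power p)
    also have "\<dots> \<le> nrm \<pi> ^ n / nrm \<pi> ^ k" using m nrm_\<pi> by (simp add: divide_right_mono)
    also have "\<dots> < e" using n nrm_\<pi> by (simp add: divide_less_eq)
    finally show ?thesis by (intro bexI[of _ "of_nat m / of_nat p ^ k"]) auto
  qed
  interpret M: Metric_space UNIV "adist nrm"
  proof
    fix x y z :: 'f
    show "0 \<le> adist nrm x y" by (simp add: adist_def nrm_nonneg)
    show "adist nrm x y = adist nrm y x" by (simp add: adist_def nrm_diff_commute)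
    show "(adist nrm x y = 0) = (x = y)" by (simp add: adist_def nrm_eq_0_iff)
    show "adist nrm x z \<le> adist nrm x y + adist nrm y z"
      using nrm_add[of "x - y" "y - z"] nrm_nonneg[of "x - y"] nrm_nonneg[of "y - z"]
      by (simp add: adist_def)
  qed
  show ?thesis
    unfolding Qp_def using approx by (auto simp: M.metric_closure_of adist_def)
qed

text \<open>For f > 1 already p^2 divides q, and p lies in the maximal ideal. For f = 1 equality
  would make p a uniformizer with q = p, so that F would be the closure of the rationals.\<close>

lemma nrm_card_less: "nrm (of_nat (p ^ f)) < nrm \<pi>"
proof -
  have le: "nrm (of_nat p) \<le> nrm \<pi>" using nrm_p_less_1 nrm_less_1_iff_le by blast
  show ?thesis
  proof (cases "f = 1")
    case True
    then show ?thesis using Qp_eq_UNIV F_neq_Qp le by force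
  next
    case False
    then have "nrm (of_nat (p ^ f)) \<le> nrm (of_nat p) ^ 2"
      using f_pos nrm_p_less_1 by (simp add: nrm_power nrm_nonneg power_decreasing)
    also have "\<dots> \<le> nrm \<pi> ^ 2" using le by (simp add: nrm_nonneg power_mono)
    also have "\<dots> < nrm \<pi>" using nrm_\<pi> by (simp add: power2_eq_square)
    finally show ?thesis .
  qed
qed

end

section \<open>The group \<open>GL\<^sub>2(F)\<close>\<close>

lemma mat2_nth [simp]:
  "mat2 a b c d $ 1 $ 1 = a" "mat2 a b c d $ 1 $ 2 = b"
  "mat2 a b c d $ 2 $ 1 = c" "mat2 a b c d $ 2 $ 2 = d"
  by (simp_all add: mat2_def vector_2)

lemma mat2_eq_iff [simp]:
  "mat2 a b c d = mat2 a' b' c' d' \<longleftrightarrow> a = a' \<and> b = b' \<and> c = c' \<and> d = d'"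
  by (auto simp: vec_eq_iff forall_2)

lemma mat2_cases: obtains a b c d where "g = mat2 a b c d"
proof
  show "g = mat2 (g $ 1 $ 1) (g $ 1 $ 2) (g $ 2 $ 1) (g $ 2 $ 2)"
    by (auto simp: vec_eq_iff forall_2)
qed

lemma mat2_mult [simp]:
  "mat2 a b c d ** mat2 a' b' c' d' =
     mat2 (a * a' + b * c') (a * b' + b * d') (c * a' + d * c') (c * b' + d * d')"
  for a :: "'a::semiring_1"
  by (auto simp: vec_eq_iff forall_2 matrix_matrix_mult_def sum_2)

lemma mat_mat2: "mat x = mat2 x 0 0 x"
  by (auto simp: vec_eq_iff forall_2 mat_def)

lemma det_mat2 [simp]: "det (mat2 a b c d) = a * d - b * c" for a :: "'a::comm_ring_1"
  by (simp add: det_2)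

lemma mat2_in_GL2_iff [simp]: "mat2 a b c d \<in> carrier GL2 \<longleftrightarrow> a * d - b * c \<noteq> 0" for a :: "'a::field"
  by (simp add: GL2_def invertible_det_nz)

lemma GL2_mult [simp]: "g \<otimes>\<^bsub>GL2\<^esub> h = g ** h"
  by (simp add: GL2_def)

lemma GL2_one [simp]: "\<one>\<^bsub>GL2\<^esub> = mat 1"
  by (simp add: GL2_def)

lemma GL2_mult_closed: "g \<in> carrier GL2 \<Longrightarrow> h \<in> carrier GL2 \<Longrightarrow> g ** h \<in> carrier GL2"
  by (simp add: GL2_def invertible_mult)

lemma mat_in_GL2_iff [simp]: "mat x \<in> carrier GL2 \<longleftrightarrow> x \<noteq> (0::'a::field)"
  by (simp add: mat_mat2)

text \<open>The adjugate divided by the determinant: an inverse whose entries can be computed by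
  rewriting. \<open>m_inv_GL2\<close> identifies it with the group inverse.\<close>

definition GL2_inv :: "'a::field^2^2 \<Rightarrow> 'a^2^2" where
  "GL2_inv g = mat2 (g$2$2 / det g) (- (g$1$2 / det g)) (- (g$2$1 / det g)) (g$1$1 / det g)"

lemma GL2_inv_mat2 [simp]:
  "GL2_inv (mat2 a b c d) = mat2 (d / (a * d - b * c)) (- (b / (a * d - b * c)))
     (- (c / (a * d - b * c))) (a / (a * d - b * c))"
  by (simp add: GL2_inv_def)

lemma GL2_inv:
  assumes "g \<in> carrier GL2"
  shows "GL2_inv g \<in> carrier GL2" "g ** GL2_inv g = mat 1" "GL2_inv g ** g = mat 1"
proof -
  obtain a b c d where g: "g = mat2 a b c d" by (rule mat2_cases)
  define D where "D = a * d - b * c"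
  have D: "D \<noteq> 0" using assms g by (simp add: D_def)
  have eq: "GL2_inv g = mat2 (d / D) (- (b / D)) (- (c / D)) (a / D)" by (simp add: g D_def)
  have 1: "a * (d / D) + b * - (c / D) = 1" "c * - (b / D) + d * (a / D) = 1"
    "d / D * a + - (b / D) * c = 1" "- (c / D) * b + a / D * d = 1"
    using D by (simp_all add: D_def diff_divide_distrib[symmetric] mult.commute)
  show *: "g ** GL2_inv g = mat 1" "GL2_inv g ** g = mat 1"
    unfolding eq unfolding g mat2_mult mat_mat2 mat2_eq_iff 1 by (simp_all add: mult.commute)
  then show "GL2_inv g \<in> carrier GL2" by (auto simp: GL2_def invertible_def)
qed

lemma GL2_group: "group GL2"
proof (rule groupI)
  fix x :: "'a^2^2" assume "x \<in> carrier GL2"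
  then show "\<exists>y\<in>carrier GL2. y \<otimes>\<^bsub>GL2\<^esub> x = \<one>\<^bsub>GL2\<^esub>" using GL2_inv by auto
qed (auto simp: GL2_mult_closed matrix_mul_assoc)

lemma m_inv_GL2: "g \<in> carrier GL2 \<Longrightarrow> inv\<^bsub>GL2\<^esub> g = GL2_inv g"
  using group.inv_equality[OF GL2_group, of "GL2_inv g" g] GL2_inv[of g] by simp

lemma GL2_center_eq: "GL2_center = {mat z | z. z \<noteq> (0::'a::field)}"
proof
  show "GL2_center \<subseteq> {mat z | z. z \<noteq> (0::'a)}"
  proof
    fix g :: "'a^2^2" assume g: "g \<in> GL2_center"
    obtain a b c d where abcd: "g = mat2 a b c d" by (rule mat2_cases)
    have "g ** mat2 1 1 0 1 = mat2 1 1 0 1 ** g" "g ** mat2 1 0 1 1 = mat2 1 0 1 1 ** g"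
      using g by (simp_all add: GL2_center_def)
    then have "g = mat a" by (auto simp: abcd mat_mat2)
    moreover have "a \<noteq> 0" using g \<open>g = mat a\<close> by (simp add: GL2_center_def)
    ultimately show "g \<in> {mat z | z. z \<noteq> 0}" by blast
  qed
next
  show "{mat z | z. z \<noteq> (0::'a)} \<subseteq> GL2_center"
  proof
    fix g :: "'a^2^2" assume "g \<in> {mat z | z. z \<noteq> 0}"
    then obtain z where z: "g = mat z" "z \<noteq> 0" by blast
    have "mat z ** h = h ** mat z" for h :: "'a^2^2"
      by (rule mat2_cases[of h]) (simp add: mat_mat2 mult.commute)
    then show "g \<in> GL2_center" using z by (simp add: GL2_center_def)
  qed
qed

lemma mat_mult_mat2: "mat z ** mat2 a b c d = mat2 (z * a) (z * b) (z * c) (z * d)"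
  for z :: "'a::semiring_1"
  by (simp add: mat_mat2)

lemma mat_mult_commute: "mat z ** h = h ** mat z" for h :: "'a::comm_semiring_1^2^2"
  by (rule mat2_cases[of h]) (simp add: mat_mat2 mult.commute)

context residue_embedding
begin

section \<open>K, KZ and the vertices of the tree\<close>

lemma mat2_in_GL2_int_iff:
  "mat2 a b c d \<in> GL2_int nrm \<longleftrightarrow>
     valint a \<and> valint b \<and> valint c \<and> valint d \<and> nrm (a * d - b * c) = 1"
proof -
  have "nrm (a * d - b * c) = 1 \<Longrightarrow> a * d - b * c \<noteq> 0" by auto
  then show ?thesis by (auto simp: GL2_int_def forall_2)
qed

lemma GL2_int_mult: "g \<in> GL2_int nrm \<Longrightarrow> h \<in> GL2_int nrm \<Longrightarrow> g ** h \<in> GL2_int nrm"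
proof (rule mat2_cases[of g], rule mat2_cases[of h])
  fix a b c d a' b' c' d'
  assume *: "g \<in> GL2_int nrm" "h \<in> GL2_int nrm" "g = mat2 a b c d" "h = mat2 a' b' c' d'"
  have "nrm (det (g ** h)) = 1" using * by (simp only: det_mul nrm_mult) (simp add: GL2_int_def)
  then show ?thesis using * by (auto simp: mat2_in_GL2_int_iff)
qed

lemma GL2_int_inv: "g \<in> GL2_int nrm \<Longrightarrow> GL2_inv g \<in> GL2_int nrm"
proof (rule mat2_cases[of g])
  fix a b c d assume *: "g \<in> GL2_int nrm" "g = mat2 a b c d"
  then have "g \<in> carrier GL2" by (simp add: GL2_int_def)
  then have "nrm (det (g ** GL2_inv g)) = 1" by (simp add: GL2_inv)
  moreover have "nrm (det g) = 1" using *(1) by (simp add: GL2_int_def)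
  ultimately have "nrm (det (GL2_inv g)) = 1" by (simp only: det_mul nrm_mult mult_1)
  moreover have "\<forall>i j. valint (GL2_inv g $ i $ j)"
    using * by (auto simp: mat2_in_GL2_int_iff nrm_divide forall_2)
  ultimately show ?thesis using \<open>g \<in> carrier GL2\<close> by (simp add: GL2_int_def GL2_inv)
qed

lemma KZ_iff: "g \<in> KZ nrm \<longleftrightarrow> (\<exists>z k. z \<noteq> 0 \<and> k \<in> GL2_int nrm \<and> g = mat z ** k)"
proof -
  have "g \<in> KZ nrm \<longleftrightarrow> (\<exists>k\<in>GL2_int nrm. \<exists>z. z \<noteq> 0 \<and> g = k ** mat z)"
    by (auto simp: KZ_def set_mult_def GL2_center_eq)
  then show ?thesis by (auto simp: mat_mult_commute)
qed

lemma KZ_I: "z \<noteq> 0 \<Longrightarrow> k \<in> GL2_int nrm \<Longrightarrow> mat z ** k \<in> KZ nrm"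
  by (auto simp: KZ_iff)

lemma mat_1_in_GL2_int [simp]: "mat 1 \<in> GL2_int nrm"
  by (simp add: mat_mat2 mat2_in_GL2_int_iff)

lemma GL2_int_subset_KZ: "k \<in> GL2_int nrm \<Longrightarrow> k \<in> KZ nrm"
  using KZ_I[of 1 k] by simp

lemma mat_in_KZ [simp]: "z \<noteq> 0 \<Longrightarrow> mat z \<in> KZ nrm"
  using KZ_I[of z "mat 1"] by simp

lemma KZ_subset_GL2: "g \<in> KZ nrm \<Longrightarrow> g \<in> carrier GL2"
  by (auto simp: KZ_iff GL2_int_def intro!: GL2_mult_closed)

lemma KZ_mult: "g \<in> KZ nrm \<Longrightarrow> h \<in> KZ nrm \<Longrightarrow> g ** h \<in> KZ nrm"
proof -
  assume "g \<in> KZ nrm" "h \<in> KZ nrm"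
  then obtain z k z' k' where *: "z \<noteq> 0" "z' \<noteq> 0" "k \<in> GL2_int nrm" "k' \<in> GL2_int nrm"
    "g = mat z ** k" "h = mat z' ** k'" by (auto simp: KZ_iff)
  have "g ** h = mat z ** (k ** mat z') ** k'" by (simp only: * matrix_mul_assoc)
  also have "\<dots> = (mat z ** mat z') ** (k ** k')"
    by (simp only: mat_mult_commute[of z' k, symmetric] matrix_mul_assoc)
  also have "(mat z ** mat z' :: 'f^2^2) = mat (z * z')" by (simp add: mat_mat2)
  finally show ?thesis using * by (auto intro!: KZ_I GL2_int_mult)
qed

lemma KZ_inv: "g \<in> KZ nrm \<Longrightarrow> GL2_inv g \<in> KZ nrm"
proof -
  assume g: "g \<in> KZ nrm"
  then obtain z k where *: "z \<noteq> 0" "k \<in> GL2_int nrm" "g = mat z ** k" by (auto simp: KZ_iff)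
  have k: "k \<in> carrier GL2" using * by (simp add: GL2_int_def)
  let ?h = "mat (inverse z) ** GL2_inv k"
  have "g ** ?h = mat z ** (k ** mat (inverse z)) ** GL2_inv k" by (simp only: * matrix_mul_assoc)
  also have "\<dots> = (mat z ** mat (inverse z)) ** (k ** GL2_inv k)"
    by (simp only: mat_mult_commute[of "inverse z" k, symmetric] matrix_mul_assoc)
  also have "\<dots> = mat 1" using * k by (simp add: GL2_inv) (simp add: mat_mat2)
  finally have gh: "g ** ?h = mat 1" .
  have "GL2_inv g = GL2_inv g ** (g ** ?h)" by (simp add: gh)
  also have "\<dots> = ?h" using KZ_subset_GL2[OF g] by (simp add: matrix_mul_assoc GL2_inv)
  finally show ?thesis using * by (auto intro!: KZ_I GL2_int_inv)
qed

lemma KZ_mult_cancel_left: "k \<in> KZ nrm \<Longrightarrow> k ** g \<in> KZ nrm \<longleftrightarrow> g \<in> KZ nrm"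
proof
  assume k: "k \<in> KZ nrm" and "k ** g \<in> KZ nrm"
  then have "GL2_inv k ** (k ** g) \<in> KZ nrm" using KZ_inv KZ_mult by blast
  then show "g \<in> KZ nrm" using KZ_subset_GL2[OF k] by (simp add: matrix_mul_assoc GL2_inv)
qed (rule KZ_mult)

lemma KZ_mult_cancel_right: "k \<in> KZ nrm \<Longrightarrow> g ** k \<in> KZ nrm \<longleftrightarrow> g \<in> KZ nrm"
proof
  assume k: "k \<in> KZ nrm" and "g ** k \<in> KZ nrm"
  then have "(g ** k) ** GL2_inv k \<in> KZ nrm" using KZ_inv KZ_mult by blast
  then show "g \<in> KZ nrm"
    using KZ_subset_GL2[OF k] by (simp add: matrix_mul_assoc[symmetric] GL2_inv)
qed (rule KZ_mult)

text \<open>The entry 1 pins down the scalar: the integral factor is upper triangular with unit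
  determinant, so its diagonal entries are units, and therefore so is the scalar.\<close>

lemma upper_in_KZ_iff: "mat2 a b 0 1 \<in> KZ nrm \<longleftrightarrow> nrm a = 1 \<and> valint b"
proof
  assume "mat2 a b 0 1 \<in> KZ nrm"
  then obtain z k where *: "z \<noteq> 0" "k \<in> GL2_int nrm" "mat2 a b 0 1 = mat z ** k"
    by (auto simp: KZ_iff)
  obtain a' b' c' d' where k: "k = mat2 a' b' c' d'" by (rule mat2_cases)
  have eq: "a = z * a'" "b = z * b'" "c' = 0" "1 = z * d'"
    using * by (auto simp: k mat_mult_mat2)
  have int: "valint a'" "valint b'" "valint d'" "nrm a' * nrm d' = 1"
    using * by (auto simp: k mat2_in_GL2_int_iff nrm_mult eq)
  have "nrm d' = 1" "nrm a' = 1"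
    using int mult_le_one[of "nrm a'" "nrm d'"] nrm_nonneg[of a'] nrm_nonneg[of d']
    by (smt (verit) mult_left_le mult_left_le_one_le)+
  moreover have "nrm z * nrm d' = 1" by (metis eq(4) nrm_1 nrm_mult)
  ultimately show "nrm a = 1 \<and> valint b" using int by (simp add: eq nrm_mult)
qed (auto intro!: GL2_int_subset_KZ simp: mat2_in_GL2_int_iff)

text \<open>\<open>vertex n \<mu>\<close> represents a vertex of the tree \<open>G/KZ\<close> whose height on the horocycles based at
  \<open>\<infinity>\<close> is \<open>n\<close>.\<close>

definition vertex :: "int \<Rightarrow> 'f \<Rightarrow> 'f^2^2" where
  "vertex n \<mu> = mat2 (\<pi> powi n) \<mu> 0 1"

definition vertex_inv :: "int \<Rightarrow> 'f \<Rightarrow> 'f^2^2" where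
  "vertex_inv n \<mu> = mat2 (inverse (\<pi> powi n)) (- (\<mu> / \<pi> powi n)) 0 1"

lemma vertex_in_GL2 [simp]: "vertex n \<mu> \<in> carrier GL2" "vertex_inv n \<mu> \<in> carrier GL2"
  by (simp_all add: vertex_def vertex_inv_def)

lemma vertex_mult_inv [simp]:
  "vertex n \<mu> ** vertex_inv n \<mu> = mat 1" "vertex_inv n \<mu> ** vertex n \<mu> = mat 1"
  by (simp_all add: vertex_def vertex_inv_def mat_mat2 field_simps)

lemma vertex_inv_mult_vertex:
  "vertex_inv m \<mu> ** vertex n \<mu>' =
     mat2 (\<pi> powi n / \<pi> powi m) ((\<mu>' - \<mu>) / \<pi> powi m) 0 1"
  by (simp add: vertex_def vertex_inv_def divide_inverse algebra_simps)

lemma vertex_inv_mult_vertex_same: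
  "vertex_inv n \<mu> ** vertex n \<mu>' = mat2 1 ((\<mu>' - \<mu>) / \<pi> powi n) 0 1"
  by (simp add: vertex_inv_mult_vertex)

text \<open>Equality of vertices rather than adjacency: membership in \<open>KZ\<close> means that
  both matrices represent the same coset, which fixes the level and determines \<mu> modulo
  \<pi>^n.\<close>

lemma vertex_adjacent:
  "vertex_inv m \<mu> ** vertex n \<mu>' \<in> KZ nrm \<longleftrightarrow> m = n \<and> valint ((\<mu>' - \<mu>) / \<pi> powi n)"
proof -
  have "nrm (\<pi> powi n / \<pi> powi m) = 1 \<longleftrightarrow> n = m"
    using nrm_powi_eq_1_iff[of "n - m"] by (simp add: power_int_diff)
  then show ?thesis by (auto simp: vertex_inv_mult_vertex upper_in_KZ_iff)
qed

text \<open>The choice of \<mu> clears the second column in the row whose first entry dominates.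
  Dividing by that entry times \<pi>^n, with n read off from the determinant, leaves an integral
  matrix with unit determinant.\<close>

lemma iwasawa: assumes "g \<in> carrier GL2" shows "\<exists>n \<mu>. g ** vertex n \<mu> \<in> KZ nrm"
proof -
  obtain a b c d where g: "g = mat2 a b c d" by (rule mat2_cases)
  define D where "D = a * d - b * c"
  have D: "D \<noteq> 0" using assms by (simp add: g D_def)
  show ?thesis
  proof (cases "nrm a \<le> nrm c")
    case True
    have c: "c \<noteq> 0" using True D nrm_nonneg[of a] nrm_eq_0_iff[of a] by (auto simp: D_def)
    obtain n where n: "nrm (D / c\<^sup>2) = nrm \<pi> powi n" using valuation[of "D / c\<^sup>2"] D c by auto
    let ?u = "- (D / c\<^sup>2 / \<pi> powi n)"
    have "nrm ?u = 1" using n nrm_\<pi> by (simp only: nrm_minus nrm_divide[of "D / c\<^sup>2"]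
      nrm_power_int) simp
    then have "mat2 (a / c) ?u 1 0 \<in> GL2_int nrm"
      using True c unfolding mat2_in_GL2_int_iff
      by (simp only: nrm_minus nrm_divide[of a c]) (simp add: divide_le_eq_1 nrm_pos_iff)
    then have "mat (c * \<pi> powi n) ** mat2 (a / c) ?u 1 0 \<in> KZ nrm" using c by (intro KZ_I) auto
    also have "mat (c * \<pi> powi n) ** mat2 (a / c) ?u 1 0 = g ** vertex n (- (d / c))"
      using c by (simp add: g vertex_def mat_mult_mat2 D_def field_simps power2_eq_square)
    finally show ?thesis by blast
  next
    case False
    then have a: "a \<noteq> 0" using nrm_nonneg[of c] by auto
    obtain n where n: "nrm (D / a\<^sup>2) = nrm \<pi> powi n" using valuation[of "D / a\<^sup>2"] D a by auto
    let ?u = "D / a\<^sup>2 / \<pi> powi n"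
    have "nrm ?u = 1" using n nrm_\<pi> by (simp only: nrm_divide[of "D / a\<^sup>2"] nrm_power_int) simp
    then have "mat2 1 0 (c / a) ?u \<in> GL2_int nrm"
      using False a unfolding mat2_in_GL2_int_iff
      by (simp only: nrm_divide[of c a]) (simp add: divide_le_eq_1 nrm_pos_iff)
    then have "mat (a * \<pi> powi n) ** mat2 1 0 (c / a) ?u \<in> KZ nrm" using a by (intro KZ_I) auto
    also have "mat (a * \<pi> powi n) ** mat2 1 0 (c / a) ?u = g ** vertex n (- (b / a))"
      using a by (simp add: g vertex_def mat_mult_mat2 D_def field_simps power2_eq_square)
    finally show ?thesis by blast
  qed
qed

lemma iwasawa_vertex_inv:
  assumes "g \<in> carrier GL2" obtains k n \<mu> where "k \<in> KZ nrm" "g = k ** vertex_inv n \<mu>"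
proof -
  obtain n \<mu> where k: "g ** vertex n \<mu> \<in> KZ nrm" using iwasawa[OF assms] by blast
  have "g = (g ** vertex n \<mu>) ** vertex_inv n \<mu>" by (simp add: matrix_mul_assoc[symmetric])
  with k show ?thesis using that by blast
qed

section \<open>Principal congruence subgroups\<close>

definition GL2_cong :: "nat \<Rightarrow> ('f^2^2) set" where
  "GL2_cong m = {g. \<forall>i j. nrm (g $ i $ j - mat 1 $ i $ j) \<le> nrm \<pi> ^ m}"

lemma mat2_in_GL2_cong_iff:
  "mat2 a b c d \<in> GL2_cong m \<longleftrightarrow>
     nrm (a - 1) \<le> nrm \<pi> ^ m \<and> nrm b \<le> nrm \<pi> ^ m \<and> nrm c \<le> nrm \<pi> ^ m \<and> nrm (d - 1) \<le> nrm \<pi> ^ m"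
  by (simp add: GL2_cong_def forall_2 mat_def)

lemma nrm_power_less_1: "0 < m \<Longrightarrow> nrm \<pi> ^ m < 1"
  using nrm_\<pi> by (simp add: power_less_one_iff)

lemma nrm_near_1: "nrm (x - 1) < 1 \<Longrightarrow> nrm x = 1"
  using nrm_add[of "x - 1" 1] nrm_diff[of x "x - 1"] by (auto simp: max_def split: if_splits)

lemma nrm_add_le: "nrm x \<le> B \<Longrightarrow> nrm y \<le> B \<Longrightarrow> nrm (x + y) \<le> B"
  using nrm_add[of x y] by simp

lemma nrm_diff_le: "nrm x \<le> B \<Longrightarrow> nrm y \<le> B \<Longrightarrow> nrm (x - y) \<le> B"
  using nrm_diff[of x y] by simp

lemma nrm_mult_le: "nrm x \<le> B \<Longrightarrow> valint y \<Longrightarrow> nrm (x * y) \<le> B"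
  using mult_left_le[of "nrm y" "nrm x"] by (simp add: nrm_mult nrm_nonneg)

lemma nrm_mult_le': "valint x \<Longrightarrow> nrm y \<le> B \<Longrightarrow> nrm (x * y) \<le> B"
  using nrm_mult_le[of y B x] by (simp add: mult.commute)

lemma GL2_cong_det:
  assumes "0 < m" "mat2 a b c d \<in> GL2_cong m"
  shows "valint a" "valint b" "valint c" "valint d"
    "nrm (a * d - b * c - 1) \<le> nrm \<pi> ^ m" "nrm (a * d - b * c) = 1" "nrm a = 1" "nrm d = 1"
proof -
  have lt: "nrm \<pi> ^ m < 1" using assms(1) by (rule nrm_power_less_1)
  show a: "nrm a = 1" and d: "nrm d = 1"
    using assms lt by (auto intro!: nrm_near_1 simp: mat2_in_GL2_cong_iff)
  show "valint a" "valint b" "valint c" "valint d"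
    using assms lt a d by (auto simp: mat2_in_GL2_cong_iff)
  have "a * d - b * c - 1 = ((a - 1) * d + (d - 1)) - b * c" by (simp add: algebra_simps)
  moreover have "nrm \<dots> \<le> nrm \<pi> ^ m"
    by (rule nrm_diff_le[OF nrm_add_le[OF nrm_mult_le] nrm_mult_le])
      (use assms(2) \<open>valint c\<close> d in \<open>simp_all add: mat2_in_GL2_cong_iff\<close>)
  ultimately show le: "nrm (a * d - b * c - 1) \<le> nrm \<pi> ^ m" by metis
  then show "nrm (a * d - b * c) = 1" using lt by (intro nrm_near_1) simp
qed

lemma GL2_cong_subset: "0 < m \<Longrightarrow> g \<in> GL2_cong m \<Longrightarrow> g \<in> GL2_int nrm"
  by (rule mat2_cases[of g]) (use GL2_cong_det in \<open>auto simp: mat2_in_GL2_int_iff\<close>)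

lemma GL2_cong_mult:
  assumes "0 < m" "g \<in> GL2_cong m" "h \<in> GL2_cong m" shows "g ** h \<in> GL2_cong m"
proof (rule mat2_cases[of g], rule mat2_cases[of h])
  fix a b c d a' b' c' d' assume g: "g = mat2 a b c d" and h: "h = mat2 a' b' c' d'"
  note * = GL2_cong_det[OF assms(1) assms(2)[unfolded g]] GL2_cong_det[OF assms(1)
    assms(3)[unfolded h]]
    assms(2,3)[unfolded g h mat2_in_GL2_cong_iff]
  let ?B = "nrm \<pi> ^ m"
  have eq: "a * a' + b * c' - 1 = ((a - 1) * a' + (a' - 1)) + b * c'"
    "c * b' + d * d' - 1 = c * b' + ((d - 1) * d' + (d' - 1))" by (simp_all add: algebra_simps)
  have le: "nrm (x * y) \<le> ?B" if "nrm x \<le> ?B" "valint y" for x y by (rule nrm_mult_le[OF that])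
  have le': "nrm (x * y) \<le> ?B" if "valint x" "nrm y \<le> ?B" for x y by (rule nrm_mult_le'[OF that])
  show ?thesis
    unfolding g h mat2_mult mat2_in_GL2_cong_iff eq
  proof (intro conjI)
    show "nrm ((a - 1) * a' + (a' - 1) + b * c') \<le> ?B"
      by (rule nrm_add_le[OF nrm_add_le[OF le] le]) (use * in simp_all)
    show "nrm (a * b' + b * d') \<le> ?B" "nrm (c * a' + d * c') \<le> ?B"
      using * by (simp_all add: nrm_add_le le le')
    show "nrm (c * b' + ((d - 1) * d' + (d' - 1))) \<le> ?B"
      by (rule nrm_add_le[OF le nrm_add_le[OF le]]) (use * in simp_all)
  qed
qed

lemma GL2_cong_inv:
  assumes "0 < m" "g \<in> GL2_cong m" shows "GL2_inv g \<in> GL2_cong m"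
proof (rule mat2_cases[of g])
  fix a b c d assume g: "g = mat2 a b c d"
  define D where "D = a * d - b * c"
  note * = GL2_cong_det[OF assms(1) assms(2)[unfolded g], folded D_def]
    assms(2)[unfolded g mat2_in_GL2_cong_iff]
  have "D \<noteq> 0" using * by auto
  then have "d / D - 1 = ((d - 1) - (D - 1)) / D" "a / D - 1 = ((a - 1) - (D - 1)) / D"
    by (simp_all add: field_simps)
  moreover have "nrm ((d - 1) - (D - 1)) \<le> nrm \<pi> ^ m"
    by (rule nrm_diff_le) (use * in simp_all)
  moreover have "nrm ((a - 1) - (D - 1)) \<le> nrm \<pi> ^ m"
    by (rule nrm_diff_le) (use * in simp_all)
  ultimately have "nrm (d / D - 1) \<le> nrm \<pi> ^ m" "nrm (a / D - 1) \<le> nrm \<pi> ^ m"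
    using * by (simp_all only: nrm_divide div_by_1)
  then show ?thesis
    using * by (simp add: g D_def[symmetric] mat2_in_GL2_cong_iff nrm_divide)
qed

text \<open>For m = 0 the set consists of all integral matrices, invertible or not, whence the
  condition \<open>0 < m\<close>.\<close>

lemma GL2_cong_subgroup: "0 < m \<Longrightarrow> subgroup (GL2_cong m) GL2"
proof (rule group.subgroupI[OF GL2_group])
  assume m: "0 < m"
  show "GL2_cong m \<subseteq> carrier GL2" using GL2_cong_subset[OF m] by (auto simp: GL2_int_def)
  show "GL2_cong m \<noteq> {}" using nrm_\<pi> by (auto simp: GL2_cong_def intro!: exI[of _ "mat 1"])
  fix g h assume "g \<in> GL2_cong m" "h \<in> GL2_cong m"
  then show "inv\<^bsub>GL2\<^esub> g \<in> GL2_cong m" "g \<otimes>\<^bsub>GL2\<^esub> h \<in> GL2_cong m"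
    using m GL2_cong_subset[OF m] by (auto simp: m_inv_GL2 GL2_int_def GL2_cong_inv GL2_cong_mult)
qed

section \<open>The topology of GL_2(F)\<close>

definition entry_dist :: "'f^2^2 \<Rightarrow> 'f^2^2 \<Rightarrow> real" where
  "entry_dist g h = Max {nrm (g $ i $ j - h $ i $ j) |i j. True}"

lemma entry_dist_eq: "entry_dist g h = Max (range (\<lambda>(i, j). nrm (g $ i $ j - h $ i $ j)))"
  unfolding entry_dist_def by (rule arg_cong[of _ _ Max]) auto

lemma entry_dist_le_iff: "entry_dist g h \<le> B \<longleftrightarrow> (\<forall>i j. nrm (g $ i $ j - h $ i $ j) \<le> B)"
  unfolding entry_dist_eq by (subst Max_le_iff) auto

lemma entry_dist_less_iff: "entry_dist g h < B \<longleftrightarrow> (\<forall>i j. nrm (g $ i $ j - h $ i $ j) < B)"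
  unfolding entry_dist_eq by (subst Max_less_iff) auto

lemma GL2_metric: "Metric_space (carrier GL2) entry_dist"
proof
  fix x y z :: "'f^2^2"
  have ge: "nrm (x $ i $ j - y $ i $ j) \<le> entry_dist x y" for x y :: "'f^2^2" and i j
    using entry_dist_le_iff by blast
  show nonneg: "0 \<le> entry_dist x y" for x y :: "'f^2^2"
    using ge[of x 1 1 y] nrm_nonneg order_trans by blast
  show "entry_dist x y = entry_dist y x" unfolding entry_dist_eq by (simp add: nrm_diff_commute)
  show "entry_dist x y = 0 \<longleftrightarrow> x = y"
  proof
    assume "entry_dist x y = 0"
    then have "nrm (x $ i $ j - y $ i $ j) \<le> 0" for i j using ge[of x i j y] by simp
    then have "x $ i $ j = y $ i $ j" for i j
      using nrm_nonneg nrm_eq_0_iff by (metis eq_iff_diff_eq_0 order_antisym)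
    then show "x = y" by (simp add: vec_eq_iff)
  qed (simp add: entry_dist_eq)
  show "entry_dist x z \<le> entry_dist x y + entry_dist y z"
    unfolding entry_dist_le_iff[of x z]
  proof (intro allI)
    fix i j
    show "nrm (x $ i $ j - z $ i $ j) \<le> entry_dist x y + entry_dist y z"
      using nrm_add[of "x $ i $ j - y $ i $ j" "y $ i $ j - z $ i $ j"] ge[of x i j y] ge[of y i j
        z]
        nonneg[of x y] nonneg[of y z] by simp
  qed
qed

lemma openin_GL2_topology_iff:
  "openin (GL2_topology nrm) U \<longleftrightarrow>
     U \<subseteq> carrier GL2 \<and> (\<forall>x\<in>U. \<exists>e>0. \<forall>y\<in>carrier GL2. entry_dist x y < e \<longrightarrow> y \<in> U)"
proof -
  interpret M: Metric_space "carrier GL2" entry_dist by (rule GL2_metric)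
  show ?thesis unfolding GL2_topology_def entry_dist_def[symmetric] M.openin_mtopology M.mball_def
    by blast
qed

lemma topspace_GL2_topology [simp]: "topspace (GL2_topology nrm) = carrier GL2"
proof -
  interpret M: Metric_space "carrier GL2" entry_dist by (rule GL2_metric)
  show ?thesis unfolding GL2_topology_def entry_dist_def[symmetric] by simp
qed

text \<open>With \<open>Y\<close> the inverse of \<open>x\<close>, the product y Y differs from 1 by
  (y - x) Y, which is small once y - x is small compared with a bound \<open>M\<close> on the
  entries of \<open>Y\<close>. Hence sets stable under left multiplication by some
  \<open>GL2_cong m\<close> are open.\<close>

lemma GL2_nearby:
  assumes x: "x \<in> carrier GL2"
  shows "\<exists>e>0. \<forall>y\<in>carrier GL2. entry_dist x y < e \<longrightarrow> (\<exists>k\<in>GL2_cong m. y = k ** x)"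
proof -
  define Y where "Y = GL2_inv x"
  define M where "M = max 1 (entry_dist Y 0)"
  have M: "nrm (Y $ i $ j) \<le> M" for i j
    using entry_dist_le_iff[of Y 0 "entry_dist Y 0"] by (simp add: M_def le_max_iff_disj)
  have M1: "1 \<le> M" by (simp add: M_def)
  show ?thesis
  proof (intro exI conjI ballI impI)
    show "0 < nrm \<pi> ^ m / M" using M1 nrm_\<pi> by simp
    fix y assume y: "y \<in> carrier GL2" "entry_dist x y < nrm \<pi> ^ m / M"
    have yx: "nrm (y $ i $ j - x $ i $ j) * M \<le> nrm \<pi> ^ m" for i j
      using y(2) M1 unfolding entry_dist_less_iff
      by (metis less_eq_real_def nrm_diff_commute pos_less_divide_eq zero_less_one
        order_less_le_trans)
    have prod: "nrm ((y $ i $ j - x $ i $ j) * Y $ i' $ j') \<le> nrm \<pi> ^ m" for i j i' j'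
    proof -
      have "nrm (y $ i $ j - x $ i $ j) * nrm (Y $ i' $ j') \<le> nrm (y $ i $ j - x $ i $ j) * M"
        using M nrm_nonneg by (intro mult_left_mono) auto
      then show ?thesis using yx[of i j] by (simp add: nrm_mult)
    qed
    have "nrm ((y ** Y) $ i $ j - mat 1 $ i $ j) \<le> nrm \<pi> ^ m" for i j
    proof -
      have "mat 1 = x ** Y" using x by (simp add: Y_def GL2_inv)
      then have "(y ** Y) $ i $ j - mat 1 $ i $ j =
        (y $ i $ 1 - x $ i $ 1) * Y $ 1 $ j + (y $ i $ 2 - x $ i $ 2) * Y $ 2 $ j"
        by (simp add: matrix_matrix_mult_def sum_2 algebra_simps)
      then show ?thesis using prod by (simp add: nrm_add_le)
    qed
    then have "y ** Y \<in> GL2_cong m" by (simp add: GL2_cong_def)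
    moreover have "y = (y ** Y) ** x"
      using x by (simp add: Y_def matrix_mul_assoc[symmetric] GL2_inv)
    ultimately show "\<exists>k\<in>GL2_cong m. y = k ** x" by blast
  qed
qed

lemma openin_GL2_topologyI:
  assumes "U \<subseteq> carrier GL2" "\<And>k x. k \<in> GL2_cong m \<Longrightarrow> x \<in> U \<Longrightarrow> k ** x \<in> U"
  shows "openin (GL2_topology nrm) U"
  unfolding openin_GL2_topology_iff
proof (intro conjI ballI)
  fix x assume "x \<in> U"
  then obtain e where "0 < e" "\<forall>y\<in>carrier GL2. entry_dist x y < e \<longrightarrow> (\<exists>k\<in>GL2_cong m. y = k ** x)"
    using GL2_nearby assms(1) by blast
  then show "\<exists>e>0. \<forall>y\<in>carrier GL2. entry_dist x y < e \<longrightarrow> y \<in> U"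
    using assms(2) \<open>x \<in> U\<close> by blast
qed (rule assms(1))

lemma openin_GL2_cong: "0 < m \<Longrightarrow> openin (GL2_topology nrm) (GL2_cong m)"
  using GL2_cong_subset
  by (intro openin_GL2_topologyI[of _ m]) (auto simp: GL2_int_def GL2_cong_mult)

lemma openin_KZ_coset:
  "g \<in> carrier GL2 \<Longrightarrow> openin (GL2_topology nrm) ((\<lambda>k. k ** g) ` KZ nrm)"
proof (rule openin_GL2_topologyI[of _ 1])
  fix k x assume "k \<in> GL2_cong 1" "x \<in> (\<lambda>k. k ** g) ` KZ nrm"
  then obtain k' where "k' \<in> KZ nrm" "x = k' ** g" "k \<in> KZ nrm"
    using GL2_cong_subset GL2_int_subset_KZ by (metis imageE zero_less_one)
  then show "k ** x \<in> (\<lambda>k. k ** g) ` KZ nrm"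
    by (intro image_eqI[of _ _ "k ** k'"]) (auto simp: matrix_mul_assoc KZ_mult)
qed (auto simp: KZ_subset_GL2 GL2_mult_closed)

text \<open>By the Iwasawa decomposition the cosets of \<open>KZ\<close> through the matrices
  \<open>vertex_inv n \<mu>\<close> cover the group, and they are open; compactness leaves finitely
  many.\<close>

lemma compactin_cosets:
  assumes "compactin (GL2_topology nrm) C"
  shows "\<exists>S. finite S \<and> C \<subseteq> (\<Union>(n, \<mu>)\<in>S. (\<lambda>k. k ** vertex_inv n \<mu>) ` KZ nrm)"
proof -
  let ?U = "\<lambda>s. (\<lambda>k. k ** vertex_inv (fst s) (snd s)) ` KZ nrm"
  have C: "C \<subseteq> carrier GL2" using compactin_subset_topspace[OF assms] by simp
  have "\<exists>\<F>. finite \<F> \<and> \<F> \<subseteq> range ?U \<and> C \<subseteq> \<Union>\<F>"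
  proof (rule compactinD[OF assms])
    fix U assume "U \<in> range ?U"
    then show "openin (GL2_topology nrm) U" by (auto intro!: openin_KZ_coset)
  next
    show "C \<subseteq> \<Union>(range ?U)"
    proof
      fix g assume "g \<in> C"
      then obtain k n \<mu> where "k \<in> KZ nrm" "g = k ** vertex_inv n \<mu>"
        using C iwasawa_vertex_inv by blast
      then show "g \<in> \<Union>(range ?U)" by (intro UnionI[OF rangeI[of ?U "(n, \<mu>)"]]) auto
    qed
  qed
  then obtain \<F> where F: "finite \<F>" "\<F> \<subseteq> range ?U" "C \<subseteq> \<Union>\<F>" by blast
  then obtain S where "finite S" "\<F> = ?U ` S" using finite_subset_image[OF F(1,2)] by blast
  then show ?thesis using F(3) by (intro exI[of _ S]) (auto simp: case_prod_beta)
qed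

end

section \<open>Digits and corestriction\<close>

text \<open>The representatives are arbitrary, and \<tau> 0 may be nonzero. Keeping them free allows
  digits with small carries to be chosen when q = p.\<close>

locale digit_system = residue_embedding p nrm f \<pi> \<iota>
  for p :: nat and nrm :: "'f::field_char_0 \<Rightarrow> real" and f :: nat and \<pi> :: 'f
    and \<iota> :: "'f set \<Rightarrow> 'k::field" +
  fixes \<tau> :: "'k \<Rightarrow> 'f"
  assumes valint_\<tau>: "a \<in> residues \<Longrightarrow> valint (\<tau> a)"
    and red_\<tau>: "a \<in> residues \<Longrightarrow> red (\<tau> a) = a"
begin

text \<open>Removes the lowest digit, so that the residue of \<open>(shift ^^ n) x\<close> is the
  digit of \<open>x\<close> at \<pi>^n.\<close>

definition shift :: "'f \<Rightarrow> 'f" where "shift x = (x - \<tau> (red x)) / \<pi>"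

lemma valint_divide_\<pi>: "nrm x < 1 \<Longrightarrow> valint (x / \<pi>)"
  using nrm_\<pi> by (simp add: nrm_divide nrm_less_1_iff_le)

lemma valint_shift: assumes "valint x" shows "valint (shift x)"
proof -
  have "red (x - \<tau> (red x)) = 0" using assms by (simp add: red_diff valint_\<tau> red_\<tau>)
  then have "nrm (x - \<tau> (red x)) < 1"
    using assms valint_\<tau>[of "red x"] red_eq_0_iff[of "x - \<tau> (red x)"] by (simp add: valint_diff)
  then show ?thesis unfolding shift_def by (rule valint_divide_\<pi>)
qed

lemma valint_shift_funpow: "valint x \<Longrightarrow> valint ((shift ^^ n) x)"
  by (induction n) (auto simp: valint_shift)

lemma red_\<pi>_mult: "valint c \<Longrightarrow> red (\<pi> * c) = 0"
  using nrm_\<pi> nrm_mult_le[of \<pi> "nrm \<pi>" c] \<pi>_integral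
  by (subst red_eq_0_iff) (auto intro: valint_mult)

lemma shift_funpow_add:
  "valint x \<Longrightarrow> valint c \<Longrightarrow> (shift ^^ n) (x + \<pi> ^ n * c) = (shift ^^ n) x + c"
proof (induction n arbitrary: x)
  case (Suc n)
  have c: "valint (\<pi> ^ n * c)" using Suc.prems \<pi>_integral by (intro valint_mult valint_power)
  have "red (x + \<pi> ^ Suc n * c) = red x"
    using red_add[of x "\<pi> * (\<pi> ^ n * c)"] red_\<pi>_mult[OF c] Suc.prems c \<pi>_integral
    by (simp add: valint_mult mult.assoc)
  then have "shift (x + \<pi> ^ Suc n * c) = shift x + \<pi> ^ n * c"
    by (simp add: shift_def field_simps)
  then show ?case using Suc by (simp add: funpow_swap1[symmetric] valint_shift del: funpow.simps)
      (simp add: funpow_swap1 Suc valint_shift)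
qed simp

lemma residues_translate:
  assumes "b \<in> residues" shows "bij_betw (\<lambda>a. b + a) residues residues"
  using assms by (intro bij_betwI[of _ _ _ "\<lambda>a. a - b"]) (auto simp: residues_closed)

lemma sum_residues_translate:
  "b \<in> residues \<Longrightarrow> (\<Sum>a\<in>residues. g (b + a)) = (\<Sum>a\<in>residues. g a)" for g :: "'k \<Rightarrow> 'x::comm_monoid_add"
  by (rule sum.reindex_bij_betw[OF residues_translate])

text \<open>The corestriction from \<open>\<pi>\<^sup>n\<^sup>+\<^sup>1\<O>\<close> to \<open>\<pi>\<^sup>n\<O>\<close> is multiplication by \<open>q\<close>; it kills additive
  characters of the residue field exactly because \<open>F \<noteq> \<rat>\<^sub>p\<close>.\<close>

lemma sum_red_shift:
  assumes "valint z" shows "(\<Sum>a\<in>residues. red (shift (z + \<tau> a))) = 0"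
proof -
  have red: "red (z + \<tau> a) = red z + a" if "a \<in> residues" for a
    using that assms by (simp add: red_add valint_\<tau> red_\<tau>)
  have "(\<Sum>a\<in>residues. red (shift (z + \<tau> a))) = red (\<Sum>a\<in>residues. shift (z + \<tau> a))"
    using assms by (subst red_sum) (auto intro: valint_shift valint_add valint_\<tau>)
  also have "(\<Sum>a\<in>residues. shift (z + \<tau> a)) =
      (\<Sum>a\<in>residues. (z + \<tau> a - \<tau> (red z + a)) / \<pi>)"
    by (simp add: shift_def red)
  also have "\<dots> = (of_nat (p ^ f) * z + (\<Sum>a\<in>residues. \<tau> a) - (\<Sum>a\<in>residues. \<tau> (red z + a))) / \<pi>"
    by (simp add: sum_divide_distrib[symmetric] sum.distrib sum_subtractf card_residues)
  \<comment> \<open>Translation by \<open>red z\<close> permutes the residues, so the two sums of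
    representatives cancel and only q times \<open>z\<close> is left.\<close>
  also have "\<dots> = of_nat (p ^ f) * z / \<pi>"
    using sum_residues_translate[of "red z" \<tau>] assms by simp
  also have "red \<dots> = 0"
  proof -
    have "nrm (of_nat (p ^ f) * z) < nrm \<pi>"
      using nrm_card_less nrm_mult_le[OF order_refl assms, of "of_nat (p ^ f)"] by simp
    then have "nrm (of_nat (p ^ f) * z / \<pi>) < 1" using nrm_\<pi> by (simp add: nrm_divide)
    then show ?thesis by (simp add: red_eq_0_iff)
  qed
  finally show ?thesis .
qed

end

section \<open>Maps close to a translation and the drift of digits\<close>

context residue_embedding
begin

text \<open>The factor \<pi>^2 leaves room for one division by \<pi>: a perturbation of x at \<pi>^n
  is passed on unchanged up to an error at \<pi>^(n+2), which the digits at \<pi>^n and \<pi>^(n+1)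
  do not notice.\<close>

definition near_identity :: "('f \<Rightarrow> 'f) \<Rightarrow> bool" where
  "near_identity M \<longleftrightarrow> (\<forall>x. valint x \<longrightarrow> valint (M x)) \<and>
     (\<forall>x y. valint x \<longrightarrow> valint y \<longrightarrow> nrm (M x - M y - (x - y)) \<le> nrm \<pi> ^ 2 * nrm (x - y))"

lemma near_identity_valint: "near_identity M \<Longrightarrow> valint x \<Longrightarrow> valint (M x)"
  by (simp add: near_identity_def)

lemma near_identity_add:
  assumes M: "near_identity M" and x: "valint x" and c: "valint c"
  obtains e where "nrm e \<le> nrm \<pi> ^ 2" "M (x + \<pi> ^ n * c) = M x + \<pi> ^ n * c + \<pi> ^ n * e"
proof
  let ?e = "(M (x + \<pi> ^ n * c) - M x - \<pi> ^ n * c) / \<pi> ^ n"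
  show "M (x + \<pi> ^ n * c) = M x + \<pi> ^ n * c + \<pi> ^ n * ?e" by simp
  have pc: "nrm (\<pi> ^ n * c) \<le> nrm \<pi> ^ n" using c by (simp add: nrm_mult nrm_power mult_left_le
    nrm_nonneg)
  have "valint (x + \<pi> ^ n * c)"
    using x c \<pi>_integral by (intro valint_add valint_mult valint_power)
  then have "nrm (M (x + \<pi> ^ n * c) - M x - \<pi> ^ n * c) \<le> nrm \<pi> ^ 2 * nrm (\<pi> ^ n * c)"
    using M x unfolding near_identity_def by (metis add_diff_cancel_left')
  also have "\<dots> \<le> nrm \<pi> ^ 2 * nrm \<pi> ^ n" using pc by (intro mult_left_mono) auto
  finally show "nrm ?e \<le> nrm \<pi> ^ 2" using nrm_\<pi> by (simp add: nrm_divide nrm_power divide_le_eq)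
qed

end

context digit_system
begin

definition drift :: "nat \<Rightarrow> ('f \<Rightarrow> 'f) \<Rightarrow> 'f \<Rightarrow> 'k" where
  "drift n M x = red ((shift ^^ n) (M x)) - red ((shift ^^ n) x)"

lemma nrm_\<pi>_square: "nrm e \<le> nrm \<pi> ^ 2 \<Longrightarrow> nrm e < 1"
  using nrm_power_less_1[of 2] by simp

lemma red_add_small: "valint x \<Longrightarrow> nrm e < 1 \<Longrightarrow> red (x + e) = red x"
  using red_add[of x e] red_eq_0_iff[of e] by simp

lemma red_shift_funpow_add:
  "valint x \<Longrightarrow> valint c \<Longrightarrow> red ((shift ^^ n) (x + \<pi> ^ n * c)) = red ((shift ^^ n) x) + red c"
  by (simp add: shift_funpow_add red_add valint_shift_funpow)

text \<open>The digit at \<pi>^n of both \<open>x\<close> and \<open>M x\<close> grows by the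
  residue of \<open>c\<close>, so the change of this digit depends only on the digits below
  it.\<close>

lemma drift_periodic:
  assumes "near_identity M" "valint x" "valint c"
  shows "drift n M (x + \<pi> ^ n * c) = drift n M x"
proof -
  obtain e where e: "nrm e \<le> nrm \<pi> ^ 2" "M (x + \<pi> ^ n * c) = M x + \<pi> ^ n * c + \<pi> ^ n * e"
    using near_identity_add[OF assms] by blast
  have "nrm e < 1" using e(1) by (rule nrm_\<pi>_square)
  then have "red (c + e) = red c" using assms by (simp add: red_add_small)
  moreover have "M (x + \<pi> ^ n * c) = M x + \<pi> ^ n * (c + e)"
    by (simp only: e(2) distrib_left add.assoc)
  moreover have "valint (c + e)" using assms \<open>nrm e < 1\<close> by (intro valint_add) auto
  ultimately show ?thesis
    using assms by (simp add: drift_def red_shift_funpow_add near_identity_valint)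
qed

text \<open>The error of \<open>M\<close> sits at \<pi>^(n+2) and cannot reach the digit at
  \<pi>^(n+1); that digit sees only the translate of \<open>M x\<close>.\<close>

lemma red_shift_near_identity:
  assumes "near_identity M" "valint x" "valint c"
  shows "red ((shift ^^ Suc n) (M (x + \<pi> ^ n * c))) = red (shift ((shift ^^ n) (M x) + c))"
proof -
  obtain e where e: "nrm e \<le> nrm \<pi> ^ 2" "M (x + \<pi> ^ n * c) = M x + \<pi> ^ n * c + \<pi> ^ n * e"
    using near_identity_add[OF assms] by blast
  define e' where "e' = e / \<pi>"
  have e': "e = \<pi> * e'" by (simp add: e'_def)
  have "nrm \<pi> * nrm e' \<le> nrm \<pi> * nrm \<pi>" using e(1) by (simp add: e' nrm_mult power2_eq_square)
  then have "nrm e' \<le> nrm \<pi>" using nrm_\<pi> by simp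
  then have e'1: "nrm e' < 1" using nrm_\<pi> by simp
  have c: "valint (M x + \<pi> ^ n * c)"
    using assms \<pi>_integral
    by (intro valint_add valint_mult valint_power near_identity_valint[of M x])
  have "\<pi> ^ n * e = \<pi> ^ Suc n * e'" by (simp add: e')
  then have "red ((shift ^^ Suc n) (M (x + \<pi> ^ n * c))) = red ((shift ^^ Suc n) (M x + \<pi> ^ n * c +
    \<pi> ^ Suc n * e'))"
    by (simp only: e(2))
  also have "\<dots> = red ((shift ^^ Suc n) (M x + \<pi> ^ n * c))"
    using e'1 c red_shift_funpow_add[of "M x + \<pi> ^ n * c" e' "Suc n"] red_eq_0_iff[of e'] by simp
  also have "\<dots> = red (shift ((shift ^^ n) (M x) + c))"
    using assms by (simp add: shift_funpow_add near_identity_valint)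
  finally show ?thesis .
qed

lemma near_identity_id: "near_identity (\<lambda>x. x)"
  by (simp add: near_identity_def nrm_nonneg)

lemma drift_Suc_add:
  assumes "near_identity M" "valint x" "valint c"
  shows "drift (Suc n) M (x + \<pi> ^ n * c) =
    red (shift ((shift ^^ n) (M x) + c)) - red (shift ((shift ^^ n) x + c))"
  using red_shift_near_identity[OF assms] red_shift_near_identity[OF near_identity_id assms(2,3)]
  by (simp add: drift_def del: funpow.simps)

text \<open>By \<open>drift_Suc_add\<close> this is a difference of two corestrictions, one based at
  \<open>M x\<close> and one at \<open>x\<close>, and \<open>sum_red_shift\<close> kills each of
  them.\<close>

lemma sum_drift:
  assumes "near_identity M" "valint x"
  shows "(\<Sum>a\<in>residues. drift (Suc n) M (x + \<pi> ^ n * \<tau> a)) = 0"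
  using assms by (simp add: drift_Suc_add valint_\<tau> sum_subtractf sum_red_shift
      valint_shift_funpow near_identity_valint)

text \<open>If the digits are additive modulo \<pi>^2, carries vanish after the division by \<pi>
  and \<open>shift\<close> is additive modulo \<pi>. The drift at \<pi>^(n+1) then depends only on x
  modulo \<pi>^n, one step better than in \<open>drift_periodic\<close>.\<close>

lemma drift_Suc_periodic:
  assumes add: "\<And>a b. a \<in> residues \<Longrightarrow> b \<in> residues \<Longrightarrow> nrm (\<tau> a + \<tau> b - \<tau> (a + b)) \<le> nrm \<pi> ^ 2"
    and M: "near_identity M" and x: "valint x" and c: "valint c"
  shows "drift (Suc n) M (x + \<pi> ^ n * c) = drift (Suc n) M x"
proof -
  have *: "red (shift (z + c)) = red (shift z) + red (shift c)" if z: "valint z" for z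
  proof -
    have "nrm (\<tau> (red z) + \<tau> (red c) - \<tau> (red z + red c)) \<le> nrm \<pi> ^ 2"
      using add[of "red z" "red c"] z c by simp
    then have "nrm ((\<tau> (red z) + \<tau> (red c) - \<tau> (red z + red c)) / \<pi>) \<le> nrm \<pi>"
      using nrm_\<pi> by (simp add: nrm_divide divide_le_eq power2_eq_square)
    moreover have "shift (z + c) = (shift z + shift c) + (\<tau> (red z) + \<tau> (red c) - \<tau> (red z + red
      c)) / \<pi>"
      using z c by (simp add: shift_def red_add add_divide_distrib diff_divide_distrib)
    ultimately show ?thesis
      using z c nrm_\<pi> by (simp add: red_add_small red_add valint_shift valint_add)
  qed
  show ?thesis
    unfolding drift_Suc_add[OF M x c]
    using * x M by (simp add: drift_def valint_shift_funpow near_identity_valint)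
qed

end

section \<open>Existence of digit systems\<close>

context residue_embedding
begin

lemma ex_digit_system: "\<exists>\<tau>. digit_system p nrm f \<pi> \<iota> \<tau>"
proof -
  have "\<exists>x. valint x \<and> red x = a" if "a \<in> residues" for a
    using that by (auto simp: residues_def)
  then obtain \<tau> where "\<And>a. a \<in> residues \<Longrightarrow> valint (\<tau> a) \<and> red (\<tau> a) = a" by metis
  then have "digit_system p nrm f \<pi> \<iota> \<tau>" by unfold_locales auto
  then show ?thesis by blast
qed

text \<open>The digits are 0, ..., p - 1. Their carries are multiples of p, and for q = p the
  inequality \<open>nrm_card_less\<close> makes p divisible by \<pi>^2.\<close>

lemma ex_additive_digit_system:
  assumes f1: "f = 1"
  shows "\<exists>\<tau>. digit_system p nrm f \<pi> \<iota> \<tau> \<and>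
    (\<forall>a\<in>residues. \<forall>b\<in>residues. nrm (\<tau> a + \<tau> b - \<tau> (a + b)) \<le> nrm \<pi> ^ 2)"
proof -
  have "(of_nat :: nat \<Rightarrow> 'k) ` {..<p} \<subseteq> residues"
    using nrm_of_nat by (metis image_subsetI red_in_residues red_of_nat)
  then have img: "(of_nat :: nat \<Rightarrow> 'k) ` {..<p} = residues"
    using card_residues f1 inj_on_of_nat_p by (intro card_subset_eq) (auto simp: card_image)
  define ix where "ix = inv_into {..<p} (of_nat :: nat \<Rightarrow> 'k)"
  have ix: "ix a < p" "of_nat (ix a) = a" if "a \<in> residues" for a
    using that img inv_into_into[of a of_nat "{..<p}"] f_inv_into_f[of a of_nat "{..<p}"]
    by (auto simp: ix_def)
  define \<tau> :: "'k \<Rightarrow> 'f" where "\<tau> a = of_nat (ix a)" for a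
  interpret digit_system p nrm f \<pi> \<iota> \<tau>
    by unfold_locales (auto simp: \<tau>_def nrm_of_nat red_of_nat ix)
  have p2: "nrm (of_nat p) \<le> nrm \<pi> ^ 2"
  proof -
    have "nrm (of_nat p / \<pi>) < 1"
      using nrm_card_less f1 nrm_\<pi> by (simp add: nrm_divide)
    then have "nrm (of_nat p / \<pi>) \<le> nrm \<pi>" by (simp only: nrm_less_1_iff_le)
    then show ?thesis using nrm_\<pi> by (simp add: nrm_divide divide_le_eq power2_eq_square)
  qed
  have "nrm (\<tau> a + \<tau> b - \<tau> (a + b)) \<le> nrm \<pi> ^ 2" if ab: "a \<in> residues" "b \<in> residues" for a b
  proof -
    have p0: "0 < p" by (rule prime_gt_0_nat[OF prime_p])
    have "(of_nat ((ix a + ix b) mod p) :: 'k) = of_nat (ix a + ix b)"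
    proof -
      have "(of_nat (ix a + ix b) :: 'k) = of_nat ((ix a + ix b) div p * p + (ix a + ix b) mod p)"
        by (simp only: div_mult_mod_eq)
      also have "\<dots> = of_nat ((ix a + ix b) mod p)"
        using of_nat_CHAR[where 'a='k] by (simp only: of_nat_add of_nat_mult char_k) simp
      finally show ?thesis by simp
    qed
    also have "\<dots> = a + b" using ix ab by simp
    finally have "ix (a + b) = (ix a + ix b) mod p"
      using ix[OF residues_closed(3)[OF ab]] p0 inj_on_of_nat_p by (auto simp: inj_on_def)
    then have eq: "ix a + ix b = p * ((ix a + ix b) div p) + ix (a + b)" by simp
    have "\<tau> a + \<tau> b - \<tau> (a + b) = of_nat (ix a + ix b) - of_nat (ix (a + b))"
      by (simp add: \<tau>_def)
    also have "\<dots> = of_nat p * of_nat ((ix a + ix b) div p)" by (subst eq) simp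
    also have "nrm \<dots> \<le> nrm \<pi> ^ 2" using p2 nrm_of_nat by (intro nrm_mult_le)
    finally show ?thesis .
  qed
  then show ?thesis using digit_system_axioms by blast
qed

end

section \<open>Unipotent translations of \<open>Sym\<^sup>r\<close>\<close>

text \<open>The exponent that a multi-index stands for in the formula for \<open>T\<close>: the
  number with base p digits i_j.\<close>

definition weight :: "nat \<Rightarrow> nat \<Rightarrow> (nat \<Rightarrow> nat) \<Rightarrow> nat" where
  "weight p f i = (\<Sum>j<f. p ^ j * i j)"

definition unip_act :: "nat \<Rightarrow> nat \<Rightarrow> (nat \<Rightarrow> nat) \<Rightarrow> 'k::field \<Rightarrow> ((nat \<Rightarrow> nat) \<Rightarrow> 'k) \<Rightarrow> (nat \<Rightarrow> nat) \<Rightarrow>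
  'k" where
  "unip_act p f r c u = sym_act p f r (mat2 1 c 0 1) u"

lemma finite_exponents:
  fixes r :: "nat \<Rightarrow> nat"
  assumes "\<forall>j\<ge>f. r j = 0" shows "finite {..r}"
proof -
  have "{..r} \<subseteq> (\<lambda>g j. if j < f then g j else 0) ` (PiE {..<f} (\<lambda>j. {..r j}))"
  proof
    fix i assume i: "i \<in> {..r}"
    then have "i j = 0" if "\<not> j < f" for j
    proof -
      have "i j \<le> r j" using i by (simp add: le_funD)
      moreover have "f \<le> j" using that by simp
      ultimately show ?thesis using assms by simp
    qed
    then have "i = (\<lambda>j. if j < f then restrict i {..<f} j else 0)" by auto
    moreover have "restrict i {..<f} \<in> PiE {..<f} (\<lambda>j. {..r j})" using i by (auto simp: le_fun_def)
    ultimately show "i \<in> (\<lambda>g j. if j < f then g j else 0) ` (PiE {..<f} (\<lambda>j. {..r j}))"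
      by (rule image_eqI)
  qed
  then show ?thesis by (rule finite_subset) (auto intro!: finite_PiE)
qed

lemma coeff_linear_power_top: "Polynomial.coeff ([:c, 1:] ^ n) n = (1 :: 'a::field)"
  using lead_coeff_power[of "[:c, 1:]" n] by (simp add: degree_linear_power)

lemma coeff_linear_power_above: "n < m \<Longrightarrow> Polynomial.coeff ([:c, 1:] ^ n) m = (0 :: 'a::field)"
  by (intro coeff_eq_0) (simp add: degree_linear_power)

locale sym_weight =
  fixes p f :: nat and r :: "nat \<Rightarrow> nat"
  assumes p_gt_1: "1 < p" and f_gt_0: "0 < f"
    and r_less_p: "j < f \<Longrightarrow> r j < p" and r_eq_0: "f \<le> j \<Longrightarrow> r j = 0"
begin

lemma finite_le_r [simp]: "finite {..r}"
  using r_eq_0 by (intro finite_exponents[of f]) auto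

lemma le_r_eq_0: "i \<le> r \<Longrightarrow> f \<le> j \<Longrightarrow> i j = 0"
  using r_eq_0[of j] by (metis le_funD le_0_eq)

lemma weight_inj: "inj_on (weight p f) {i. (\<forall>j<f. i j < p) \<and> (\<forall>j\<ge>f. i j = 0)}"
proof -
  have digits: "\<forall>j<n. a j < p \<Longrightarrow> \<forall>j<n. b j < p \<Longrightarrow> (\<Sum>j<n. p ^ j * a j) = (\<Sum>j<n. p ^ j * b j) \<Longrightarrow>
      \<forall>j<n. a j = b j" for n and a b :: "nat \<Rightarrow> nat"
  proof (induction n arbitrary: a b)
    case (Suc n)
    have split: "(\<Sum>j<Suc n. p ^ j * c j) = c 0 + p * (\<Sum>j<n. p ^ j * c (Suc j))" for c
      unfolding sum.lessThan_Suc_shift by (simp add: sum_distrib_left mult.assoc)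
    have eq: "a 0 + p * (\<Sum>j<n. p ^ j * a (Suc j)) = b 0 + p * (\<Sum>j<n. p ^ j * b (Suc j))"
      using Suc.prems(3) unfolding split .
    have "a 0 < p" "b 0 < p" using Suc.prems by auto
    then have 0: "a 0 = b 0" using arg_cong[OF eq, of "\<lambda>x. x mod p"] by simp
    then have "(\<Sum>j<n. p ^ j * a (Suc j)) = (\<Sum>j<n. p ^ j * b (Suc j))" using eq p_gt_1 by simp
    moreover have "\<forall>j<n. a (Suc j) < p" "\<forall>j<n. b (Suc j) < p" using Suc.prems(1,2) by simp_all
    ultimately have "\<forall>j<n. a (Suc j) = b (Suc j)"
      by (intro Suc.IH[of "\<lambda>j. a (Suc j)" "\<lambda>j. b (Suc j)"])
    then show ?case using 0 by (auto simp: less_Suc_eq_0_disj)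
  qed simp
  show ?thesis
  proof (rule inj_onI)
    fix a b assume *: "a \<in> {i. (\<forall>j<f. i j < p) \<and> (\<forall>j\<ge>f. i j = 0)}"
      "b \<in> {i. (\<forall>j<f. i j < p) \<and> (\<forall>j\<ge>f. i j = 0)}" "weight p f a = weight p f b"
    then have "\<forall>j<f. a j = b j" using digits[of f a b] unfolding weight_def by blast
    moreover have "\<forall>j\<ge>f. a j = b j" using * by simp
    ultimately have "a j = b j" for j by (cases "j < f") simp_all
    then show "a = b" by (rule ext)
  qed
qed

lemma weight_less:
  assumes "\<forall>j<f. i j < p" shows "weight p f i < p ^ f"
proof -
  have "(\<Sum>j<n. p ^ j * i j) < p ^ n" if "n \<le> f" for n
    using that
  proof (induction n)
    case (Suc n)
    then have "(\<Sum>j<n. p ^ j * i j) + p ^ n * i n < p ^ n + p ^ n * i n" by simp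
    also have "\<dots> = p ^ n * Suc (i n)" by simp
    also have "\<dots> \<le> p ^ n * p" using assms Suc.prems by (intro mult_left_mono Suc_leI) auto
    finally show ?case by (simp add: mult.commute)
  qed simp
  then show ?thesis by (simp add: weight_def)
qed

lemma le_r_less_p: "i \<le> r \<Longrightarrow> j < f \<Longrightarrow> i j < p"
  using r_less_p[of j] le_funD[of i r j] by simp

abbreviation xr :: "(nat \<Rightarrow> nat) \<Rightarrow> 'k::field" where
  "xr \<equiv> monomial (\<lambda>_. 0)"

abbreviation uact :: "'k::field \<Rightarrow> ((nat \<Rightarrow> nat) \<Rightarrow> 'k) \<Rightarrow> (nat \<Rightarrow> nat) \<Rightarrow> 'k" where
  "uact \<equiv> unip_act p f r"

lemma uact_eq:
  fixes c :: "'k::field"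
  shows "uact c u l = (if l \<le> r then \<Sum>i\<in>{..r}. u i *
    (\<Prod>j<f. Polynomial.coeff ([:c ^ (p ^ j), 1:] ^ i j) (l j)) else 0)"
proof -
  have "[:1 :: 'k, 0 ^ (p ^ j):] = 1" for j using p_gt_1 by (simp add: one_pCons)
  then show ?thesis by (simp add: unip_act_def sym_act_def)
qed

lemma uact_in_Sym: "uact c u l \<noteq> 0 \<Longrightarrow> l \<le> r"
  by (auto simp: uact_eq split: if_splits)

lemma uact_add: "uact c (\<lambda>i. u i + v i) = (\<lambda>i. uact c u i + uact c v i)"
  by (rule ext) (simp add: uact_eq sum.distrib[symmetric] distrib_right)

lemma uact_scale: "uact c (\<lambda>i. a * u i) = (\<lambda>i. a * uact c u i)"
  by (rule ext) (simp add: uact_eq sum_distrib_left mult.assoc)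

lemma uact_sum: "uact c (\<lambda>i. \<Sum>x\<in>A. g x i) = (\<lambda>i. \<Sum>x\<in>A. uact c (g x) i)"
  by (rule ext) (simp add: uact_eq sum_distrib_right sum.swap[of _ A])

text \<open>The coefficient of \<open>x\<^sup>r\<close> after translation is the value at \<open>c\<close> of the polynomial function
  attached to \<open>u\<close>.\<close>

lemma uact_bottom: "uact c u (\<lambda>_. 0) = (\<Sum>i\<in>{..r}. u i * c ^ weight p f i)"
proof -
  have "(\<Prod>j<f. (c ^ (p ^ j)) ^ i j) = c ^ weight p f i" for i
    by (simp add: weight_def power_sum power_mult)
  then show ?thesis by (simp add: uact_eq coeff_0_power le_fun_def)
qed

text \<open>An upper unipotent replaces y by y plus a multiple of x, which never raises the degree
  in y.\<close>

lemma uact_top: "uact c u r = u r"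
proof -
  have zero: "(\<Prod>j<f. Polynomial.coeff ([:c ^ (p ^ j), 1:] ^ i j) (r j)) = 0" if "i \<le> r" "i \<noteq> r"
    for i
  proof -
    obtain j where "i j \<noteq> r j" using \<open>i \<noteq> r\<close> by (auto simp: fun_eq_iff)
    then have j: "i j < r j" using le_funD[OF that(1), of j] by simp
    moreover then have "j < f" using r_eq_0[of j] by (cases "j < f") auto
    ultimately show ?thesis
      by (auto intro!: bexI[of _ j] coeff_linear_power_above)
  qed
  have "uact c u r = (\<Sum>i\<in>{..r}. u i * (\<Prod>j<f. Polynomial.coeff ([:c ^ (p ^ j), 1:] ^ i j) (r j)))"
    by (simp add: uact_eq)
  also have "\<dots> = (\<Sum>i\<in>{..r}. if i = r then u r else 0)"
    by (rule sum.cong) (simp_all add: zero coeff_linear_power_top)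
  finally show ?thesis by simp
qed

lemma uact_0: assumes "\<forall>i. u i \<noteq> 0 \<longrightarrow> i \<le> r" shows "uact 0 u = u"
proof
  fix l
  show "uact 0 u l = u l"
  proof (cases "l \<le> r")
    case True
    have c: "Polynomial.coeff ([:0, 1:] ^ i j) (l j) = (if i j = l j then 1 else 0)" for i j
      using monom_altdef[of 1 "i j"] by (metis coeff_monom smult_1_left)
    have zero: "(\<Prod>j<f. if i j = l j then 1 else 0 :: 'a) = (if i = l then 1 else 0)" if "i \<le> r"
      for i
    proof (cases "i = l")
      case False
      then obtain j where j: "i j \<noteq> l j" by auto
      then have "j < f" using le_r_eq_0[OF that, of j] le_r_eq_0[OF True, of j] by (cases "j < f")
        auto
      then have "(\<Prod>j<f. if i j = l j then 1 else 0 :: 'a) = 0" using j by (auto simp: prod_zero_iff)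
      then show ?thesis using False by simp
    qed simp
    have "uact 0 u l = (\<Sum>i\<in>{..r}. u i * (if i = l then 1 else 0))"
      unfolding uact_eq using True p_gt_1 by (auto intro!: sum.cong simp: c zero power_0_left)
    also have "\<dots> = (\<Sum>i\<in>{..r}. if i = l then u l else 0)" by (rule sum.cong) auto
    finally show ?thesis using True by simp
  qed (use assms in \<open>auto simp: uact_eq\<close>)
qed

lemma uact_monomial:
  "i \<le> r \<Longrightarrow> uact c (monomial i) l =
    (if l \<le> r then \<Prod>j<f. Polynomial.coeff ([:c ^ (p ^ j), 1:] ^ i j) (l j) else 0)"
proof -
  assume "i \<le> r"
  have "(\<Sum>i'\<in>{..r}. monomial i i' * (\<Prod>j<f. Polynomial.coeff ([:c ^ (p ^ j), 1:] ^ i' j) (l j))) =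
    (\<Sum>i'\<in>{..r}. if i' = i then \<Prod>j<f. Polynomial.coeff ([:c ^ (p ^ j), 1:] ^ i j) (l j) else 0)"
    by (rule sum.cong) (auto simp: monomial_def)
  then show ?thesis using \<open>i \<le> r\<close> by (simp add: uact_eq)
qed

lemma uact_monomial_bottom: "i \<le> r \<Longrightarrow> uact c (monomial i) (\<lambda>_. 0) = c ^ weight p f i"
proof -
  assume "i \<le> r"
  have "(\<Sum>i'\<in>{..r}. monomial i i' * c ^ weight p f i') = (\<Sum>i'\<in>{..r}. if i' = i then c ^ weight p f
    i else 0)"
    by (rule sum.cong) (auto simp: monomial_def)
  then show ?thesis using \<open>i \<le> r\<close> by (simp add: uact_bottom)
qed

lemma uact_x: "uact c (xr) = xr"
proof
  fix l
  have "(\<Prod>j<f. Polynomial.coeff 1 (l j)) = xr l" if "l \<le> r"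
  proof (cases "l = (\<lambda>_. 0)")
    case False
    then obtain j where j: "l j \<noteq> 0" by auto
    then have "j < f" using le_r_eq_0[OF that, of j] by (cases "j < f") auto
    then show ?thesis using j False by (auto simp: monomial_def coeff_1 prod_zero_iff)
  qed (simp add: monomial_def)
  moreover have "(\<lambda>_. 0) \<le> r" by (simp add: le_fun_def)
  ultimately show "uact c (xr) l = (xr l :: 'a)"
    by (simp add: uact_monomial) (auto simp: monomial_def)
qed

definition e0 :: "nat \<Rightarrow> nat" where "e0 = (\<lambda>j. if j = 0 then 1 else 0)"

text \<open>The index 0 carries no Frobenius twist, so the translation adds x^r times
  \<open>c\<close> itself and not times a p-power of \<open>c\<close>. This is how digits
  add.\<close>

lemma uact_y0:
  assumes "0 < r 0"
  shows "uact c (monomial e0) = (\<lambda>i. monomial e0 i + c * xr i)"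
proof
  fix l
  have e0: "e0 \<le> r" using assms by (auto simp: e0_def le_fun_def)
  show "uact c (monomial e0) l = monomial e0 l + c * xr l"
  proof (cases "l \<le> r")
    case True
    obtain f' where f': "f = Suc f'" using f_gt_0 by (cases f) auto
    have "uact c (monomial e0) l = Polynomial.coeff [:c, 1:] (l 0) * (\<Prod>j<f'. Polynomial.coeff 1 (l
      (Suc j)))"
      using True unfolding uact_monomial[OF e0] unfolding f' prod.lessThan_Suc_shift by (simp add:
        e0_def)
    also have "\<dots> = monomial e0 l + c * xr l"
    proof (cases "\<exists>j<f'. l (Suc j) \<noteq> 0")
      case True
      then have "l \<noteq> e0" "l \<noteq> (\<lambda>_. 0)" by (auto simp: e0_def)
      moreover have "(\<Prod>j<f'. Polynomial.coeff 1 (l (Suc j))) = (0 :: 'a)"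
        using True by (auto simp: prod_zero_iff)
      ultimately show ?thesis by (simp add: monomial_def)
    next
      case False
      have l: "l j = 0" if "j \<noteq> 0" for j
      proof (cases j)
        case (Suc j')
        then show ?thesis using False le_r_eq_0[OF \<open>l \<le> r\<close>, of j] by (cases "j' < f'") (auto simp:
          f')
      qed (use that in simp)
      have e0_iff: "l = e0 \<longleftrightarrow> l 0 = 1"
      proof
        assume "l 0 = 1"
        then show "l = e0" using l by (simp add: e0_def fun_eq_iff)
      qed (simp add: e0_def)
      have zero_iff: "l = (\<lambda>_. 0) \<longleftrightarrow> l 0 = 0"
      proof
        assume "l 0 = 0"
        then show "l = (\<lambda>_. 0)" using l by (metis ext)
      qed simp
      moreover have "(\<Prod>j<f'. Polynomial.coeff 1 (l (Suc j))) = (1 :: 'a)"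
        using False by auto
      ultimately show ?thesis
        by (simp add: monomial_def e0_iff zero_iff coeff_pCons split: nat.splits)
    qed
    finally show ?thesis .
  qed (use e0 in \<open>auto simp: uact_eq monomial_def le_fun_def\<close>)
qed

end

section \<open>The compact induction\<close>

lemma scalar_field_simps [simp]:
  "carrier (ring_of_type_algebra :: 'k::field ring) = UNIV"
  "a \<otimes>\<^bsub>(ring_of_type_algebra :: 'k ring)\<^esub> b = a * b"
  "a \<oplus>\<^bsub>(ring_of_type_algebra :: 'k ring)\<^esub> b = a + b"
  "\<one>\<^bsub>(ring_of_type_algebra :: 'k ring)\<^esub> = 1"
  "\<zero>\<^bsub>(ring_of_type_algebra :: 'k ring)\<^esub> = 0"
  by (simp_all add: ring_of_type_algebra_def)

lemma Sym_simps [simp]: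
  "carrier (Sym r) = {u. \<forall>i. u i \<noteq> 0 \<longrightarrow> i \<le> r}"
  "u \<oplus>\<^bsub>Sym r\<^esub> v = (\<lambda>i. u i + v i)"
  "c \<odot>\<^bsub>Sym r\<^esub> u = (\<lambda>i. c * u i)"
  by (simp_all add: Sym_def)

locale hecke_setting = residue_embedding p nrm f \<pi> \<iota>
  for p :: nat and nrm :: "'f::field_char_0 \<Rightarrow> real" and f :: nat and \<pi> :: 'f
    and \<iota> :: "'f set \<Rightarrow> 'k::field" +
  fixes V :: "('k, 'v) module" and \<rho> :: "'f^2^2 \<Rightarrow> 'v \<Rightarrow> 'v"
    and \<eta> :: "'f set \<Rightarrow> 'k" and r :: "nat \<Rightarrow> nat" and \<nu> :: 'k
    and \<phi> :: "'v \<Rightarrow> (nat \<Rightarrow> nat) \<Rightarrow> 'k"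
    and T :: "('f^2^2 \<Rightarrow> 'v) \<Rightarrow> 'f^2^2 \<Rightarrow> 'v"
  assumes rep: "representation (GL2\<lparr>carrier := KZ nrm\<rparr>) V \<rho>"
    and ident: "sym_identification p f nrm \<pi> \<iota> V \<rho> \<eta> r \<nu> \<phi>"
    and hecke: "hecke_operator p f nrm \<pi> \<iota> V \<rho> r \<phi> T"
begin

sublocale sym_weight p f r
proof
  show "1 < p" by (rule prime_gt_1_nat[OF prime_p])
  show "0 < f" by (rule f_pos)
  show "r j < p" if "j < f" for j
    using ident that \<open>1 < p\<close> unfolding sym_identification_def by (metis Suc_pred' le_imp_less_Suc
      less_trans zero_less_one)
  show "r j = 0" if "f \<le> j" for j
    using ident that unfolding sym_identification_def by blast
qed

sublocale V: Module.module "ring_of_type_algebra :: 'k ring" V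
  using rep by (simp add: representation_def)

lemma \<rho>_closed: "\<kappa> \<in> KZ nrm \<Longrightarrow> v \<in> carrier V \<Longrightarrow> \<rho> \<kappa> v \<in> carrier V"
  using rep by (auto simp: representation_def lin_maps_def)

lemma \<rho>_add: "\<kappa> \<in> KZ nrm \<Longrightarrow> v \<in> carrier V \<Longrightarrow> w \<in> carrier V \<Longrightarrow>
    \<rho> \<kappa> (v \<oplus>\<^bsub>V\<^esub> w) = \<rho> \<kappa> v \<oplus>\<^bsub>V\<^esub> \<rho> \<kappa> w"
  using rep by (auto simp: representation_def lin_maps_def)

lemma \<rho>_smult: "\<kappa> \<in> KZ nrm \<Longrightarrow> v \<in> carrier V \<Longrightarrow> \<rho> \<kappa> (c \<odot>\<^bsub>V\<^esub> v) = c \<odot>\<^bsub>V\<^esub> \<rho> \<kappa> v"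
  using rep by (auto simp: representation_def lin_maps_def)

lemma \<rho>_one: "v \<in> carrier V \<Longrightarrow> \<rho> (mat 1) v = v"
  using rep by (simp add: representation_def GL2_def)

lemma \<rho>_mult: "\<kappa> \<in> KZ nrm \<Longrightarrow> \<kappa>' \<in> KZ nrm \<Longrightarrow> v \<in> carrier V \<Longrightarrow>
    \<rho> (\<kappa> ** \<kappa>') v = \<rho> \<kappa> (\<rho> \<kappa>' v)"
  using rep by (simp add: representation_def GL2_def)

lemma \<rho>_zero: "\<kappa> \<in> KZ nrm \<Longrightarrow> \<rho> \<kappa> \<zero>\<^bsub>V\<^esub> = \<zero>\<^bsub>V\<^esub>"
  using \<rho>_smult[of \<kappa> "\<zero>\<^bsub>V\<^esub>" 0] \<rho>_closed[of \<kappa> "\<zero>\<^bsub>V\<^esub>"] V.smult_l_null by simp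

lemma \<phi>_bij: "bij_betw \<phi> (carrier V) {u. \<forall>i. u i \<noteq> 0 \<longrightarrow> i \<le> r}"
  using ident by (simp add: sym_identification_def)

lemma \<phi>_add: "v \<in> carrier V \<Longrightarrow> w \<in> carrier V \<Longrightarrow> \<phi> (v \<oplus>\<^bsub>V\<^esub> w) = (\<lambda>i. \<phi> v i + \<phi> w i)"
  using ident by (simp add: sym_identification_def lin_maps_def)

lemma \<phi>_smult: "v \<in> carrier V \<Longrightarrow> \<phi> (c \<odot>\<^bsub>V\<^esub> v) = (\<lambda>i. c * \<phi> v i)"
  using ident by (simp add: sym_identification_def lin_maps_def)

lemma \<phi>_zero: "\<phi> \<zero>\<^bsub>V\<^esub> = (\<lambda>_. 0)"
  using \<phi>_smult[of "\<zero>\<^bsub>V\<^esub>" 0] V.smult_l_null[of "\<zero>\<^bsub>V\<^esub>"] by simp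

lemma \<phi>_le_r: "v \<in> carrier V \<Longrightarrow> \<phi> v i \<noteq> 0 \<Longrightarrow> i \<le> r"
  using \<phi>_bij by (auto simp: bij_betw_def)

lemma \<phi>_eq_iff: "v \<in> carrier V \<Longrightarrow> w \<in> carrier V \<Longrightarrow> \<phi> v = \<phi> w \<longleftrightarrow> v = w"
  using \<phi>_bij by (auto simp: bij_betw_def inj_on_def)

definition \<psi> :: "((nat \<Rightarrow> nat) \<Rightarrow> 'k) \<Rightarrow> 'v" where "\<psi> = inv_into (carrier V) \<phi>"

lemma \<psi>_closed: "\<forall>i. u i \<noteq> 0 \<longrightarrow> i \<le> r \<Longrightarrow> \<psi> u \<in> carrier V"
  unfolding \<psi>_def using \<phi>_bij by (intro inv_into_into) (auto simp: bij_betw_def)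

lemma \<phi>_\<psi>: "\<forall>i. u i \<noteq> 0 \<longrightarrow> i \<le> r \<Longrightarrow> \<phi> (\<psi> u) = u"
  unfolding \<psi>_def using \<phi>_bij by (intro f_inv_into_f) (auto simp: bij_betw_def)

lemma \<rho>_\<pi>: "v \<in> carrier V \<Longrightarrow> \<rho> (mat \<pi>) v = \<nu> \<odot>\<^bsub>V\<^esub> v"
  using ident by (simp add: sym_identification_def)

lemma \<eta>_one: "\<eta> (res nrm 1) = 1"
proof -
  interpret R: ring "residue_field nrm"
    unfolding residue_field_def by (rule ideal.quotient_is_ring[OF max_ideal_ideal])
  have K: "group (units_of (ring_of_type_algebra :: 'k ring))"
    by (rule monoid.units_group[OF ring.axioms(2)[OF ring_from_type_algebra]])
  have "\<one>\<^bsub>residue_field nrm\<^esub> = res nrm 1"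
    by (simp add: residue_field_def FactRing_def res_def)
  moreover have "\<eta> \<one>\<^bsub>units_of (residue_field nrm)\<^esub> = \<one>\<^bsub>units_of (ring_of_type_algebra :: 'k ring)\<^esub>"
    using ident R.units_group K hom_one unfolding sym_identification_def by blast
  ultimately show ?thesis by (simp add: units_of_one)
qed

text \<open>The action of K factors through the reduction, so only the residues of the entries and
  of the determinant matter.\<close>

lemma \<phi>_\<rho>_unipotent_mod:
  assumes \<kappa>: "\<kappa> \<in> GL2_int nrm" and v: "v \<in> carrier V" and b: "valint b"
    and red: "res nrm (det \<kappa>) = res nrm 1" "red (\<kappa> $ 1 $ 1) = 1" "red (\<kappa> $ 1 $ 2) = red b"
      "red (\<kappa> $ 2 $ 1) = 0" "red (\<kappa> $ 2 $ 2) = 1"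
  shows "\<phi> (\<rho> \<kappa> v) = uact (red b) (\<phi> v)"
proof -
  have "(\<chi> a b. \<iota> (res nrm (\<kappa> $ a $ b))) = mat2 1 (red b) 0 1"
    using red by (simp add: vec_eq_iff forall_2 red_def)
  then show ?thesis
    using ident \<kappa> v red(1) \<eta>_one by (simp add: sym_identification_def unip_act_def)
qed

lemma \<phi>_\<rho>_unipotent:
  assumes "v \<in> carrier V" "valint b" shows "\<phi> (\<rho> (mat2 1 b 0 1) v) = uact (red b) (\<phi> v)"
  using assms by (intro \<phi>_\<rho>_unipotent_mod) (auto simp: mat2_in_GL2_int_iff)

lemma \<rho>_cong:
  assumes "0 < m" "\<kappa> \<in> GL2_cong m" "v \<in> carrier V" shows "\<rho> \<kappa> v = v"
proof -
  obtain a b c d where \<kappa>: "\<kappa> = mat2 a b c d" by (rule mat2_cases)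
  note * = GL2_cong_det[OF assms(1) assms(2)[unfolded \<kappa>]] nrm_power_less_1[OF assms(1)]
  have lt: "nrm (a - 1) < 1" "nrm b < 1" "nrm c < 1" "nrm (d - 1) < 1" "nrm (det \<kappa> - 1) < 1"
    using * assms(2) by (auto simp: \<kappa> mat2_in_GL2_cong_iff)
  have int: "\<kappa> \<in> GL2_int nrm" using GL2_cong_subset assms by blast
  have "\<phi> (\<rho> \<kappa> v) = uact (red 0) (\<phi> v)"
  proof (rule \<phi>_\<rho>_unipotent_mod[OF int assms(3)])
    show "res nrm (det \<kappa>) = res nrm 1" using lt(5) * by (subst res_eq_iff) (auto simp: \<kappa>)
    show "red (\<kappa> $ 1 $ 1) = 1" "red (\<kappa> $ 2 $ 2) = 1"
      using lt * red_eq_iff[of a 1] red_eq_iff[of d 1] by (simp_all add: \<kappa>)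
    show "red (\<kappa> $ 1 $ 2) = red 0" "red (\<kappa> $ 2 $ 1) = 0"
      using lt by (simp_all add: \<kappa> red_eq_0_iff)
  qed simp
  also have "\<dots> = \<phi> v" using \<phi>_le_r[OF assms(3)] by (simp add: uact_0)
  finally show ?thesis
    using assms(3) \<rho>_closed[OF GL2_int_subset_KZ[OF int] assms(3)] by (simp add: \<phi>_eq_iff)
qed

text \<open>Transported from the multiplicativity of \<open>\<rho>\<close> along the identification
  instead of expanding binomials; for this the parameters must lift to integers, i.e. lie in
  \<open>residues\<close>.\<close>

lemma uact_uact:
  assumes "a \<in> residues" "b \<in> residues" "\<forall>i. u i \<noteq> 0 \<longrightarrow> i \<le> r"
  shows "uact a (uact b u) = uact (a + b) u"
proof -
  obtain x y where xy: "valint x" "red x = a" "valint y" "red y = b"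
    using assms by (auto simp: residues_def)
  have KZ: "mat2 1 x 0 1 \<in> KZ nrm" "mat2 1 y 0 1 \<in> KZ nrm" using xy by (simp_all add:
    upper_in_KZ_iff)
  define v where "v = \<psi> u"
  have v: "v \<in> carrier V" "\<phi> v = u" using assms by (simp_all add: v_def \<psi>_closed \<phi>_\<psi>)
  have "uact (a + b) u = \<phi> (\<rho> (mat2 1 (x + y) 0 1) v)"
    using xy v by (simp add: \<phi>_\<rho>_unipotent red_add valint_add)
  also have "\<rho> (mat2 1 (x + y) 0 1) v = \<rho> (mat2 1 x 0 1) (\<rho> (mat2 1 y 0 1) v)"
    using \<rho>_mult[OF KZ v(1)] by (simp add: add.commute)
  also have "\<phi> \<dots> = uact a (uact b u)"
    using xy v KZ by (simp add: \<phi>_\<rho>_unipotent \<rho>_closed)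
  finally show ?thesis by simp
qed

abbreviation "Ind \<equiv> cind nrm V \<rho>"

lemma Ind_simps [simp]:
  "h \<oplus>\<^bsub>Ind\<^esub> h' = (\<lambda>g. h g \<oplus>\<^bsub>V\<^esub> h' g)" "\<zero>\<^bsub>Ind\<^esub> = (\<lambda>g. \<zero>\<^bsub>V\<^esub>)" "c \<odot>\<^bsub>Ind\<^esub> h = (\<lambda>g. c \<odot>\<^bsub>V\<^esub> h g)"
  by (simp_all add: cind_def)

lemma Ind_outside: "h \<in> carrier Ind \<Longrightarrow> g \<notin> carrier GL2 \<Longrightarrow> h g = \<zero>\<^bsub>V\<^esub>"
  by (simp add: cind_def)

lemma Ind_closed: "h \<in> carrier Ind \<Longrightarrow> h g \<in> carrier V"
  by (cases "g \<in> carrier GL2") (auto simp: cind_def)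

lemma Ind_equivariant:
  "h \<in> carrier Ind \<Longrightarrow> \<kappa> \<in> KZ nrm \<Longrightarrow> g \<in> carrier GL2 \<Longrightarrow> h (\<kappa> ** g) = \<rho> \<kappa> (h g)"
  by (simp add: cind_def)

text \<open>Compact support modulo \<open>KZ\<close> means support on finitely many vertices.\<close>

definition supported_on :: "('f^2^2 \<Rightarrow> 'v) \<Rightarrow> (int \<times> 'f) set \<Rightarrow> bool" where
  "supported_on h S \<longleftrightarrow> (\<forall>g\<in>carrier GL2. h g \<noteq> \<zero>\<^bsub>V\<^esub> \<longrightarrow> (\<exists>(n, \<mu>)\<in>S. g ** vertex n \<mu> \<in> KZ nrm))"

lemma supported_onD:
  assumes "supported_on h S" "g \<in> carrier GL2" "h g \<noteq> \<zero>\<^bsub>V\<^esub>"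
  obtains n \<mu> where "(n, \<mu>) \<in> S" "g ** vertex n \<mu> \<in> KZ nrm"
  using assms unfolding supported_on_def by fastforce

lemma Ind_supported_on: assumes "h \<in> carrier Ind" shows "\<exists>S. finite S \<and> supported_on h S"
proof -
  obtain C where C: "compactin (GL2_topology nrm) C"
    "{g \<in> carrier GL2. h g \<noteq> \<zero>\<^bsub>V\<^esub>} \<subseteq> KZ nrm <#>\<^bsub>GL2\<^esub> C"
    using assms by (auto simp: cind_def)
  obtain S where S: "finite S" "C \<subseteq> (\<Union>(n, \<mu>)\<in>S. (\<lambda>k. k ** vertex_inv n \<mu>) ` KZ nrm)"
    using compactin_cosets[OF C(1)] by blast
  have "supported_on h S"
    unfolding supported_on_def
  proof (intro ballI impI)
    fix g assume "g \<in> carrier GL2" "h g \<noteq> \<zero>\<^bsub>V\<^esub>"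
    then obtain k c where g: "k \<in> KZ nrm" "c \<in> C" "g = k ** c" using C(2) by (auto simp:
      set_mult_def)
    obtain n \<mu> k' where k': "(n, \<mu>) \<in> S" "k' \<in> KZ nrm" "c = k' ** vertex_inv n \<mu>" using S(2) g(2)
      by blast
    have "g ** vertex n \<mu> = (k ** k') ** (vertex_inv n \<mu> ** vertex n \<mu>)"
      by (simp only: g(3) k'(3) matrix_mul_assoc)
    then have "g ** vertex n \<mu> \<in> KZ nrm" using KZ_mult[OF g(1) k'(2)] by simp
    then show "\<exists>(n, \<mu>)\<in>S. g ** vertex n \<mu> \<in> KZ nrm" using k'(1) by blast
  qed
  then show ?thesis using S(1) by blast
qed

lemma IndI:
  assumes "\<And>g. g \<notin> carrier GL2 \<Longrightarrow> h g = \<zero>\<^bsub>V\<^esub>" "\<And>g. g \<in> carrier GL2 \<Longrightarrow> h g \<in> carrier V"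
    "\<And>\<kappa> g. \<kappa> \<in> KZ nrm \<Longrightarrow> g \<in> carrier GL2 \<Longrightarrow> h (\<kappa> ** g) = \<rho> \<kappa> (h g)"
    "finite S" "supported_on h S"
  shows "h \<in> carrier Ind"
proof -
  let ?C = "(\<lambda>(n, \<mu>). vertex_inv n \<mu>) ` S"
  have "compactin (GL2_topology nrm) ?C"
    using assms(4) by (intro finite_imp_compactin) auto
  moreover have "{g \<in> carrier GL2. h g \<noteq> \<zero>\<^bsub>V\<^esub>} \<subseteq> KZ nrm <#>\<^bsub>GL2\<^esub> ?C"
  proof
    fix g assume "g \<in> {g \<in> carrier GL2. h g \<noteq> \<zero>\<^bsub>V\<^esub>}"
    then obtain n \<mu> where *: "(n, \<mu>) \<in> S" "g ** vertex n \<mu> \<in> KZ nrm"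
      using assms(5) by (auto elim: supported_onD)
    have "g = (g ** vertex n \<mu>) ** vertex_inv n \<mu>" by (simp add: matrix_mul_assoc[symmetric])
    with * show "g \<in> KZ nrm <#>\<^bsub>GL2\<^esub> ?C" unfolding set_mult_def by force
  qed
  ultimately show ?thesis using assms(1-3) by (auto simp: cind_def)
qed

lemma supported_on_mono: "supported_on h S \<Longrightarrow> S \<subseteq> S' \<Longrightarrow> supported_on h S'"
  unfolding supported_on_def by blast

lemma Ind_add: assumes "h \<in> carrier Ind" "h' \<in> carrier Ind" shows "(\<lambda>g. h g \<oplus>\<^bsub>V\<^esub> h' g) \<in> carrier
  Ind"
proof -
  obtain S S' where S: "finite S" "supported_on h S" "finite S'" "supported_on h' S'"
    using assms Ind_supported_on by metis
  then have "supported_on h (S \<union> S')" "supported_on h' (S \<union> S')" by (auto elim: supported_on_mono)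
  then have "supported_on (\<lambda>g. h g \<oplus>\<^bsub>V\<^esub> h' g) (S \<union> S')"
    unfolding supported_on_def by (metis V.l_zero V.zero_closed)
  then show ?thesis
    using assms S by (intro IndI[where S = "S \<union> S'"])
      (auto simp: Ind_outside Ind_closed Ind_equivariant \<rho>_add)
qed

lemma Ind_smult: assumes "h \<in> carrier Ind" shows "(\<lambda>g. c \<odot>\<^bsub>V\<^esub> h g) \<in> carrier Ind"
proof -
  obtain S where S: "finite S" "supported_on h S" using assms Ind_supported_on by metis
  then have "supported_on (\<lambda>g. c \<odot>\<^bsub>V\<^esub> h g) S"
    unfolding supported_on_def by (metis V.smult_r_null scalar_field_simps(1) UNIV_I)
  then show ?thesis
    using assms S by (intro IndI[where S = S]) (auto simp: Ind_outside Ind_closed Ind_equivariant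
      \<rho>_smult)
qed

lemma Ind_zero: "(\<lambda>g. \<zero>\<^bsub>V\<^esub>) \<in> carrier Ind"
  by (rule IndI[where S = "{}"]) (auto simp: supported_on_def \<rho>_zero)

lemma Ind_module: "Module.module (ring_of_type_algebra :: 'k ring) Ind"
proof (rule moduleI)
  show "cring (ring_of_type_algebra :: 'k ring)" by (rule cring_from_type_algebra)
  show "abelian_group Ind"
  proof (rule abelian_groupI)
    fix h assume h: "h \<in> carrier Ind"
    show "\<exists>h'\<in>carrier Ind. h' \<oplus>\<^bsub>Ind\<^esub> h = \<zero>\<^bsub>Ind\<^esub>"
    proof
      show "(\<lambda>g. (- 1) \<odot>\<^bsub>V\<^esub> h g) \<in> carrier Ind" by (rule Ind_smult[OF h])
      have "(- 1) \<odot>\<^bsub>V\<^esub> v \<oplus>\<^bsub>V\<^esub> v = \<zero>\<^bsub>V\<^esub>" if "v \<in> carrier V" for v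
        using that V.smult_l_distr[of "- 1" 1 v] V.smult_one[OF that] V.smult_l_null[OF that] by
          simp
      then show "(\<lambda>g. (- 1) \<odot>\<^bsub>V\<^esub> h g) \<oplus>\<^bsub>Ind\<^esub> h = \<zero>\<^bsub>Ind\<^esub>"
        using h by (simp add: Ind_closed)
    qed
  qed (auto simp: Ind_add Ind_zero Ind_closed V.add.m_ac)
qed (auto simp: Ind_smult Ind_closed V.smult_l_distr V.smult_r_distr V.smult_assoc1[simplified]
      V.smult_one[simplified] V.smult_l_distr[simplified])

sublocale Ind: Module.module "ring_of_type_algebra :: 'k ring" Ind
  by (rule Ind_module)

text \<open>The coordinates of \<open>h\<close>: in a sum of standard functions, one for each
  vertex, this is the vector attached to the vertex, written in \<open>Sym r\<close>. One vertex has
  many \<mu>; \<open>co_translate\<close> relates the coordinates at them.\<close>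

definition co :: "('f^2^2 \<Rightarrow> 'v) \<Rightarrow> int \<Rightarrow> 'f \<Rightarrow> (nat \<Rightarrow> nat) \<Rightarrow> 'k" where
  "co h n \<mu> = \<phi> (h (vertex_inv n \<mu>))"

lemma co_add: "h \<in> carrier Ind \<Longrightarrow> h' \<in> carrier Ind \<Longrightarrow>
    co (\<lambda>g. h g \<oplus>\<^bsub>V\<^esub> h' g) n \<mu> = (\<lambda>i. co h n \<mu> i + co h' n \<mu> i)"
  by (simp add: co_def \<phi>_add Ind_closed)

lemma co_smult: "h \<in> carrier Ind \<Longrightarrow> co (\<lambda>g. c \<odot>\<^bsub>V\<^esub> h g) n \<mu> = (\<lambda>i. c * co h n \<mu> i)"
  by (simp add: co_def \<phi>_smult Ind_closed)

lemma co_zero: "co (\<lambda>g. \<zero>\<^bsub>V\<^esub>) n \<mu> = (\<lambda>_. 0)"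
  by (simp add: co_def \<phi>_zero)

lemma co_finsum:
  "finite A \<Longrightarrow> g \<in> A \<rightarrow> carrier Ind \<Longrightarrow>
    co (\<Oplus>\<^bsub>Ind\<^esub>a\<in>A. g a) n \<mu> = (\<lambda>i. \<Sum>a\<in>A. co (g a) n \<mu> i)"
proof (induction A rule: finite_induct)
  case (insert a A)
  then have "(\<Oplus>\<^bsub>Ind\<^esub>a\<in>A. g a) \<in> carrier Ind" "g a \<in> carrier Ind" by (auto intro: Ind.finsum_closed)
  moreover have "(\<Oplus>\<^bsub>Ind\<^esub>a\<in>insert a A. g a) = (\<lambda>x. g a x \<oplus>\<^bsub>V\<^esub> (\<Oplus>\<^bsub>Ind\<^esub>a\<in>A. g a) x)"
    using insert by (subst Ind.finsum_insert) auto
  ultimately show ?case using insert by (simp add: co_add)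
qed (simp add: Ind.finsum_empty co_zero)

lemma co_le_r: "h \<in> carrier Ind \<Longrightarrow> co h n \<mu> i \<noteq> 0 \<Longrightarrow> i \<le> r"
  unfolding co_def by (rule \<phi>_le_r[OF Ind_closed])

lemma Ind_eqI:
  assumes "h \<in> carrier Ind" "h' \<in> carrier Ind" "\<And>n \<mu>. co h n \<mu> = co h' n \<mu>"
  shows "h = h'"
proof
  fix g
  show "h g = h' g"
  proof (cases "g \<in> carrier GL2")
    case True
    then obtain k n \<mu> where g: "k \<in> KZ nrm" "g = k ** vertex_inv n \<mu>" by (rule iwasawa_vertex_inv)
    have "h (vertex_inv n \<mu>) = h' (vertex_inv n \<mu>)"
      using assms(3)[of n \<mu>] assms(1,2) by (simp add: co_def \<phi>_eq_iff Ind_closed)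
    then show ?thesis using g assms by (simp add: Ind_equivariant)
  qed (use assms in \<open>simp add: Ind_outside\<close>)
qed

lemma vertex_inv_translate:
  "vertex_inv n (\<mu> + \<pi> powi n * c) = mat2 1 (- c) 0 1 ** vertex_inv n \<mu>"
  by (simp add: vertex_inv_def field_simps)

lemma co_translate:
  assumes "h \<in> carrier Ind" "valint c"
  shows "co h n (\<mu> + \<pi> powi n * c) = uact (- red c) (co h n \<mu>)"
  using assms by (simp add: co_def vertex_inv_translate Ind_equivariant upper_in_KZ_iff
      \<phi>_\<rho>_unipotent Ind_closed red_minus)

lemma right_translation_Ind:
  assumes h: "h \<in> carrier Ind" and x: "x \<in> carrier GL2" shows "right_translation x h \<in> carrier Ind"
proof -
  obtain S where S: "finite S" "supported_on h S" using h Ind_supported_on by metis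
  \<comment> \<open>Translation by \<open>x\<close> moves a vertex to a vertex, which the Iwasawa
    decomposition brings back to the form \<open>vertex n' \<mu>'\<close>.\<close>
  have "\<exists>q. \<forall>g. g ** (x ** vertex n \<mu>) \<in> KZ nrm \<longrightarrow> g ** vertex (fst q) (snd q) \<in> KZ nrm" for n \<mu>
  proof -
    let ?y = "GL2_inv (x ** vertex n \<mu>)"
    have y: "x ** vertex n \<mu> \<in> carrier GL2" using x by (simp add: GL2_mult_closed)
    obtain n' \<mu>' where k: "?y ** vertex n' \<mu>' \<in> KZ nrm" using iwasawa GL2_inv(1)[OF y] by blast
    have "g ** vertex n' \<mu>' \<in> KZ nrm" if "g ** (x ** vertex n \<mu>) \<in> KZ nrm" for g
    proof -
      have "g ** vertex n' \<mu>' = g ** ((x ** vertex n \<mu>) ** ?y) ** vertex n' \<mu>'"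
        using GL2_inv(2)[OF y] by simp
      also have "\<dots> = (g ** (x ** vertex n \<mu>)) ** (?y ** vertex n' \<mu>')" by (simp only:
        matrix_mul_assoc)
      finally show ?thesis using KZ_mult[OF that k] by simp
    qed
    then show ?thesis by (intro exI[of _ "(n', \<mu>')"]) simp
  qed
  then obtain F where F: "\<And>n \<mu> g. g ** (x ** vertex n \<mu>) \<in> KZ nrm \<Longrightarrow>
      g ** vertex (fst (F n \<mu>)) (snd (F n \<mu>)) \<in> KZ nrm"
    by metis
  have "supported_on (right_translation x h) ((\<lambda>(n, \<mu>). F n \<mu>) ` S)"
    unfolding supported_on_def right_translation_def
  proof (intro ballI impI)
    fix g assume g: "g \<in> carrier GL2" "h (g ** x) \<noteq> \<zero>\<^bsub>V\<^esub>"
    then obtain n \<mu> where S': "(n, \<mu>) \<in> S" "(g ** x) ** vertex n \<mu> \<in> KZ nrm"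
      using S(2) x GL2_mult_closed by (metis supported_onD)
    then have "g ** vertex (fst (F n \<mu>)) (snd (F n \<mu>)) \<in> KZ nrm"
      by (intro F) (simp add: matrix_mul_assoc)
    with S'(1) show "\<exists>(n, \<mu>)\<in>(\<lambda>(n, \<mu>). F n \<mu>) ` S. g ** vertex n \<mu> \<in> KZ nrm"
      by (intro bexI[of _ "F n \<mu>"]) (auto simp: case_prod_beta intro: rev_image_eqI)
  qed
  moreover have "g ** x \<in> carrier GL2 \<longleftrightarrow> g \<in> carrier GL2" for g
    using x by (auto simp: GL2_def invertible_det_nz det_mul)
  ultimately show ?thesis
    using S h x by (intro IndI[where S = "(\<lambda>(n, \<mu>). F n \<mu>) ` S"])
      (auto simp: right_translation_def Ind_equivariant Ind_closed Ind_outside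
        matrix_mul_assoc[symmetric])
qed

end

context hecke_setting
begin

section \<open>Standard functions and the formula for \<open>T\<close> in coordinates\<close>

abbreviation std :: "'f^2^2 \<Rightarrow> 'v \<Rightarrow> 'f^2^2 \<Rightarrow> 'v" where
  "std \<equiv> std_fun nrm V \<rho>"

lemma std_vertex_Ind: assumes "w \<in> carrier V" shows "std (vertex n \<mu>) w \<in> carrier Ind"
proof (rule IndI[where S = "{(n, \<mu>)}"])
  fix \<kappa> g :: "'f^2^2" assume "\<kappa> \<in> KZ nrm" "g \<in> carrier GL2"
  then show "std (vertex n \<mu>) w (\<kappa> ** g) = \<rho> \<kappa> (std (vertex n \<mu>) w g)"
    using assms by (auto simp: std_fun_def GL2_mult_closed KZ_subset_GL2 matrix_mul_assoc[symmetric]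
        KZ_mult_cancel_left \<rho>_mult \<rho>_zero)
qed (use assms in \<open>auto simp: std_fun_def supported_on_def \<rho>_closed split: if_splits\<close>)

lemma std_mult_KZ:
  assumes "\<kappa> \<in> KZ nrm" "w \<in> carrier V" shows "std (g ** \<kappa>) w = std g (\<rho> \<kappa> w)"
  using assms by (auto simp: std_fun_def fun_eq_iff matrix_mul_assoc KZ_mult_cancel_right \<rho>_mult)

lemma right_translation_std:
  assumes "x \<in> carrier GL2" shows "right_translation x (std g w) = std (x ** g) w"
proof -
  have "g' ** x \<in> carrier GL2 \<longleftrightarrow> g' \<in> carrier GL2" for g'
    using assms by (auto simp: GL2_def invertible_det_nz det_mul)
  then show ?thesis by (auto simp: std_fun_def right_translation_def fun_eq_iff matrix_mul_assoc)
qed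

lemma vertex_0_0: "vertex 0 0 = mat 1"
  by (simp add: vertex_def mat_mat2)

lemma co_std:
  assumes "w \<in> carrier V"
  shows "co (std (vertex m \<mu>') w) n \<mu> =
    (if m = n \<and> valint ((\<mu>' - \<mu>) / \<pi> powi n) then uact (red ((\<mu>' - \<mu>) / \<pi> powi n)) (\<phi> w) else (\<lambda>_.
      0))"
  using assms
  by (auto simp: co_def std_fun_def vertex_adjacent vertex_inv_mult_vertex_same \<phi>_\<rho>_unipotent
    \<phi>_zero)

lemma co_right_translation_vertex:
  "co (right_translation (vertex m \<mu>') h) n \<mu> = co h (n - m) ((\<mu> - \<mu>') / \<pi> powi m)"
proof -
  have "vertex_inv n \<mu> ** vertex m \<mu>' = vertex_inv (n - m) ((\<mu> - \<mu>') / \<pi> powi m)"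
    unfolding vertex_inv_mult_vertex by (simp add: vertex_inv_def power_int_diff field_simps)
  then show ?thesis by (simp add: co_def right_translation_def)
qed

lemma T_closed: "h \<in> carrier Ind \<Longrightarrow> T h \<in> carrier Ind"
  using hecke by (auto simp: hecke_operator_def lin_maps_def)

lemma T_add: "h \<in> carrier Ind \<Longrightarrow> h' \<in> carrier Ind \<Longrightarrow>
    T (\<lambda>g. h g \<oplus>\<^bsub>V\<^esub> h' g) = (\<lambda>g. T h g \<oplus>\<^bsub>V\<^esub> T h' g)"
  using hecke by (simp add: hecke_operator_def lin_maps_def)

lemma T_smult: "h \<in> carrier Ind \<Longrightarrow> T (\<lambda>g. c \<odot>\<^bsub>V\<^esub> h g) = (\<lambda>g. c \<odot>\<^bsub>V\<^esub> T h g)"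
  using hecke by (simp add: hecke_operator_def lin_maps_def)

lemma T_right_translation: "x \<in> carrier GL2 \<Longrightarrow> h \<in> carrier Ind \<Longrightarrow>
    T (right_translation x h) = right_translation x (T h)"
  using hecke by (simp add: hecke_operator_def)

lemma T_zero: "T (\<lambda>g. \<zero>\<^bsub>V\<^esub>) = (\<lambda>g. \<zero>\<^bsub>V\<^esub>)"
  using T_smult[OF Ind_zero, of 0] T_closed[OF Ind_zero] Ind_closed V.smult_l_null by simp

lemma zero_le_r [simp]: "(\<lambda>_. 0) \<le> r"
  by (simp add: le_fun_def)

lemma monomial_supported: "i \<le> r \<Longrightarrow> \<forall>j. c * monomial i j \<noteq> (0 :: 'k) \<longrightarrow> j \<le> r"
  by (auto simp: monomial_def)

lemma uact_smult_monomial: "uact a (\<lambda>j. c * monomial i j) = (\<lambda>j. c * uact a (monomial i) j)"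
  by (rule uact_scale)

text \<open>The values of \<open>teichmueller\<close> are left as they stand: that they are lifts is
  deduced from this very formula.\<close>

lemma co_T_std:
  assumes v: "v \<in> carrier V"
  shows "co (T (std (mat 1) v)) n \<mu> = (\<lambda>i.
    (\<Sum>l\<in>carrier (residue_field nrm). if n = 1 \<and> valint ((teichmueller nrm l - \<mu>) / \<pi>)
       then uact (- \<iota> l) (\<phi> v) (\<lambda>_. 0) * xr i else 0) +
    (if n = - 1 \<and> valint (- (\<pi> * \<mu>)) then \<nu> * \<phi> v r * uact (red (- (\<pi> * \<mu>))) (monomial r) i else
      0))"
proof -
  let ?R = "carrier (residue_field nrm)"
  define s where "s l = uact (- \<iota> l) (\<phi> v) (\<lambda>_. 0)" for l
  have s: "(\<Sum>i\<in>{..r}. \<phi> v i * (- \<iota> l) ^ (\<Sum>j<f. p ^ j * i j)) = s l" for l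
    by (simp add: s_def uact_bottom weight_def)
  define h1 where "h1 l = std (vertex 1 (teichmueller nrm l)) (\<psi> (\<lambda>i. s l * xr i))" for l
  define h2 where "h2 = std (vertex (- 1) 0) (\<rho> (mat \<pi>) (\<psi> (\<lambda>i. \<phi> v r * monomial r i)))"
  have w1: "\<psi> (\<lambda>i. c * xr i) \<in> carrier V"
    "\<phi> (\<psi> (\<lambda>i. c * xr i)) = (\<lambda>i. c * xr i)" for c
    by (rule \<psi>_closed \<phi>_\<psi>, rule monomial_supported, simp)+
  have w2: "\<psi> (\<lambda>i. c * monomial r i) \<in> carrier V"
    "\<phi> (\<psi> (\<lambda>i. c * monomial r i)) = (\<lambda>i. c * monomial r i)" for c
    by (rule \<psi>_closed \<phi>_\<psi>, rule monomial_supported, simp)+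
  have h1: "h1 l \<in> carrier Ind" for l unfolding h1_def by (intro std_vertex_Ind w1)
  have h2: "h2 \<in> carrier Ind" unfolding h2_def by (intro std_vertex_Ind \<rho>_closed w2) auto
  \<comment> \<open>Pulling out a central matrix gives the second matrix of the formula the form of
    a vertex; the central matrix acts by \<nu>.\<close>
  have "mat2 1 0 0 \<pi> = vertex (- 1) 0 ** mat \<pi>" by (simp add: vertex_def mat_mat2 power_int_minus)
  then have std2: "std (mat2 1 0 0 \<pi>) w = std (vertex (- 1) 0) (\<rho> (mat \<pi>) w)" if "w \<in> carrier V"
    for w
    using that by (simp add: std_mult_KZ)
  have "T (std (mat 1) v) = (\<Oplus>\<^bsub>Ind\<^esub>l\<in>?R. h1 l) \<oplus>\<^bsub>Ind\<^esub> h2"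
    using hecke v unfolding hecke_operator_def
    by (simp add: s \<psi>_def[symmetric] h1_def h2_def vertex_def[of 1] std2 w2)
  then have "co (T (std (mat 1) v)) n \<mu> = (\<lambda>i. (\<Sum>l\<in>?R. co (h1 l) n \<mu> i) + co h2 n \<mu> i)"
    using h1 h2 finite_residue_field by (simp add: co_add co_finsum Ind.finsum_closed)
  moreover have "co (h1 l) n \<mu> i = (if n = 1 \<and> valint ((teichmueller nrm l - \<mu>) / \<pi>)
       then s l * xr i else 0)" for l i
    unfolding h1_def using w1 by (auto simp: co_std uact_smult_monomial uact_x)
  moreover have "co h2 n \<mu> i = (if n = - 1 \<and> valint (- (\<pi> * \<mu>))
      then \<nu> * \<phi> v r * uact (red (- (\<pi> * \<mu>))) (monomial r) i else 0)" for i
  proof -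
    let ?w = "\<rho> (mat \<pi>) (\<psi> (\<lambda>i. \<phi> v r * monomial r i))"
    have w: "?w \<in> carrier V" "\<phi> ?w = (\<lambda>i. \<nu> * (\<phi> v r * monomial r i))"
      using w2 by (simp_all add: \<rho>_\<pi> \<phi>_smult V.smult_closed)
    have "(0 - \<mu>) / \<pi> powi (- 1) = - (\<pi> * \<mu>)" by (simp add: power_int_minus field_simps)
    then show ?thesis
      unfolding h2_def co_std[OF w(1)] w(2) by (auto simp: uact_scale mult.assoc)
  qed
  ultimately show ?thesis unfolding s_def[symmetric] by simp
qed

section \<open>Teichmueller representatives\<close>

text \<open>For two fixed points of the q-th power map, x - y = x^q - y^q is x - y times a sum
  \<open>?s\<close>. In one residue class this sum reduces to q y^(q-1) = 0, so x - y would be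
  smaller than itself unless it vanishes.\<close>

lemma teichmueller_unique:
  assumes "valint a" "x \<in> res nrm a" "y \<in> res nrm a" "x ^ (p ^ f) = x" "y ^ (p ^ f) = y"
  shows "x = y"
proof (rule ccontr)
  assume "x \<noteq> y"
  have ax: "nrm (x - a) < 1" "nrm (y - a) < 1" using assms by (simp_all add: mem_res_iff)
  then have int: "valint x" "valint y"
    using assms(1) valint_add[of "x - a" a] valint_add[of "y - a" a] by simp_all
  have red: "red x = red y" using ax assms(1) int red_eq_iff[of x a] red_eq_iff[of y a] by simp
  let ?s = "\<Sum>i<p ^ f. y ^ (p ^ f - Suc i) * x ^ i"
  have red_power: "red (z ^ n) = red z ^ n" if "valint z" for z n
    using that by (induction n) (simp_all add: red_mult valint_power)
  have int_s: "valint ?s" using int by (intro valint_sum valint_mult valint_power)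
  have "red ?s = (\<Sum>i<p ^ f. red y ^ (p ^ f - Suc i) * red y ^ i)"
    using int by (subst red_sum) (simp_all add: red_mult valint_mult valint_power red_power red)
  also have "\<dots> = (\<Sum>i<p ^ f. red y ^ (p ^ f - 1))"
    by (rule sum.cong) (simp_all add: power_add[symmetric])
  also have "\<dots> = of_nat (p ^ f) * red y ^ (p ^ f - 1)" by simp
  also have "(of_nat (p ^ f) :: 'k) = 0"
    using f_pos of_nat_CHAR[where 'a='k] by (simp add: char_k power_0_left)
  finally have "nrm ?s < 1" using int_s by (simp add: red_eq_0_iff)
  moreover have "x - y = (x - y) * ?s"
    using assms(4,5) power_diff_sumr2[of x "p ^ f" y] by (simp add: mult.commute)
  then have "nrm (x - y) = nrm (x - y) * nrm ?s" by (metis nrm_mult)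
  then have "nrm ?s = 1" using \<open>x \<noteq> y\<close> nrm_eq_0_iff[of "x - y"] by simp
  ultimately show False by simp
qed

text \<open>Without completeness of \<open>F\<close> at hand, the existence of Teichmueller lifts is read off from the
  existence of \<open>T\<close>: the element \<open>[1, x\<^sup>r]\<close> is invariant under integral unipotents, hence so is its
  image, and therefore every residue class contains the same number, modulo \<open>p\<close>, of the
  representatives in the formula for \<open>T\<close>. Classes without Teichmueller lift all share the junk
  value of the definite description on the empty predicate.\<close>

lemma teichmueller:
  assumes l: "l \<in> carrier (residue_field nrm)"
  shows "valint (teichmueller nrm l)" "red (teichmueller nrm l) = \<iota> l"
proof -
  let ?R = "carrier (residue_field nrm)"
  define t where "t = teichmueller nrm"
  define C where "C \<mu> = {l \<in> ?R. nrm (t l - \<mu>) < 1}" for \<mu>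
  define x0 where "x0 = (THE x :: 'f. False)"
  have lift_or_junk: "nrm (t (res nrm a) - a) < 1 \<or> t (res nrm a) = x0" if a: "valint a" for a
  proof (cases "\<exists>x. x \<in> res nrm a \<and> x ^ (p ^ f) = x")
    case True
    then have "\<exists>!x. x \<in> res nrm a \<and> x ^ (p ^ f) = x" using teichmueller_unique[OF a] by blast
    from theI'[OF this] show ?thesis
      using a by (simp add: t_def teichmueller_def res_card mem_res_iff)
  next
    case False
    then have "(\<lambda>x. x \<in> res nrm a \<and> x ^ (p ^ f) = x) = (\<lambda>_. False)" by blast
    then show ?thesis by (simp add: t_def teichmueller_def res_card x0_def)
  qed
  have lift: "nrm (t (res nrm a) - a) < 1" if "a ^ (p ^ f) = a" "valint a" for a
  proof -
    have "a \<in> res nrm a" using that by (simp add: mem_res_iff)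
    then have "\<exists>!x. x \<in> res nrm a \<and> x ^ (p ^ f) = x" using teichmueller_unique[OF that(2)] that(1)
      by blast
    from theI'[OF this] show ?thesis
      using that by (simp add: t_def teichmueller_def res_card mem_res_iff)
  qed
  define v where "v = \<psi> (xr)"
  have mon: "\<forall>j. xr j \<noteq> (0 :: 'k) \<longrightarrow> j \<le> r" by (auto simp: monomial_def)
  have v: "v \<in> carrier V" "\<phi> v = xr" using mon by (simp_all add: v_def \<psi>_closed \<phi>_\<psi>)
  define h where "h = std (mat 1) v"
  have h: "h \<in> carrier Ind" using std_vertex_Ind[OF v(1), of 0 0] by (simp add: h_def vertex_0_0)
  \<comment> \<open>The x^r coefficient of T [1, x^r] at (1, \<mu>) counts the representatives
    congruent to \<mu>.\<close>
  have count: "co (T h) 1 \<mu> (\<lambda>_. 0) = of_nat (card (C \<mu>))" for \<mu>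
  proof -
    have "co (T h) 1 \<mu> (\<lambda>_. 0) = (\<Sum>l\<in>?R. if nrm (t l - \<mu>) < 1 then 1 else 0)"
      unfolding h_def co_T_std[OF v(1)] v(2) uact_x
      using nrm_\<pi> by (simp add: monomial_def t_def nrm_divide nrm_less_1_iff_le cong: if_cong)
    also have "\<dots> = of_nat (card (C \<mu>))"
      using finite_residue_field by (simp add: C_def sum.If_cases Int_def)
    finally show ?thesis .
  qed
  have same: "(of_nat (card (C \<mu>)) :: 'k) = of_nat (card (C 0))" if \<mu>: "valint \<mu>" for \<mu>
  proof -
    have KZ: "vertex 0 \<mu> \<in> KZ nrm" using \<mu> by (simp add: vertex_def upper_in_KZ_iff)
    have "\<phi> (\<rho> (vertex 0 \<mu>) v) = \<phi> v" using \<mu> v by (simp add: vertex_def \<phi>_\<rho>_unipotent uact_x)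
    then have "\<rho> (vertex 0 \<mu>) v = v" using \<phi>_eq_iff[OF \<rho>_closed[OF KZ v(1)] v(1)] by simp
    then have "right_translation (vertex 0 \<mu>) h = h"
      using std_mult_KZ[OF KZ v(1), of "mat 1"] by (simp add: h_def right_translation_std)
    then have "T h = right_translation (vertex 0 \<mu>) (T h)" using T_right_translation[of "vertex 0
      \<mu>" h] h by simp
    then have "co (T h) 1 \<mu> = co (T h) 1 0" using co_right_translation_vertex[of 0 \<mu> "T h" 1 \<mu>] by
      simp
    then show ?thesis by (metis count)
  qed
  obtain a where a: "valint a" "l = res nrm a" using l by (auto simp: carrier_residue_field)
  have "nrm (t l - a) < 1"
  proof (rule ccontr)
    assume bad: "\<not> nrm (t l - a) < 1"
    then have tl: "t l = x0" using lift_or_junk a by blast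
    have class_or_junk: "l' = res nrm \<mu> \<or> t l' = x0" if "l' \<in> C \<mu>" "valint \<mu>" for l' \<mu>
    proof -
      obtain b where b: "valint b" "l' = res nrm b" using \<open>l' \<in> C \<mu>\<close> by (auto simp: C_def
        carrier_residue_field)
      have "l' = res nrm \<mu>" if "nrm (t l' - b) < 1"
      proof -
        have "nrm (b - \<mu>) \<le> max (nrm (t l' - \<mu>)) (nrm (t l' - b))"
          using nrm_diff[of "t l' - \<mu>" "t l' - b"] by (simp add: algebra_simps)
        also have "\<dots> < 1" using that \<open>l' \<in> C \<mu>\<close> by (simp add: C_def)
        finally show ?thesis using b \<open>valint \<mu>\<close> by (simp add: res_eq_iff)
      qed
      then show ?thesis using lift_or_junk[OF b(1)] b(2) by blast
    qed
    \<comment> \<open>A member of \<open>C a\<close> is the class of \<open>a\<close> or shares the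
      junk value with it; in both cases its representative is the bad one, which is not congruent to
      \<open>a\<close>.\<close>
    have "C a = {}"
    proof (rule ccontr)
      assume "C a \<noteq> {}"
      then obtain l' where l': "l' \<in> C a" by blast
      then have "t l' = t l" using class_or_junk[OF l' a(1)] tl a(2) by auto
      then show False using l' bad by (simp add: C_def)
    qed
    then have zero: "(of_nat (card (C \<mu>)) :: 'k) = 0" if "valint \<mu>" for \<mu>
      using same[OF that] same[OF a(1)] by simp
    \<comment> \<open>Otherwise exactly one representative, the lift \<mu> itself, would be
      congruent to \<mu>, and 1 is not 0 in \<open>k\<close>.\<close>
    have single: "nrm (x0 - \<mu>) < 1" if "valint \<mu>" "\<mu> ^ (p ^ f) = \<mu>" for \<mu>
    proof (rule ccontr)
      assume x0: "\<not> nrm (x0 - \<mu>) < 1"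
      have "C \<mu> = {res nrm \<mu>}"
      proof
        show "C \<mu> \<subseteq> {res nrm \<mu>}" using class_or_junk that x0 by (auto simp: C_def)
        show "{res nrm \<mu>} \<subseteq> C \<mu>" using lift[OF that(2,1)] that by (auto simp: C_def
          carrier_residue_field)
      qed
      then show False using zero[OF that(1)] by simp
    qed
    \<comment> \<open>0 and 1 are always fixed points of the power map, and \<open>x0\<close> cannot
      be congruent to both.\<close>
    have "nrm x0 < 1" "nrm (x0 - 1) < 1"
      using single[of 0] single[of 1] prime_gt_0_nat[OF prime_p] by (simp_all add: power_0_left)
    then show False using nrm_diff[of x0 "x0 - 1"] by simp
  qed
  then have int: "valint (t l)" using a valint_add[of "t l - a" a] by simp
  then show "valint (teichmueller nrm l)" by (simp add: t_def)
  have "red (t l) = red a" using \<open>nrm (t l - a) < 1\<close> int a by (simp add: red_eq_iff)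
  then show "red (teichmueller nrm l) = \<iota> l" by (simp add: t_def a red_def)
qed

end

section \<open>The Hecke operator on the tree\<close>

locale hecke_digits =
  hecke_setting p nrm f \<pi> \<iota> V \<rho> \<eta> r \<nu> \<phi> T + digit_system p nrm f \<pi> \<iota> \<tau>
  for p nrm f \<pi> and \<iota> :: "'f::field_char_0 set \<Rightarrow> 'k::field" and V :: "('k, 'v) module"
    and \<rho> \<eta> r \<nu> \<phi> T \<tau>
begin

text \<open>A vertex has one neighbour on level n - 1, which enters through its value function, and
  q neighbours on level n + 1, enumerated by the digits, which enter through their y^r
  coefficients.\<close>

definition hecke_co :: "('f^2^2 \<Rightarrow> 'v) \<Rightarrow> int \<Rightarrow> 'f \<Rightarrow> (nat \<Rightarrow> nat) \<Rightarrow> 'k" where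
  "hecke_co h n \<mu> i = co h (n - 1) \<mu> (\<lambda>_. 0) * xr i +
     \<nu> * (\<Sum>a\<in>residues. co h (n + 1) (\<mu> + \<pi> powi n * \<tau> a) r * uact a (monomial r) i)"

lemma valint_divide_iff_red:
  assumes "valint t" shows "valint ((t - \<mu>) / \<pi>) \<longleftrightarrow> valint \<mu> \<and> red t = red \<mu>"
proof -
  have "valint ((t - \<mu>) / \<pi>) \<longleftrightarrow> nrm (t - \<mu>) < 1"
    using nrm_\<pi> by (simp add: nrm_divide nrm_less_1_iff_le)
  moreover have "valint \<mu>" if "nrm (t - \<mu>) < 1"
    using that assms valint_diff[of t "t - \<mu>"] by simp
  ultimately show ?thesis using assms red_eq_iff by blast
qed

lemma co_T_std_origin:
  assumes v: "v \<in> carrier V"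
  shows "co (T (std (mat 1) v)) n \<mu> i = hecke_co (std (mat 1) v) n \<mu> i"
proof -
  let ?R = "carrier (residue_field nrm)"
  have co: "co (std (mat 1) v) m x = (if m = 0 \<and> valint x then uact (- red x) (\<phi> v) else (\<lambda>_. 0))"
    for m x
    using co_std[OF v, of 0 0 m x] by (auto simp: vertex_0_0 red_minus)
  have "(\<Sum>l\<in>?R. if n = 1 \<and> valint ((teichmueller nrm l - \<mu>) / \<pi>)
       then uact (- \<iota> l) (\<phi> v) (\<lambda>_. 0) * xr i else 0) =
     (\<Sum>l\<in>?R. if n = 1 \<and> valint \<mu> \<and> \<iota> l = red \<mu>
       then uact (- \<iota> l) (\<phi> v) (\<lambda>_. 0) * xr i else 0)"
    by (rule sum.cong) (auto simp: valint_divide_iff_red teichmueller)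
  also have "\<dots> = (\<Sum>a\<in>residues. if n = 1 \<and> valint \<mu> \<and> a = red \<mu>
       then uact (- a) (\<phi> v) (\<lambda>_. 0) * xr i else 0)"
    by (rule sum.reindex_bij_betw[OF bij_residues])
  also have "\<dots> = (\<Sum>a\<in>residues. if a = red \<mu> then (if n = 1 \<and> valint \<mu>
       then uact (- a) (\<phi> v) (\<lambda>_. 0) * xr i else 0) else 0)"
    by (rule sum.cong) auto
  also have "\<dots> = co (std (mat 1) v) (n - 1) \<mu> (\<lambda>_. 0) * xr i"
    by (auto simp: co)
  finally have 1: "(\<Sum>l\<in>?R. if n = 1 \<and> valint ((teichmueller nrm l - \<mu>) / \<pi>)
       then uact (- \<iota> l) (\<phi> v) (\<lambda>_. 0) * xr i else 0) =
     co (std (mat 1) v) (n - 1) \<mu> (\<lambda>_. 0) * xr i" .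
  have val: "valint (\<mu> + \<pi> powi (- 1) * \<tau> a) \<longleftrightarrow> valint (- (\<pi> * \<mu>)) \<and> a = red (- (\<pi> * \<mu>))"
    if "a \<in> residues" for a
  proof -
    have "\<mu> + \<pi> powi (- 1) * \<tau> a = (\<tau> a - (- (\<pi> * \<mu>))) / \<pi>" by (simp add: power_int_minus
      field_simps)
    then show ?thesis using that by (simp only: valint_divide_iff_red valint_\<tau> red_\<tau>)
  qed
  have "(\<Sum>a\<in>residues. co (std (mat 1) v) (n + 1) (\<mu> + \<pi> powi n * \<tau> a) r * uact a (monomial r) i) =
    (\<Sum>a\<in>residues. if a = red (- (\<pi> * \<mu>)) then (if n = - 1 \<and> valint (- (\<pi> * \<mu>))
       then \<phi> v r * uact a (monomial r) i else 0) else 0)"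
  proof (rule sum.cong)
    fix a assume a: "a \<in> residues"
    show "co (std (mat 1) v) (n + 1) (\<mu> + \<pi> powi n * \<tau> a) r * uact a (monomial r) i =
      (if a = red (- (\<pi> * \<mu>)) then (if n = - 1 \<and> valint (- (\<pi> * \<mu>))
       then \<phi> v r * uact a (monomial r) i else 0) else 0)"
    proof (cases "n = - 1")
      case True
      show ?thesis unfolding co unfolding True using val[OF a] by (simp add: uact_top)
    qed (auto simp: co)
  qed simp
  also have "\<dots> = (if n = - 1 \<and> valint (- (\<pi> * \<mu>)) then \<phi> v r * uact (red (- (\<pi> * \<mu>))) (monomial r)
    i else 0)"
    by auto
  finally show ?thesis
    unfolding co_T_std[OF v] hecke_co_def 1 by simp
qed

lemma co_T_vertex:
  assumes v: "v \<in> carrier V"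
  shows "co (T (std (vertex m \<mu>') v)) n \<mu> = hecke_co (std (vertex m \<mu>') v) n \<mu>"
proof -
  let ?h = "std (mat 1) v"
  have h: "?h \<in> carrier Ind" using std_vertex_Ind[OF v, of 0 0] by (simp add: vertex_0_0)
  have eq: "std (vertex m \<mu>') v = right_translation (vertex m \<mu>') ?h" by (simp add:
    right_translation_std)
  have arg: "(\<mu> + \<pi> powi n * c - \<mu>') / \<pi> powi m = (\<mu> - \<mu>') / \<pi> powi m + \<pi> powi (n - m) * c" for c
    by (simp add: power_int_diff add_divide_distrib diff_divide_distrib)
  have idx: "n + 1 - m = n - m + 1" "n - 1 - m = n - m - 1" by simp_all
  show ?thesis
    unfolding eq T_right_translation[OF vertex_in_GL2(1) h] co_right_translation_vertex
    by (rule ext) (simp only: co_T_std_origin[OF v] hecke_co_def co_right_translation_vertex arg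
      idx)
qed

text \<open>Both sides are additive in \<open>h\<close>, so the finite support can be peeled off
  vertex by vertex; at a single vertex equivariance reduces to the base vertex.\<close>

theorem co_T:
  assumes "h \<in> carrier Ind" shows "co (T h) n \<mu> = hecke_co h n \<mu>"
proof -
  have main: "\<forall>h\<in>carrier Ind. supported_on h S \<longrightarrow> (\<forall>n \<mu>. co (T h) n \<mu> = hecke_co h n \<mu>)" if "finite
    S" for S
    using that
  proof (induction S rule: finite_induct)
    case empty
    show ?case
    proof (intro ballI impI allI)
      fix h n \<mu> assume h: "h \<in> carrier Ind" "supported_on h {}"
      have "h g = \<zero>\<^bsub>V\<^esub>" for g
        using h by (cases "g \<in> carrier GL2") (auto simp: supported_on_def Ind_outside)
      then have "h = (\<lambda>g. \<zero>\<^bsub>V\<^esub>)" by (rule ext)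
      then show "co (T h) n \<mu> = hecke_co h n \<mu>"
        by (auto simp: hecke_co_def T_zero co_zero)
    qed
  next
    case (insert s S)
    obtain m \<mu>' where s: "s = (m, \<mu>')" by (cases s)
    show ?case
    proof (intro ballI impI allI)
      fix h n \<mu> assume h: "h \<in> carrier Ind" and supp: "supported_on h (insert s S)"
      define w where "w = h (vertex_inv m \<mu>')"
      have w: "w \<in> carrier V" using h by (simp add: w_def Ind_closed)
      define h1 where "h1 = std (vertex m \<mu>') w"
      define h2 where "h2 g = (if g \<in> carrier GL2 \<and> g ** vertex m \<mu>' \<in> KZ nrm then \<zero>\<^bsub>V\<^esub> else h g)"
        for g
      have h1: "h1 \<in> carrier Ind" unfolding h1_def by (rule std_vertex_Ind[OF w])
      have supp2: "supported_on h2 S"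
        using supp unfolding supported_on_def h2_def s by (auto split: if_splits)
      have h2: "h2 \<in> carrier Ind"
        using insert(1) h supp2
        by (intro IndI[where S = S])
          (auto simp: h2_def Ind_outside Ind_closed Ind_equivariant GL2_mult_closed KZ_subset_GL2
            matrix_mul_assoc[symmetric] KZ_mult_cancel_left \<rho>_zero)
      have "h g = h1 g \<oplus>\<^bsub>V\<^esub> h2 g" for g
      proof (cases "g \<in> carrier GL2 \<and> g ** vertex m \<mu>' \<in> KZ nrm")
        case True
        have "h g = h ((g ** vertex m \<mu>') ** vertex_inv m \<mu>')" by (simp add:
          matrix_mul_assoc[symmetric])
        also have "\<dots> = \<rho> (g ** vertex m \<mu>') w" using True h by (simp add: Ind_equivariant w_def)
        finally show ?thesis using True w by (simp add: h1_def h2_def std_fun_def \<rho>_closed)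
      next
        case False
        then show ?thesis using h by (auto simp: h1_def h2_def std_fun_def Ind_closed)
      qed
      then have eq: "h = (\<lambda>g. h1 g \<oplus>\<^bsub>V\<^esub> h2 g)" by blast
      have co1: "co (T h1) n \<mu> = hecke_co h1 n \<mu>" unfolding h1_def by (rule co_T_vertex[OF w])
      have "co (T h) n \<mu> i = hecke_co h1 n \<mu> i + hecke_co h2 n \<mu> i" for i
        using h1 h2 supp2 insert.IH
        by (simp add: eq T_add co_add T_closed co1)
      also have "hecke_co h1 n \<mu> i + hecke_co h2 n \<mu> i = hecke_co h n \<mu> i" for i
        using h1 h2 by (simp add: hecke_co_def eq co_add sum.distrib distrib_left distrib_right)
      finally show "co (T h) n \<mu> = hecke_co h n \<mu>" by blast
    qed
  qed
  obtain S where "finite S" "supported_on h S" using Ind_supported_on[OF assms] by blast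
  then show ?thesis using main assms by blast
qed

end

context residue_embedding
begin

section \<open>Moebius transformations\<close>

text \<open>The fractional linear action of the inverse of \<open>h\<close>. The inverse appears
  because functions are evaluated at \<open>vertex_inv\<close> and \<open>h\<close> acts by right
  translation.\<close>

definition mobius :: "'f^2^2 \<Rightarrow> 'f \<Rightarrow> 'f" where
  "mobius h \<mu> = (h$2$2 * \<mu> - h$1$2) / (h$1$1 - h$2$1 * \<mu>)"

lemma mobius_denominator:
  assumes "mat2 a b c d \<in> GL2_cong 2" "valint x"
  shows "nrm (a - c * x - 1) \<le> nrm \<pi> ^ 2" "nrm (a - c * x) = 1" "a - c * x \<noteq> 0"
proof -
  have "nrm ((a - 1) - c * x) \<le> nrm \<pi> ^ 2"
    by (rule nrm_diff_le[OF _ nrm_mult_le]) (use assms in \<open>simp_all add: mat2_in_GL2_cong_iff\<close>)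
  then show le: "nrm (a - c * x - 1) \<le> nrm \<pi> ^ 2" by (simp add: algebra_simps)
  show 1: "nrm (a - c * x) = 1"
    using le nrm_power_less_1[of 2] by (intro nrm_near_1) simp
  then show "a - c * x \<noteq> 0" by auto
qed

text \<open>The deviation from a translation is (D - A B) (x - y) / (A B), where the determinant
  \<open>D\<close> and the denominators \<open>A\<close>, \<open>B\<close> are all 1 modulo
  \<pi>^2.\<close>

lemma near_identity_mobius: assumes "h \<in> GL2_cong 2" shows "near_identity (mobius h)"
proof -
  obtain a b c d where h: "h = mat2 a b c d" by (rule mat2_cases)
  note h' = assms[unfolded h]
  note int = GL2_cong_det[OF _ h', simplified]
  have mob: "mobius h x = (d * x - b) / (a - c * x)" for x by (simp add: h mobius_def)
  define D where "D = a * d - b * c"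
  show ?thesis
    unfolding near_identity_def
  proof (intro conjI allI impI)
    fix x assume x: "valint x"
    have "valint (d * x - b)" using int x by (intro valint_diff valint_mult) auto
    then show "valint (mobius h x)" using mobius_denominator[OF h' x] by (simp add: mob nrm_divide)
  next
    fix x y assume xy: "valint x" "valint y"
    define A B where "A = a - c * x" and "B = a - c * y"
    note A = mobius_denominator[OF h' xy(1), folded A_def]
    note B = mobius_denominator[OF h' xy(2), folded B_def]
    have "D - A * B = (D - 1) - ((A - 1) * B + (B - 1))" by (simp add: algebra_simps)
    moreover have "nrm \<dots> \<le> nrm \<pi> ^ 2"
      by (rule nrm_diff_le[OF _ nrm_add_le[OF nrm_mult_le]]) (use A B int(5) in \<open>simp_all add:
        D_def\<close>)
    ultimately have le: "nrm (D - A * B) \<le> nrm \<pi> ^ 2" by (simp only:)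
    have "(d * x - b) * B - (d * y - b) * A = D * (x - y)"
      by (simp add: A_def B_def D_def algebra_simps)
    then have "mobius h x - mobius h y = D * (x - y) / (A * B)"
      using A(3) B(3) by (simp add: mob A_def[symmetric] B_def[symmetric] diff_frac_eq)
    then have "mobius h x - mobius h y - (x - y) = (D - A * B) * (x - y) / (A * B)"
      using A(3) B(3) by (simp add: field_simps)
    then have "nrm (mobius h x - mobius h y - (x - y)) = nrm (D - A * B) * nrm (x - y)"
      using A(2) B(2) by (simp only: nrm_divide nrm_mult mult_1 div_by_1)
    then show "nrm (mobius h x - mobius h y - (x - y)) \<le> nrm \<pi> ^ 2 * nrm (x - y)"
      using le by (simp add: mult_right_mono nrm_nonneg)
  qed
qed

text \<open>The witness is lower triangular with diagonal a - c \<mu>, c x + d and corner c \<pi>^n.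
  As the level is nonnegative, the corner stays small and the witness lies in
  \<open>GL2_cong 2\<close>, so it will act trivially on \<open>V\<close>.\<close>

lemma vertex_inv_mult_cong:
  assumes "h \<in> GL2_cong 2" "valint \<mu>"
  shows "\<exists>\<kappa>\<in>GL2_cong 2. vertex_inv (int n) \<mu> ** h = \<kappa> ** vertex_inv (int n) (mobius h \<mu>)"
proof -
  obtain a b c d where h: "h = mat2 a b c d" by (rule mat2_cases)
  note h' = assms(1)[unfolded h]
  note A = mobius_denominator[OF h' assms(2)]
  define x where "x = mobius h \<mu>"
  have x: "valint x" unfolding x_def by (rule near_identity_valint[OF near_identity_mobius[OF
    assms(1)] assms(2)])
  have eq: "(a - c * \<mu>) * x = d * \<mu> - b" using A(3) by (simp add: x_def mobius_def h)
  let ?\<kappa> = "mat2 (a - c * \<mu>) 0 (c * \<pi> ^ n) (c * x + d)"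
  have "?\<kappa> \<in> GL2_cong 2"
    unfolding mat2_in_GL2_cong_iff
  proof (intro conjI)
    have "nrm (c * x + (d - 1)) \<le> nrm \<pi> ^ 2"
      by (rule nrm_add_le[OF nrm_mult_le]) (use h' x in \<open>simp_all add: mat2_in_GL2_cong_iff\<close>)
    then show "nrm (c * x + d - 1) \<le> nrm \<pi> ^ 2" by (simp add: algebra_simps)
    show "nrm (c * \<pi> ^ n) \<le> nrm \<pi> ^ 2"
      by (rule nrm_mult_le) (use h' \<pi>_integral in \<open>simp_all add: mat2_in_GL2_cong_iff valint_power\<close>)
  qed (use A(1) nrm_\<pi> in simp_all)
  moreover have "vertex_inv (int n) \<mu> ** h = ?\<kappa> ** vertex_inv (int n) x"
  proof -
    have "(a - c * \<mu>) * - (x / \<pi> ^ n) = - (((a - c * \<mu>) * x) / \<pi> ^ n)" by simp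
    also have "\<dots> = inverse (\<pi> ^ n) * b - \<mu> / \<pi> ^ n * d"
      unfolding eq by (simp add: divide_inverse algebra_simps)
    finally show ?thesis by (simp add: vertex_inv_def h) (simp add: divide_inverse algebra_simps)
  qed
  ultimately show ?thesis unfolding x_def by blast
qed

text \<open>\<open>vertex_inv_mult_cong\<close>, applied to the inverse of \<open>h\<close>, shows
  that \<open>h\<close> keeps the set of vertices with integral \<mu> on a level n \<ge> 0.\<close>

lemma vertex_inv_cong_vertex:
  assumes h: "h \<in> GL2_cong 2" and \<mu>': "valint \<mu>'"
    and KZ: "(vertex_inv m \<mu> ** h) ** vertex (int n) \<mu>' \<in> KZ nrm"
  shows "m = int n" "valint \<mu>"
proof -
  have hG: "h \<in> carrier GL2" using GL2_cong_subset[OF _ h] by (simp add: GL2_int_def)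
  let ?v = "vertex (int n)" and ?w = "vertex_inv (int n)"
  obtain \<kappa> where \<kappa>: "\<kappa> \<in> GL2_cong 2" "?w \<mu>' ** GL2_inv h = \<kappa> ** ?w (mobius (GL2_inv h) \<mu>')"
    using vertex_inv_mult_cong[OF GL2_cong_inv[OF _ h] \<mu>'] by auto
  define x where "x = mobius (GL2_inv h) \<mu>'"
  have x: "valint x"
    unfolding x_def by (rule near_identity_valint[OF near_identity_mobius[OF GL2_cong_inv[OF _ h]]
      \<mu>']) simp
  have \<kappa>KZ: "\<kappa> \<in> KZ nrm" using GL2_cong_subset[OF _ \<kappa>(1)] GL2_int_subset_KZ by simp
  have "(vertex_inv m \<mu> ** h) ** ?v \<mu>' = (vertex_inv m \<mu> ** ?v x ** GL2_inv \<kappa>) ** ((\<kappa> ** ?w x) **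
    (h ** ?v \<mu>'))"
  proof -
    have "(vertex_inv m \<mu> ** ?v x ** GL2_inv \<kappa>) ** ((\<kappa> ** ?w x) ** (h ** ?v \<mu>')) =
      vertex_inv m \<mu> ** (?v x ** ((GL2_inv \<kappa> ** \<kappa>) ** ?w x)) ** (h ** ?v \<mu>')"
      by (simp only: matrix_mul_assoc)
    then show ?thesis using KZ_subset_GL2[OF \<kappa>KZ] by (simp add: GL2_inv matrix_mul_assoc)
  qed
  also have "(\<kappa> ** ?w x) ** (h ** ?v \<mu>') = ?w \<mu>' ** (GL2_inv h ** h) ** ?v \<mu>'"
    unfolding x_def \<kappa>(2)[symmetric] by (simp only: matrix_mul_assoc)
  also have "\<dots> = mat 1" using hG by (simp add: GL2_inv)
  finally have "vertex_inv m \<mu> ** ?v x ** GL2_inv \<kappa> \<in> KZ nrm" using KZ by simp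
  then have "vertex_inv m \<mu> ** ?v x \<in> KZ nrm" using KZ_mult_cancel_right KZ_inv[OF \<kappa>KZ] by blast
  then have *: "m = int n" "valint ((x - \<mu>) / \<pi> ^ n)" by (auto simp: vertex_adjacent)
  then have "valint (\<pi> ^ n * ((x - \<mu>) / \<pi> ^ n))"
    using \<pi>_integral by (intro valint_mult valint_power)
  then have "valint (x - \<mu>)" by simp
  then show "valint \<mu>" using x valint_diff[of x "x - \<mu>"] by simp
  show "m = int n" by (rule *)
qed

text \<open>A polynomial of degree below q with q roots.\<close>

lemma residue_polynomial_zero:
  assumes "\<And>a. a \<in> residues \<Longrightarrow> (\<Sum>k<p ^ f. d k * a ^ k) = 0" "k < p ^ f"
  shows "d k = 0"
proof -
  define P where "P = (\<Sum>k<p ^ f. Polynomial.monom (d k) k)"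
  have coeff: "Polynomial.coeff P j = (if j < p ^ f then d j else 0)" for j
    by (simp add: P_def coeff_sum)
  have deg: "degree P < p ^ f"
    using prime_gt_0_nat[OF prime_p] by (intro degree_lessI) (auto simp: coeff)
  have "P = 0"
  proof (rule ccontr)
    assume "P \<noteq> 0"
    have "residues \<subseteq> {a. poly P a = 0}" using assms(1) by (auto simp: P_def poly_sum poly_monom)
    then have "card residues \<le> card {a. poly P a = 0}"
      by (intro card_mono poly_roots_finite \<open>P \<noteq> 0\<close>)
    also have "\<dots> \<le> degree P" by (rule card_poly_roots_bound[OF \<open>P \<noteq> 0\<close>])
    finally show False using deg card_residues by simp
  qed
  then show ?thesis using coeff[of k] assms(2) by simp
qed

end

section \<open>Vectors of \<open>Sym r\<close> as polynomial functions on the residue field\<close>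

context hecke_setting
begin

lemma weight_le_r_less: "i \<le> r \<Longrightarrow> weight p f i < p ^ f"
  by (intro weight_less allI impI le_r_less_p)

lemma weight_inj_on_r: "inj_on (weight p f) {..r}"
  by (rule inj_on_subset[OF weight_inj]) (auto simp: le_r_less_p le_r_eq_0)

lemma uact_bottom_eq_sum:
  "uact a u (\<lambda>_. 0) = (\<Sum>k<p ^ f. (\<Sum>i\<in>{i\<in>{..r}. weight p f i = k}. u i) * a ^ k)"
proof -
  have "uact a u (\<lambda>_. 0) = (\<Sum>k<p ^ f. \<Sum>i\<in>{i\<in>{..r}. weight p f i = k}. u i * a ^ weight p f i)"
    unfolding uact_bottom using weight_le_r_less by (subst sum.group) auto
  also have "\<dots> = (\<Sum>k<p ^ f. (\<Sum>i\<in>{i\<in>{..r}. weight p f i = k}. u i) * a ^ k)"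
    unfolding sum_distrib_right by (intro sum.cong refl) auto
  finally show ?thesis .
qed

lemma weight_fibre: "i \<le> r \<Longrightarrow> {i'\<in>{..r}. weight p f i' = weight p f i} = {i}"
  using weight_inj_on_r by (auto simp: inj_on_def)

text \<open>The weights of the exponents up to r are distinct and below q, so a vector can be
  recovered from its value function.\<close>

lemma uact_bottom_zero:
  assumes "\<And>a. a \<in> residues \<Longrightarrow> uact a u (\<lambda>_. 0) = 0" "i \<le> r" shows "u i = 0"
proof -
  let ?d = "\<lambda>k. \<Sum>i\<in>{i'\<in>{..r}. weight p f i' = k}. u i"
  have "?d (weight p f i) = 0"
    by (rule residue_polynomial_zero[where d = ?d])
      (use assms weight_le_r_less in \<open>simp_all only: uact_bottom_eq_sum[symmetric]\<close>)
  then show ?thesis unfolding weight_fibre[OF assms(2)] by simp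
qed

text \<open>The coefficient of the value function at the exponent \<open>k\<close> would have to be
  1, while no monomial of \<open>Sym r\<close> has weight \<open>k\<close>.\<close>

lemma uact_bottom_not_power:
  assumes k: "k < p ^ f" "k \<notin> weight p f ` {..r}"
  shows "\<not> (\<forall>a\<in>residues. uact a u (\<lambda>_. 0) = a ^ k)"
proof
  assume *: "\<forall>a\<in>residues. uact a u (\<lambda>_. 0) = a ^ k"
  define d where "d j = (\<Sum>i\<in>{i\<in>{..r}. weight p f i = j}. u i)" for j
  have "d k - (if k = k then 1 else 0) = 0"
  proof (rule residue_polynomial_zero[where d = "\<lambda>j. d j - (if j = k then 1 else 0)", OF _ k(1)])
    fix a assume "a \<in> residues"
    have "(\<Sum>j<p ^ f. (d j - (if j = k then 1 else 0)) * a ^ j) =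
      (\<Sum>j<p ^ f. d j * a ^ j) - (\<Sum>j<p ^ f. if j = k then a ^ k else 0)"
      unfolding sum_subtractf[symmetric] by (rule sum.cong) (auto simp: algebra_simps)
    moreover have "(\<Sum>j<p ^ f. d j * a ^ j) = uact a u (\<lambda>_. 0)"
      unfolding d_def by (rule uact_bottom_eq_sum[symmetric])
    ultimately show "(\<Sum>j<p ^ f. (d j - (if j = k then 1 else 0)) * a ^ j) = 0"
      using * \<open>a \<in> residues\<close> k(1) by simp
  qed
  moreover have "{i\<in>{..r}. weight p f i = k} = {}" using k(2) by auto
  then have "d k = 0" unfolding d_def by (simp only: sum.empty)
  ultimately show False by simp
qed

end

context hecke_digits
begin

section \<open>Functions supported on one level\<close>

text \<open>Coordinates of an element supported on the vertices (n, \<mu>) with integral \<mu>; the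
  second clause is the compatibility found in \<open>co_translate\<close>.\<close>

definition level_fun :: "nat \<Rightarrow> ('f \<Rightarrow> (nat \<Rightarrow> nat) \<Rightarrow> 'k) \<Rightarrow> bool" where
  "level_fun n F \<longleftrightarrow> (\<forall>\<mu> i. valint \<mu> \<longrightarrow> F \<mu> i \<noteq> 0 \<longrightarrow> i \<le> r) \<and>
     (\<forall>\<mu> c. valint \<mu> \<longrightarrow> valint c \<longrightarrow> F (\<mu> + \<pi> ^ n * c) = uact (- red c) (F \<mu>))"

text \<open>The element with coordinates \<open>F\<close>. The representative \<mu> is picked by
  choice; \<open>emb_eq\<close> shows that the value does not depend on it.\<close>

definition emb :: "nat \<Rightarrow> ('f \<Rightarrow> (nat \<Rightarrow> nat) \<Rightarrow> 'k) \<Rightarrow> 'f^2^2 \<Rightarrow> 'v" where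
  "emb n F g =
     (if g \<in> carrier GL2 \<and> (\<exists>\<mu>. valint \<mu> \<and> g ** vertex (int n) \<mu> \<in> KZ nrm)
      then let \<mu> = SOME \<mu>. valint \<mu> \<and> g ** vertex (int n) \<mu> \<in> KZ nrm
           in \<rho> (g ** vertex (int n) \<mu>) (\<psi> (F \<mu>))
      else \<zero>\<^bsub>V\<^esub>)"

lemma valint_translate: "valint \<mu> \<Longrightarrow> valint c \<Longrightarrow> valint (\<mu> + \<pi> ^ n * c)"
  using \<pi>_integral by (intro valint_add valint_mult valint_power)

lemma level_funD:
  assumes "level_fun n F" "valint \<mu>"
  shows "\<forall>i. F \<mu> i \<noteq> 0 \<longrightarrow> i \<le> r" "\<psi> (F \<mu>) \<in> carrier V" "\<phi> (\<psi> (F \<mu>)) = F \<mu>"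
    "valint c \<Longrightarrow> F (\<mu> + \<pi> ^ n * c) = uact (- red c) (F \<mu>)"
proof -
  show *: "\<forall>i. F \<mu> i \<noteq> 0 \<longrightarrow> i \<le> r" using assms by (simp add: level_fun_def)
  show "\<psi> (F \<mu>) \<in> carrier V" "\<phi> (\<psi> (F \<mu>)) = F \<mu>" using * by (simp_all add: \<psi>_closed \<phi>_\<psi>)
  show "valint c \<Longrightarrow> F (\<mu> + \<pi> ^ n * c) = uact (- red c) (F \<mu>)"
    using assms by (simp add: level_fun_def)
qed

lemma vertex_translate: "vertex (int n) (\<mu> + \<pi> ^ n * c) = vertex (int n) \<mu> ** mat2 1 c 0 1"
  by (simp add: vertex_def)

lemma emb_eq:
  assumes F: "level_fun n F" and g: "g \<in> carrier GL2" and \<mu>: "valint \<mu>"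
    and KZ: "g ** vertex (int n) \<mu> \<in> KZ nrm"
  shows "emb n F g = \<rho> (g ** vertex (int n) \<mu>) (\<psi> (F \<mu>))"
proof -
  define \<mu>' where "\<mu>' = (SOME \<mu>. valint \<mu> \<and> g ** vertex (int n) \<mu> \<in> KZ nrm)"
  have \<mu>': "valint \<mu>'" "g ** vertex (int n) \<mu>' \<in> KZ nrm"
    using someI[of "\<lambda>\<mu>. valint \<mu> \<and> g ** vertex (int n) \<mu> \<in> KZ nrm" \<mu>] \<mu> KZ by (auto simp: \<mu>'_def)
  define c where "c = (\<mu> - \<mu>') / \<pi> ^ n"
  have \<mu>_eq: "\<mu> = \<mu>' + \<pi> ^ n * c" by (simp add: c_def)
  have eq: "g ** vertex (int n) \<mu> = (g ** vertex (int n) \<mu>') ** mat2 1 c 0 1"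
    unfolding \<mu>_eq vertex_translate by (simp only: matrix_mul_assoc)
  then have "mat2 1 c 0 1 \<in> KZ nrm" using KZ KZ_mult_cancel_left[OF \<mu>'(2)] by simp
  then have c: "valint c" "mat2 1 c 0 1 \<in> KZ nrm" by (simp_all add: upper_in_KZ_iff)
  note F\<mu> = level_funD[OF F \<mu>] and F\<mu>' = level_funD[OF F \<mu>'(1)]
  have "\<phi> (\<rho> (mat2 1 c 0 1) (\<psi> (F \<mu>))) = uact (red c) (F (\<mu>' + \<pi> ^ n * c))"
    using F\<mu> c by (simp add: \<phi>_\<rho>_unipotent \<mu>_eq[symmetric])
  also have "\<dots> = F \<mu>'"
    using c(1) F\<mu>' by (simp add: uact_uact residues_closed uact_0)
  finally have "\<rho> (mat2 1 c 0 1) (\<psi> (F \<mu>)) = \<psi> (F \<mu>')"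
    using F\<mu> F\<mu>' c by (subst \<phi>_eq_iff[symmetric]) (simp_all add: \<rho>_closed)
  then have "\<rho> (g ** vertex (int n) \<mu>) (\<psi> (F \<mu>)) = \<rho> (g ** vertex (int n) \<mu>') (\<psi> (F \<mu>'))"
    unfolding eq using \<mu>'(2) c(2) F\<mu>(2) by (simp add: \<rho>_mult)
  moreover have "emb n F g = \<rho> (g ** vertex (int n) \<mu>') (\<psi> (F \<mu>'))"
    using g \<mu> KZ by (auto simp: emb_def \<mu>'_def Let_def)
  ultimately show ?thesis by simp
qed

lemma emb_outside:
  "(\<And>\<mu>. valint \<mu> \<Longrightarrow> g ** vertex (int n) \<mu> \<notin> KZ nrm) \<Longrightarrow> emb n F g = \<zero>\<^bsub>V\<^esub>"
  by (auto simp: emb_def)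

lemma finite_representatives:
  "\<exists>R. finite R \<and> (\<forall>x. valint x \<longrightarrow> (\<exists>y\<in>R. \<exists>c. valint c \<and> y = x + \<pi> ^ n * c))"
proof (induction n)
  case 0
  show ?case by (intro exI[of _ "{0}"]) (auto intro!: exI[of _ "- x" for x])
next
  case (Suc n)
  then obtain R where R: "finite R" "\<And>x. valint x \<Longrightarrow> \<exists>y\<in>R. \<exists>c. valint c \<and> y = x + \<pi> ^ n * c" by blast
  have "\<exists>y\<in>(\<lambda>(a, y). \<tau> a + \<pi> * y) ` (residues \<times> R). \<exists>c. valint c \<and> y = x + \<pi> ^ Suc n * c"
    if x: "valint x" for x
  proof -
    obtain y c where y: "y \<in> R" "valint c" "y = shift x + \<pi> ^ n * c"
      using R(2)[OF valint_shift[OF x]] by blast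
    then have "\<tau> (red x) + \<pi> * y = x + \<pi> ^ Suc n * c"
      unfolding y(3) distrib_left by (simp add: shift_def)
    then show ?thesis using y(1,2) x by force
  qed
  then show ?case using R(1) by (intro exI[of _ "(\<lambda>(a, y). \<tau> a + \<pi> * y) ` (residues \<times> R)"]) auto
qed

lemma emb_Ind: assumes F: "level_fun n F" shows "emb n F \<in> carrier Ind"
proof -
  obtain R where R: "finite R" "\<And>x. valint x \<Longrightarrow> \<exists>y\<in>R. \<exists>c. valint c \<and> y = x + \<pi> ^ n * c"
    using finite_representatives by blast
  show ?thesis
  proof (rule IndI[where S = "Pair (int n) ` R"])
    show "supported_on (emb n F) (Pair (int n) ` R)"
      unfolding supported_on_def
    proof (intro ballI impI)
      fix g assume g: "g \<in> carrier GL2" "emb n F g \<noteq> \<zero>\<^bsub>V\<^esub>"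
      then obtain \<mu> where \<mu>: "valint \<mu>" "g ** vertex (int n) \<mu> \<in> KZ nrm" using emb_outside by blast
      obtain y c where y: "y \<in> R" "valint c" "y = \<mu> + \<pi> ^ n * c" using R(2)[OF \<mu>(1)] by blast
      have "g ** vertex (int n) y = (g ** vertex (int n) \<mu>) ** mat2 1 c 0 1"
        unfolding y(3) vertex_translate by (simp only: matrix_mul_assoc)
      then have "g ** vertex (int n) y \<in> KZ nrm"
        using \<mu>(2) y(2) by (simp add: KZ_mult_cancel_left upper_in_KZ_iff)
      then show "\<exists>(n, \<mu>)\<in>Pair (int n) ` R. g ** vertex n \<mu> \<in> KZ nrm" using y(1) by auto
    qed
  next
    fix \<kappa> g :: "'f^2^2" assume \<kappa>: "\<kappa> \<in> KZ nrm" and g: "g \<in> carrier GL2"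
    have \<kappa>g: "\<kappa> ** g \<in> carrier GL2" using \<kappa> g by (simp add: KZ_subset_GL2 GL2_mult_closed)
    have iff: "(\<kappa> ** g) ** vertex (int n) \<mu> \<in> KZ nrm \<longleftrightarrow> g ** vertex (int n) \<mu> \<in> KZ nrm" for \<mu>
      using KZ_mult_cancel_left[OF \<kappa>] by (simp add: matrix_mul_assoc[symmetric])
    show "emb n F (\<kappa> ** g) = \<rho> \<kappa> (emb n F g)"
    proof (cases "\<exists>\<mu>. valint \<mu> \<and> g ** vertex (int n) \<mu> \<in> KZ nrm")
      case True
      then obtain \<mu> where \<mu>: "valint \<mu>" "g ** vertex (int n) \<mu> \<in> KZ nrm" by blast
      have "emb n F (\<kappa> ** g) = \<rho> (\<kappa> ** (g ** vertex (int n) \<mu>)) (\<psi> (F \<mu>))"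
        using emb_eq[OF F \<kappa>g \<mu>(1)] \<mu>(2) iff by (simp add: matrix_mul_assoc)
      also have "\<dots> = \<rho> \<kappa> (emb n F g)"
        using emb_eq[OF F g \<mu>] \<kappa> \<mu> level_funD(2)[OF F \<mu>(1)] by (simp add: \<rho>_mult)
      finally show ?thesis .
    next
      case False
      then show ?thesis using \<kappa> by (simp add: emb_outside iff \<rho>_zero)
    qed
  next
    fix g :: "'f^2^2" assume g: "g \<in> carrier GL2"
    show "emb n F g \<in> carrier V"
    proof (cases "\<exists>\<mu>. valint \<mu> \<and> g ** vertex (int n) \<mu> \<in> KZ nrm")
      case True
      then show ?thesis using emb_eq[OF F g] level_funD(2)[OF F] by (auto simp: \<rho>_closed)
    next
      case False
      then show ?thesis by (simp add: emb_outside)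
    qed
  qed (use R in \<open>auto simp: emb_def\<close>)
qed

lemma valint_near:
  assumes "valint ((\<mu>' - \<mu>) / \<pi> ^ n)" shows "valint \<mu>' \<longleftrightarrow> valint \<mu>"
proof -
  have "valint (\<pi> ^ n * ((\<mu>' - \<mu>) / \<pi> ^ n))"
    using assms \<pi>_integral by (intro valint_mult valint_power)
  then have "valint (\<mu>' - \<mu>)" by simp
  then show ?thesis using valint_add[of "\<mu>' - \<mu>" \<mu>] valint_diff[of \<mu>' "\<mu>' - \<mu>"] by auto
qed

lemma co_emb:
  assumes F: "level_fun n F"
  shows "co (emb n F) m \<mu> = (if m = int n \<and> valint \<mu> then F \<mu> else (\<lambda>_. 0))"
proof (cases "m = int n \<and> valint \<mu>")
  case True
  then show ?thesis
    using emb_eq[OF F, of "vertex_inv m \<mu>" \<mu>] level_funD[OF F]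
    by (simp add: co_def \<rho>_one)
next
  case False
  have "emb n F (vertex_inv m \<mu>) = \<zero>\<^bsub>V\<^esub>"
  proof (rule emb_outside)
    fix \<mu>' assume "valint \<mu>'"
    then show "vertex_inv m \<mu> ** vertex (int n) \<mu>' \<notin> KZ nrm"
      using False valint_near[of \<mu>' \<mu> n] by (auto simp: vertex_adjacent)
  qed
  then show ?thesis using False by (auto simp: co_def \<phi>_zero)
qed

text \<open>The factor from \<open>GL2_cong 2\<close> acts trivially on \<open>V\<close>, so
  \<open>h\<close> acts on coordinates by substitution alone.\<close>

lemma co_right_translation_emb:
  assumes F: "level_fun n F" and h: "h \<in> GL2_cong 2"
  shows "co (right_translation h (emb n F)) m \<mu> =
    (if m = int n \<and> valint \<mu> then F (mobius h \<mu>) else (\<lambda>_. 0))"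
proof (cases "m = int n \<and> valint \<mu>")
  case True
  then have \<mu>: "valint \<mu>" and m: "m = int n" by auto
  obtain \<kappa> where \<kappa>: "\<kappa> \<in> GL2_cong 2" "vertex_inv (int n) \<mu> ** h = \<kappa> ** vertex_inv (int n) (mobius
    h \<mu>)"
    using vertex_inv_mult_cong[OF h \<mu>] by blast
  have KZ: "\<kappa> \<in> KZ nrm" using GL2_cong_subset[OF _ \<kappa>(1)] GL2_int_subset_KZ by simp
  have "right_translation h (emb n F) (vertex_inv (int n) \<mu>) = \<rho> \<kappa> (emb n F (vertex_inv (int n)
    (mobius h \<mu>)))"
    using KZ by (simp add: right_translation_def \<kappa>(2) Ind_equivariant[OF emb_Ind[OF F]])
  also have "\<dots> = emb n F (vertex_inv (int n) (mobius h \<mu>))"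
    using \<kappa>(1) by (intro \<rho>_cong[of 2]) (auto simp: Ind_closed emb_Ind[OF F])
  finally have "co (right_translation h (emb n F)) m \<mu> = co (emb n F) m (mobius h \<mu>)"
    by (simp add: co_def m)
  then show ?thesis
    using True near_identity_valint[OF near_identity_mobius[OF h] \<mu>] by (simp add: co_emb[OF F])
next
  case False
  have "emb n F (vertex_inv m \<mu> ** h) = \<zero>\<^bsub>V\<^esub>"
    using False vertex_inv_cong_vertex[OF h] by (intro emb_outside) blast
  then show ?thesis using False by (auto simp: co_def right_translation_def \<phi>_zero)
qed

text \<open>\<open>T\<close> maps the function on level \<open>n + 1\<close> given by \<open>G\<close> to the sum of a function on level \<open>n + 2\<close>,
  which sees the coefficients of \<open>x\<^sup>r\<close>, and one on level \<open>n\<close>, which sees those of \<open>y\<^sup>r\<close>. The second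
  one is required to vanish.\<close>

definition descends :: "nat \<Rightarrow> ('f \<Rightarrow> (nat \<Rightarrow> nat) \<Rightarrow> 'k) \<Rightarrow> bool" where
  "descends n G \<longleftrightarrow> level_fun (Suc n) G \<and>
     (\<forall>\<mu> i. valint \<mu> \<longrightarrow> (\<Sum>a\<in>residues. G (\<mu> + \<pi> ^ n * \<tau> a) r * uact a (monomial r) i) = 0)"

lemma co_T_emb:
  assumes G: "descends n G"
  shows "co (T (emb (Suc n) G)) m \<mu> i =
    (if m = int (Suc (Suc n)) \<and> valint \<mu> then G \<mu> (\<lambda>_. 0) * xr i else 0)"
proof -
  have lev: "level_fun (Suc n) G" using G by (simp add: descends_def)
  have "(\<Sum>a\<in>residues. co (emb (Suc n) G) (m + 1) (\<mu> + \<pi> powi m * \<tau> a) r * uact a (monomial r) i) =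
    0"
  proof (cases "m = int n")
    case True
    have val: "valint (\<mu> + \<pi> ^ n * \<tau> a) \<longleftrightarrow> valint \<mu>" if "a \<in> residues" for a
      using valint_near[of "\<mu> + \<pi> ^ n * \<tau> a" \<mu> n] valint_\<tau>[OF that] by simp
    show ?thesis
    proof (cases "valint \<mu>")
      case True
      then show ?thesis using G val \<open>m = int n\<close> by (simp add: co_emb[OF lev] descends_def)
    qed (use val \<open>m = int n\<close> in \<open>simp add: co_emb[OF lev]\<close>)
  qed (simp add: co_emb[OF lev])
  then show ?thesis
    by (auto simp: co_T[OF emb_Ind[OF lev]] hecke_co_def co_emb[OF lev])
qed

lemma right_translation_emb:
  assumes F: "level_fun (Suc (Suc n)) F" and h: "h \<in> GL2_cong 2" and G: "descends n G"
    and eq: "\<And>\<mu> i. valint \<mu> \<Longrightarrow> F (mobius h \<mu>) i = F \<mu> i + G \<mu> (\<lambda>_. 0) * xr i"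
  shows "right_translation h (emb (Suc (Suc n)) F) =
    emb (Suc (Suc n)) F \<oplus>\<^bsub>Ind\<^esub> T (emb (Suc n) G)"
proof -
  have G': "level_fun (Suc n) G" using G by (simp add: descends_def)
  have hG: "h \<in> carrier GL2" using GL2_cong_subset[OF _ h] by (simp add: GL2_int_def)
  show ?thesis
  proof (rule Ind_eqI)
    show "right_translation h (emb (Suc (Suc n)) F) \<in> carrier Ind"
      using right_translation_Ind[OF emb_Ind[OF F] hG] .
    show "emb (Suc (Suc n)) F \<oplus>\<^bsub>Ind\<^esub> T (emb (Suc n) G) \<in> carrier Ind"
      by (intro Ind.a_closed emb_Ind[OF F] T_closed emb_Ind[OF G'])
    show "co (right_translation h (emb (Suc (Suc n)) F)) m \<mu> =
      co (emb (Suc (Suc n)) F \<oplus>\<^bsub>Ind\<^esub> T (emb (Suc n) G)) m \<mu>" for m \<mu>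
      unfolding Ind_simps co_add[OF emb_Ind[OF F] T_closed[OF emb_Ind[OF G']]]
        co_right_translation_emb[OF F h] co_emb[OF F] co_T_emb[OF G]
      by (rule ext) (simp add: eq)
  qed
qed

section \<open>Linear independence modulo the image of \<open>T\<close>\<close>

text \<open>Were \<open>h\<close> nonzero on level N or above, take its highest level M. Level M + 1
  of T h shows all value functions of \<open>h\<close> on level M, and these vanish, hence so does
  \<open>h\<close> there. Level N of T h thus comes from level N - 1 alone.\<close>

lemma co_T_top:
  assumes h: "h \<in> carrier Ind" and top: "\<And>m \<mu>. N < m \<Longrightarrow> co (T h) m \<mu> = (\<lambda>_. 0)"
  shows "co (T h) N \<mu> i = co h (N - 1) \<mu> (\<lambda>_. 0) * xr i"
proof -
  define L where "L = {m. N \<le> m \<and> (\<exists>\<mu>. co h m \<mu> \<noteq> (\<lambda>_. 0))}"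
  obtain S where S: "finite S" "supported_on h S" using Ind_supported_on[OF h] by blast
  have "L \<subseteq> fst ` S"
  proof
    fix m assume "m \<in> L"
    then obtain \<mu> where "co h m \<mu> \<noteq> (\<lambda>_. 0)" by (auto simp: L_def)
    then have "h (vertex_inv m \<mu>) \<noteq> \<zero>\<^bsub>V\<^esub>" by (auto simp: co_def \<phi>_zero)
    then obtain n \<mu>' where "(n, \<mu>') \<in> S" "vertex_inv m \<mu> ** vertex n \<mu>' \<in> KZ nrm"
      using supported_onD[OF S(2)] by (metis vertex_in_GL2(2))
    then have "(m, \<mu>') \<in> S" by (simp add: vertex_adjacent)
    then show "m \<in> fst ` S" by (rule image_eqI[rotated]) simp
  qed
  then have fin: "finite L" using S(1) finite_subset by blast
  have "L = {}"
  proof (rule ccontr)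
    assume "L \<noteq> {}"
    define M where "M = Max L"
    have M: "M \<in> L" "\<And>m. m \<in> L \<Longrightarrow> m \<le> M" using fin \<open>L \<noteq> {}\<close> by (auto simp: M_def)
    then have "N \<le> M" by (simp add: L_def)
    have above: "co h (M + 1 + 1) \<mu> = (\<lambda>_. 0)" for \<mu>
      using M(2)[of "M + 1 + 1"] \<open>N \<le> M\<close> by (auto simp: L_def)
    have bottom: "co h M \<mu> (\<lambda>_. 0) = 0" for \<mu>
    proof -
      have "co (T h) (M + 1) \<mu> (\<lambda>_. 0) = co h M \<mu> (\<lambda>_. 0)"
        unfolding co_T[OF h] hecke_co_def above by (simp add: monomial_def)
      then show ?thesis using top \<open>N \<le> M\<close> by simp
    qed
    have "co h M \<mu> = (\<lambda>_. 0)" for \<mu>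
    proof
      fix i
      have "uact a (co h M \<mu>) (\<lambda>_. 0) = 0" if a: "a \<in> residues" for a
      proof -
        \<comment> \<open>Passing to another representative of the same vertex turns the x^r
          coefficient into the value at \<open>a\<close>.\<close>
        have "co h M (\<mu> + \<pi> powi M * \<tau> (- a)) = uact a (co h M \<mu>)"
          using a by (simp add: co_translate[OF h] valint_\<tau> red_\<tau> residues_closed)
        then show ?thesis using bottom by metis
      qed
      then show "co h M \<mu> i = 0" using uact_bottom_zero co_le_r[OF h] by blast
    qed
    then show False using M(1) by (simp add: L_def)
  qed
  then have "co h (N + 1) \<mu>' = (\<lambda>_. 0)" for \<mu>' by (auto simp: L_def)
  then show ?thesis by (simp add: co_T[OF h] hecke_co_def)
qed

text \<open>The level is n + 2, so that \<open>G\<close> lives on level n + 1 and the part of T G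
  that has to vanish on level n. The last clause concerns the vertices of level n + 2 next to (n +
  1, 0): there \<open>F\<close> is not what \<open>T\<close> produces from a vector at that
  vertex.\<close>

definition new_vector :: "nat \<Rightarrow> ('f \<Rightarrow> (nat \<Rightarrow> nat) \<Rightarrow> 'k) \<Rightarrow> bool" where
  "new_vector n F \<longleftrightarrow> level_fun (Suc (Suc n)) F \<and>
     (\<forall>h\<in>GL2_cong 2. \<exists>G. descends n G \<and>
        (\<forall>\<mu> i. valint \<mu> \<longrightarrow> F (mobius h \<mu>) i = F \<mu> i + G \<mu> (\<lambda>_. 0) * xr i)) \<and>
     \<not> (\<exists>w. (\<forall>i. w i \<noteq> 0 \<longrightarrow> i \<le> r) \<and> (\<forall>a\<in>residues. \<forall>i. F (\<pi> ^ Suc n * \<tau> a) i = uact (- a) w (\<lambda>_. 0)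
       * xr i))"

lemma new_vector_level: "new_vector n F \<Longrightarrow> level_fun (Suc (Suc n)) F"
  by (simp add: new_vector_def)

text \<open>On the highest level with nonzero coefficient, \<open>co_T_top\<close> exhibits the new
  vector as coming from the level below, against the last clause of
  \<open>new_vector\<close>.\<close>

lemma new_vectors_independent:
  assumes new: "\<And>n. n \<in> A \<Longrightarrow> new_vector n (F n)" and A: "finite A"
    and h: "h \<in> carrier Ind"
    and eq: "\<And>m \<mu> i. co (T h) m \<mu> i = (\<Sum>n\<in>A. a n * co (emb (Suc (Suc n)) (F n)) m \<mu> i)"
    and n: "n \<in> A"
  shows "a n = 0"
proof (rule ccontr)
  assume "a n \<noteq> 0"
  define B where "B = {n\<in>A. a n \<noteq> 0}"
  define N where "N = Max B"
  have B: "finite B" "B \<noteq> {}" using A n \<open>a n \<noteq> 0\<close> by (auto simp: B_def)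
  then have "N \<in> B" unfolding N_def by (rule Max_in)
  then have N: "N \<in> A" "a N \<noteq> 0" by (auto simp: B_def)
  have max: "k \<le> N" if "k \<in> A" "a k \<noteq> 0" for k using B that by (simp add: N_def B_def)
  have co: "co (T h) m \<mu> i = (\<Sum>n\<in>A. a n * (if m = int (Suc (Suc n)) \<and> valint \<mu> then F n \<mu> i else
    0))" for m \<mu> i
    unfolding eq by (rule sum.cong) (auto simp: co_emb[OF new_vector_level[OF new]])
  have "co (T h) m \<mu> i = 0" if "int (Suc (Suc N)) < m" for m \<mu> i
    unfolding co
  proof (rule sum.neutral, rule ballI)
    fix k assume "k \<in> A"
    then show "a k * (if m = int (Suc (Suc k)) \<and> valint \<mu> then F k \<mu> i else 0) = 0"
      using max[of k] that by (cases "a k = 0") auto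
  qed
  then have top: "co (T h) (int (Suc (Suc N))) \<mu> i = co h (int (Suc N)) \<mu> (\<lambda>_. 0) * xr i" for \<mu> i
    using co_T_top[OF h, of "int (Suc (Suc N))" \<mu> i] by (simp add: fun_eq_iff)
  have main: "a N * F N \<mu> i = co h (int (Suc N)) \<mu> (\<lambda>_. 0) * xr i" if "valint \<mu>" for \<mu> i
  proof -
    have "co (T h) (int (Suc (Suc N))) \<mu> i = (\<Sum>n\<in>A. if n = N then a N * F N \<mu> i else 0)"
      unfolding co using that by (intro sum.cong) auto
    then show ?thesis using A N(1) top by simp
  qed
  have "F N (\<pi> ^ Suc N * \<tau> b) i =
      uact (- b) (\<lambda>i. inverse (a N) * co h (int (Suc N)) 0 i) (\<lambda>_. 0) * xr i"
    if b: "b \<in> residues" for b i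
  proof -
    have "valint (\<pi> ^ Suc N * \<tau> b)" using valint_translate[of 0 "\<tau> b" "Suc N"] valint_\<tau>[OF b] by
      simp
    moreover have "co h (int (Suc N)) (0 + \<pi> powi (int (Suc N)) * \<tau> b) = uact (- b) (co h (int
      (Suc N)) 0)"
      using b by (simp only: co_translate[OF h] valint_\<tau> red_\<tau>)
    ultimately have "a N * F N (\<pi> ^ Suc N * \<tau> b) i =
        uact (- b) (co h (int (Suc N)) 0) (\<lambda>_. 0) * xr i"
      using main by (simp only: power_int_of_nat add_0)
    then show ?thesis using N(2) unfolding uact_scale by (simp add: field_simps)
  qed
  moreover have "\<forall>i. inverse (a N) * co h (int (Suc N)) 0 i \<noteq> 0 \<longrightarrow> i \<le> r"
    by (auto intro: co_le_r[OF h])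
  ultimately have "\<exists>w. (\<forall>i. w i \<noteq> 0 \<longrightarrow> i \<le> r) \<and> (\<forall>a\<in>residues. \<forall>i.
      F N (\<pi> ^ Suc N * \<tau> a) i = uact (- a) w (\<lambda>_. 0) * xr i)"
    by (intro exI[of _ "\<lambda>i. inverse (a N) * co h (int (Suc N)) 0 i"] conjI ballI allI) simp_all
  then show False using new[OF N(1)] unfolding new_vector_def by (elim conjE) (erule notE)
qed

end

section \<open>A linear relation by elimination\<close>

lemma ex_linear_relation:
  fixes c :: "'n \<Rightarrow> 'b \<Rightarrow> 'k::field"
  assumes "finite B" "finite A" "card B < card A"
  shows "\<exists>a. (\<exists>n\<in>A. a n \<noteq> 0) \<and> (\<forall>b\<in>B. (\<Sum>n\<in>A. a n * c n b) = 0)"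
  using assms
proof (induction B arbitrary: A c rule: finite_induct)
  case empty
  then have "A \<noteq> {}" by auto
  then show ?case by (intro exI[of _ "\<lambda>_. 1"]) auto
next
  case (insert b B)
  show ?case
  proof (cases "\<forall>n\<in>A. c n b = 0")
    case True
    obtain a where "\<exists>n\<in>A. a n \<noteq> 0" "\<forall>b\<in>B. (\<Sum>n\<in>A. a n * c n b) = 0"
      using insert.IH[of A c] insert.prems insert.hyps by auto
    then show ?thesis using True by (intro exI[of _ a]) simp
  next
    case False
    then obtain m where m: "m \<in> A" "c m b \<noteq> 0" by blast
    let ?A = "A - {m}"
    have "card B < card ?A" using insert m by simp
    then obtain a where a: "\<exists>n\<in>?A. a n \<noteq> 0"
      "\<forall>b'\<in>B. (\<Sum>n\<in>?A. a n * (c n b' - c n b / c m b * c m b')) = 0"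
      using insert.IH[of ?A "\<lambda>n b'. c n b' - c n b / c m b * c m b'"] insert.prems by auto
    define t where "t = - (\<Sum>n\<in>?A. a n * c n b) / c m b"
    define a' where "a' = a(m := t)"
    have sum: "(\<Sum>n\<in>A. a' n * c n b') = t * c m b' + (\<Sum>n\<in>?A. a n * c n b')" for b'
    proof -
      have "(\<Sum>n\<in>A. a' n * c n b') = a' m * c m b' + (\<Sum>n\<in>?A. a' n * c n b')"
        by (rule sum.remove[OF insert.prems(1) m(1)])
      also have "(\<Sum>n\<in>?A. a' n * c n b') = (\<Sum>n\<in>?A. a n * c n b')"
        by (rule sum.cong) (auto simp: a'_def)
      finally show ?thesis by (simp add: a'_def)
    qed
    have "(\<Sum>n\<in>A. a' n * c n b') = 0" if "b' \<in> insert b B" for b'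
    proof (cases "b' = b")
      case True
      then show ?thesis using m(2) by (simp add: sum t_def)
    next
      case False
      then have "(\<Sum>n\<in>?A. a n * (c n b' - c n b / c m b * c m b')) = 0" using a(2) that by blast
      moreover have "(\<Sum>n\<in>?A. a n * (c n b' - c n b / c m b * c m b')) =
          (\<Sum>n\<in>?A. a n * c n b') - (\<Sum>n\<in>?A. a n * c n b) / c m b * c m b'"
        by (simp add: sum_subtractf right_diff_distrib sum_divide_distrib sum_distrib_right
          mult.assoc)
      ultimately show ?thesis by (simp add: sum t_def)
    qed
    moreover have "\<exists>n\<in>A. a' n \<noteq> 0" using a(1) by (auto simp: a'_def)
    ultimately show ?thesis by blast
  qed
qed

context hecke_setting
begin

section \<open>The universal supersingular quotient\<close>

definition "imT = T ` carrier Ind"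

lemma imT_add: "v \<in> imT \<Longrightarrow> w \<in> imT \<Longrightarrow> v \<oplus>\<^bsub>Ind\<^esub> w \<in> imT"
  unfolding imT_def
proof (elim imageE)
  fix x y assume "x \<in> carrier Ind" "y \<in> carrier Ind" "v = T x" "w = T y"
  then show "v \<oplus>\<^bsub>Ind\<^esub> w \<in> T ` carrier Ind"
    by (intro image_eqI[of _ _ "x \<oplus>\<^bsub>Ind\<^esub> y"]) (simp_all add: T_add Ind_add)
qed

lemma imT_smult: "v \<in> imT \<Longrightarrow> c \<odot>\<^bsub>Ind\<^esub> v \<in> imT"
  unfolding imT_def
proof (elim imageE)
  fix x assume "x \<in> carrier Ind" "v = T x"
  then show "c \<odot>\<^bsub>Ind\<^esub> v \<in> T ` carrier Ind"
    by (intro image_eqI[of _ _ "c \<odot>\<^bsub>Ind\<^esub> x"]) (simp_all add: T_smult Ind_smult)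
qed

lemma imT_subset: "imT \<subseteq> carrier Ind"
  by (auto simp: imT_def T_closed)

lemma imT_subgroup: "abelian_subgroup imT Ind"
proof (rule abelian_subgroupI3)
  show "abelian_group Ind" by (rule Ind.abelian_group_axioms)
  have "subgroup imT (add_monoid Ind)"
  proof (rule group.subgroupI)
    show "Group.group (add_monoid Ind)" by (rule Ind.a_group)
    show "imT \<subseteq> carrier (add_monoid Ind)" using imT_subset by simp
    show "imT \<noteq> {}" using Ind_zero by (auto simp: imT_def)
    fix v assume v: "v \<in> imT"
    have "inv\<^bsub>add_monoid Ind\<^esub> v = \<ominus>\<^bsub>Ind\<^esub> v" by (simp add: a_inv_def)
    also have "\<dots> = (- 1) \<odot>\<^bsub>Ind\<^esub> v"
    proof (rule Ind.minus_equality)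
      show "v \<in> carrier Ind" "(- 1) \<odot>\<^bsub>Ind\<^esub> v \<in> carrier Ind"
        using v imT_subset imT_smult by blast+
      then show "(- 1) \<odot>\<^bsub>Ind\<^esub> v \<oplus>\<^bsub>Ind\<^esub> v = \<zero>\<^bsub>Ind\<^esub>"
        using Ind.smult_l_distr[of "- 1" 1 v] Ind.smult_one[of v] Ind.smult_l_null[of v]
        by (simp del: Ind_simps)
    qed
    finally show "inv\<^bsub>add_monoid Ind\<^esub> v \<in> imT" using imT_smult[OF v] by simp
    fix w assume "w \<in> imT"
    with v show "v \<otimes>\<^bsub>add_monoid Ind\<^esub> w \<in> imT" using imT_add by simp
  qed
  then show "additive_subgroup imT Ind" by (rule additive_subgroupI)
qed

sublocale imT: abelian_subgroup imT Ind
  by (rule imT_subgroup)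

abbreviation "Q \<equiv> quot_space Ind imT"

lemma Q_simps:
  "carrier Q = a_rcosets\<^bsub>Ind\<^esub> imT" "\<zero>\<^bsub>Q\<^esub> = imT" "A \<oplus>\<^bsub>Q\<^esub> B = A <+>\<^bsub>Ind\<^esub> B"
  "c \<odot>\<^bsub>Q\<^esub> A = (\<Union>a\<in>A. imT +>\<^bsub>Ind\<^esub> (c \<odot>\<^bsub>Ind\<^esub> a))"
  by (simp_all add: quot_space_def)

lemma Q_comm_monoid: "comm_monoid (add_monoid Q)"
proof -
  have eqs: "carrier (add_monoid Q) = carrier (Ind A_Mod imT)"
    "monoid.mult (add_monoid Q) = monoid.mult (Ind A_Mod imT)"
    "one (add_monoid Q) = one (Ind A_Mod imT)"
    by (simp_all add: quot_space_def A_FactGroup_def FactGroup_def A_RCOSETS_def set_add_def)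
  interpret M: comm_monoid "Ind A_Mod imT"
    by (rule comm_group.axioms(1)[OF imT.a_factorgroup_is_comm_group])
  show ?thesis
    by (rule comm_monoidI; unfold eqs) (simp_all only: M.m_closed M.one_closed M.l_one M.r_one
      M.m_ac)
qed

lemma abelian_monoid_Q: "abelian_monoid Q"
  by (rule abelian_monoid.intro[OF Q_comm_monoid])

lemma mem_coset_iff: "x \<in> imT +>\<^bsub>Ind\<^esub> v \<longleftrightarrow> (\<exists>w\<in>imT. x = w \<oplus>\<^bsub>Ind\<^esub> v)"
  by (auto simp: a_r_coset_def')

lemma coset_eqI: "v \<in> carrier Ind \<Longrightarrow> w \<in> imT \<Longrightarrow> imT +>\<^bsub>Ind\<^esub> (w \<oplus>\<^bsub>Ind\<^esub> v) = imT +>\<^bsub>Ind\<^esub> v"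
  using Ind.a_repr_independence[of "w \<oplus>\<^bsub>Ind\<^esub> v" imT v] imT.a_subgroup mem_coset_iff by blast

lemma coset_in_Q: "v \<in> carrier Ind \<Longrightarrow> imT +>\<^bsub>Ind\<^esub> v \<in> carrier Q"
  by (auto simp: Q_simps A_RCOSETS_def')

lemma coset_add:
  "v \<in> carrier Ind \<Longrightarrow> w \<in> carrier Ind \<Longrightarrow>
    (imT +>\<^bsub>Ind\<^esub> v) \<oplus>\<^bsub>Q\<^esub> (imT +>\<^bsub>Ind\<^esub> w) = imT +>\<^bsub>Ind\<^esub> (v \<oplus>\<^bsub>Ind\<^esub> w)"
  unfolding Q_simps by (rule imT.a_rcos_sum)

lemma coset_smult:
  assumes v: "v \<in> carrier Ind"
  shows "c \<odot>\<^bsub>Q\<^esub> (imT +>\<^bsub>Ind\<^esub> v) = imT +>\<^bsub>Ind\<^esub> (c \<odot>\<^bsub>Ind\<^esub> v)"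
proof -
  have cv: "c \<odot>\<^bsub>Ind\<^esub> v \<in> carrier Ind" using v by (simp add: Ind_smult)
  have "imT +>\<^bsub>Ind\<^esub> (c \<odot>\<^bsub>Ind\<^esub> a) = imT +>\<^bsub>Ind\<^esub> (c \<odot>\<^bsub>Ind\<^esub> v)" if "a \<in> imT +>\<^bsub>Ind\<^esub> v" for a
  proof -
    obtain w where w: "w \<in> imT" "a = w \<oplus>\<^bsub>Ind\<^esub> v" 
      using \<open>a \<in> imT +>\<^bsub>Ind\<^esub> v\<close> unfolding mem_coset_iff by blast
    have "w \<in> carrier Ind" using w(1) imT_subset by blast
    then have "c \<odot>\<^bsub>Ind\<^esub> a = c \<odot>\<^bsub>Ind\<^esub> w \<oplus>\<^bsub>Ind\<^esub> c \<odot>\<^bsub>Ind\<^esub> v"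
      unfolding w(2) using v by (intro Ind.smult_r_distr) simp_all
    then show ?thesis using coset_eqI[OF cv imT_smult[OF w(1)]] by simp
  qed
  moreover have "v \<in> imT +>\<^bsub>Ind\<^esub> v" by (rule imT.a_rcos_self[OF v])
  ultimately show ?thesis unfolding Q_simps by blast
qed

lemma coset_finsum:
  assumes "finite A" "\<And>b. b \<in> A \<Longrightarrow> v b \<in> carrier Ind"
  shows "(\<Oplus>\<^bsub>Q\<^esub>b\<in>A. c b \<odot>\<^bsub>Q\<^esub> (imT +>\<^bsub>Ind\<^esub> v b)) = imT +>\<^bsub>Ind\<^esub> (\<Oplus>\<^bsub>Ind\<^esub>b\<in>A. c b \<odot>\<^bsub>Ind\<^esub> v b)"
  using assms
proof (induction A rule: finite_induct)
  case empty
  interpret Q: abelian_monoid Q by (rule abelian_monoid_Q)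
  have "imT +>\<^bsub>Ind\<^esub> \<zero>\<^bsub>Ind\<^esub> = imT"
    using Ind.a_coset_join2[OF Ind.zero_closed imT.a_subgroup] imT.zero_closed by simp
  then show ?case by (simp only: Q.finsum_empty Ind.finsum_empty) (simp add: Q_simps)
next
  case (insert b A)
  interpret Q: abelian_monoid Q by (rule abelian_monoid_Q)
  have cv: "c x \<odot>\<^bsub>Ind\<^esub> v x \<in> carrier Ind" if "x \<in> insert b A" for x
    using insert.prems[OF that] by (simp add: Ind_smult)
  have cQ: "c x \<odot>\<^bsub>Q\<^esub> (imT +>\<^bsub>Ind\<^esub> v x) \<in> carrier Q" if "x \<in> insert b A" for x
    unfolding coset_smult[OF insert.prems[OF that]] by (rule coset_in_Q[OF cv[OF that]])
  have "(\<Oplus>\<^bsub>Q\<^esub>x\<in>insert b A. c x \<odot>\<^bsub>Q\<^esub> (imT +>\<^bsub>Ind\<^esub> v x)) =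
      c b \<odot>\<^bsub>Q\<^esub> (imT +>\<^bsub>Ind\<^esub> v b) \<oplus>\<^bsub>Q\<^esub> (\<Oplus>\<^bsub>Q\<^esub>x\<in>A. c x \<odot>\<^bsub>Q\<^esub> (imT +>\<^bsub>Ind\<^esub> v x))"
    using insert(1,2) cQ by (intro Q.finsum_insert) auto
  also have "\<dots> = imT +>\<^bsub>Ind\<^esub> (c b \<odot>\<^bsub>Ind\<^esub> v b \<oplus>\<^bsub>Ind\<^esub> (\<Oplus>\<^bsub>Ind\<^esub>x\<in>A. c x \<odot>\<^bsub>Ind\<^esub> v x))"
    using insert cv by (simp only: coset_smult insert.IH insertI1 insertI2)
      (intro coset_add Ind.finsum_closed, auto)
  also have "c b \<odot>\<^bsub>Ind\<^esub> v b \<oplus>\<^bsub>Ind\<^esub> (\<Oplus>\<^bsub>Ind\<^esub>x\<in>A. c x \<odot>\<^bsub>Ind\<^esub> v x) = (\<Oplus>\<^bsub>Ind\<^esub>x\<in>insert b A. c x \<odot>\<^bsub>Ind\<^esub> v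
    x)"
    using insert cv by (intro Ind.finsum_insert[symmetric]) auto
  finally show ?case .
qed

lemma right_translation_mult: "right_translation g (right_translation h u) = right_translation (g
  ** h) u"
  by (simp add: right_translation_def matrix_mul_assoc)

text \<open>It suffices that every \<open>h\<close> maps the coset into itself, because
  \<open>H\<close> contains inverses.\<close>

lemma coset_invariant:
  assumes v: "v \<in> carrier Ind" and H: "subgroup H GL2"
    and inv: "\<And>h. h \<in> H \<Longrightarrow> \<exists>w\<in>imT. right_translation h v = v \<oplus>\<^bsub>Ind\<^esub> w"
  shows "imT +>\<^bsub>Ind\<^esub> v \<in> invariants H Q (quot_action right_translation)"
proof -
  have sub: "right_translation h ` (imT +>\<^bsub>Ind\<^esub> v) \<subseteq> imT +>\<^bsub>Ind\<^esub> v" if h: "h \<in> H" for h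
  proof
    have hG: "h \<in> carrier GL2" using h subgroup.subset[OF H] by blast
    fix y assume "y \<in> right_translation h ` (imT +>\<^bsub>Ind\<^esub> v)"
    then obtain x where x: "x \<in> carrier Ind" "y = right_translation h (T x \<oplus>\<^bsub>Ind\<^esub> v)"
      unfolding image_iff Bex_def mem_coset_iff unfolding imT_def by blast
    obtain w where w: "w \<in> imT" "right_translation h v = v \<oplus>\<^bsub>Ind\<^esub> w" using inv[OF h] by blast
    have "y = right_translation h (T x) \<oplus>\<^bsub>Ind\<^esub> right_translation h v"
      by (simp add: x right_translation_def)
    also have "\<dots> = T (right_translation h x) \<oplus>\<^bsub>Ind\<^esub> (v \<oplus>\<^bsub>Ind\<^esub> w)"
      using w x hG by (simp only: T_right_translation)
    also have "\<dots> = (T (right_translation h x) \<oplus>\<^bsub>Ind\<^esub> w) \<oplus>\<^bsub>Ind\<^esub> v"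
      using v w(1) imT_subset T_closed[OF right_translation_Ind[OF x(1) hG]]
      by (auto simp: Ind_closed V.add.m_ac subset_iff fun_eq_iff)
    finally show "y \<in> imT +>\<^bsub>Ind\<^esub> v"
      unfolding mem_coset_iff
      using imT_add[OF _ w(1)] right_translation_Ind[OF x(1) hG] by (auto simp only: imT_def)
  qed
  have "right_translation h ` (imT +>\<^bsub>Ind\<^esub> v) = imT +>\<^bsub>Ind\<^esub> v" if h: "h \<in> H" for h
  proof (rule equalityI[OF sub[OF h]])
    have hG: "h \<in> carrier GL2" using h subgroup.subset[OF H] by blast
    have inv_H: "GL2_inv h \<in> H" using subgroup.m_inv_closed[OF H h] hG by (simp add: m_inv_GL2)
    show "imT +>\<^bsub>Ind\<^esub> v \<subseteq> right_translation h ` (imT +>\<^bsub>Ind\<^esub> v)"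
    proof
      fix y assume "y \<in> imT +>\<^bsub>Ind\<^esub> v"
      then have "right_translation (GL2_inv h) y \<in> imT +>\<^bsub>Ind\<^esub> v" using sub[OF inv_H] by blast
      moreover have "y = right_translation h (right_translation (GL2_inv h) y)"
        unfolding right_translation_mult GL2_inv(2)[OF hG] by (simp add: right_translation_def)
      ultimately show "y \<in> right_translation h ` (imT +>\<^bsub>Ind\<^esub> v)" by blast
    qed
  qed
  then show ?thesis using coset_in_Q[OF v] by (simp add: invariants_def quot_action_def)
qed

lemma ex_T_combination:
  assumes "finite A" "\<And>n. n \<in> A \<Longrightarrow> x n \<in> carrier Ind"
  shows "\<exists>h\<in>carrier Ind. \<forall>m \<mu> i. co (T h) m \<mu> i = (\<Sum>n\<in>A. a n * co (T (x n)) m \<mu> i)"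
  using assms
proof (induction A rule: finite_induct)
  case empty
  then show ?case by (intro bexI[OF _ Ind_zero]) (simp add: T_zero co_zero)
next
  case (insert n A)
  then obtain h where h: "h \<in> carrier Ind" "\<forall>m \<mu> i. co (T h) m \<mu> i = (\<Sum>n\<in>A. a n * co (T (x n)) m \<mu>
    i)"
    by auto
  have x: "x n \<in> carrier Ind" using insert by simp
  show ?case
  proof (intro bexI allI)
    show "(\<lambda>g. a n \<odot>\<^bsub>V\<^esub> x n g \<oplus>\<^bsub>V\<^esub> h g) \<in> carrier Ind" by (intro Ind_add Ind_smult x h)
    show "co (T (\<lambda>g. a n \<odot>\<^bsub>V\<^esub> x n g \<oplus>\<^bsub>V\<^esub> h g)) m \<mu> i = (\<Sum>n\<in>insert n A. a n * co (T (x n)) m \<mu> i)"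
      for m \<mu> i
      using insert(1,2) h x
      by (simp add: T_add Ind_smult T_smult co_add T_closed co_smult)
  qed
qed

end

section \<open>From new vectors to infinitely many invariants\<close>

context hecke_digits
begin

theorem not_admissible:
  assumes "\<And>n. \<exists>F. new_vector n F"
  shows "\<not> admissible nrm Q (quot_action right_translation)"
proof
  assume "admissible nrm Q (quot_action right_translation)"
  then have "fin_dim Q (invariants (GL2_cong 2) Q (quot_action right_translation))"
    using GL2_cong_subgroup[OF pos2] openin_GL2_cong[OF pos2] unfolding admissible_def by blast
  then obtain B where fin_B: "finite B" and sub_B: "B \<subseteq> invariants (GL2_cong 2) Q (quot_action
    right_translation)"
    and span_B: "\<forall>u\<in>invariants (GL2_cong 2) Q (quot_action right_translation).
       \<exists>c. u = (\<Oplus>\<^bsub>Q\<^esub>b\<in>B. c b \<odot>\<^bsub>Q\<^esub> b)"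
    unfolding fin_dim_def by (elim exE conjE)
  define v where "v b = (SOME v. v \<in> carrier Ind \<and> b = imT +>\<^bsub>Ind\<^esub> v)" for b
  have v: "v b \<in> carrier Ind" "b = imT +>\<^bsub>Ind\<^esub> v b" if "b \<in> B" for b
  proof -
    have "b \<in> invariants (GL2_cong 2) Q (quot_action right_translation)" by (rule subsetD[OF sub_B
      that])
    then have "b \<in> carrier Q" unfolding invariants_def by (elim CollectE conjE)
    then have "\<exists>v. v \<in> carrier Ind \<and> b = imT +>\<^bsub>Ind\<^esub> v" unfolding Q_simps A_RCOSETS_def' by blast
    then have "v b \<in> carrier Ind \<and> b = imT +>\<^bsub>Ind\<^esub> v b" unfolding v_def by (rule someI_ex)
    then show "v b \<in> carrier Ind" "b = imT +>\<^bsub>Ind\<^esub> v b" by (rule conjunct1, rule conjunct2)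
  qed
  obtain F where F: "\<And>n. new_vector n (F n)" using assms by metis
  define e where "e n = emb (Suc (Suc n)) (F n)" for n
  have e: "e n \<in> carrier Ind" for n unfolding e_def by (rule emb_Ind[OF new_vector_level[OF F]])
  have "\<exists>c x. x \<in> carrier Ind \<and>
    (\<forall>m \<mu> i. co (e n) m \<mu> i = co (T x) m \<mu> i + (\<Sum>b\<in>B. c b * co (v b) m \<mu> i))" for n
  proof -
    have "imT +>\<^bsub>Ind\<^esub> e n \<in> invariants (GL2_cong 2) Q (quot_action right_translation)"
    proof (rule coset_invariant[OF e GL2_cong_subgroup])
      fix h assume h: "h \<in> GL2_cong 2"
      obtain G where G: "descends n G"
        "\<And>\<mu> i. valint \<mu> \<Longrightarrow> F n (mobius h \<mu>) i = F n \<mu> i + G \<mu> (\<lambda>_. 0) * xr i"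
        using F h unfolding new_vector_def by metis
      have "T (emb (Suc n) G) \<in> imT" unfolding imT_def using G(1) emb_Ind by (auto simp:
        descends_def)
      then show "\<exists>w\<in>imT. right_translation h (e n) = e n \<oplus>\<^bsub>Ind\<^esub> w"
        using right_translation_emb[OF new_vector_level[OF F] h G] unfolding e_def by blast
    qed simp
    from bspec[OF span_B this]
    obtain c where "imT +>\<^bsub>Ind\<^esub> e n = (\<Oplus>\<^bsub>Q\<^esub>b\<in>B. c b \<odot>\<^bsub>Q\<^esub> b)" by (elim exE)
    also have "\<dots> = (\<Oplus>\<^bsub>Q\<^esub>b\<in>B. c b \<odot>\<^bsub>Q\<^esub> (imT +>\<^bsub>Ind\<^esub> v b))"
    proof -
      interpret Q: abelian_monoid Q by (rule abelian_monoid_Q)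
      have "c b \<odot>\<^bsub>Q\<^esub> (imT +>\<^bsub>Ind\<^esub> v b) \<in> carrier Q" if "b \<in> B" for b
        using v(1)[OF that] by (simp only: coset_smult) (intro coset_in_Q Ind.smult_closed, auto)
      then show ?thesis using v(2) by (intro Q.finsum_cong') auto
    qed
    also have "\<dots> = imT +>\<^bsub>Ind\<^esub> (\<Oplus>\<^bsub>Ind\<^esub>b\<in>B. c b \<odot>\<^bsub>Ind\<^esub> v b)" by (rule coset_finsum[OF fin_B v(1)])
    finally have "e n \<in> imT +>\<^bsub>Ind\<^esub> (\<Oplus>\<^bsub>Ind\<^esub>b\<in>B. c b \<odot>\<^bsub>Ind\<^esub> v b)"
      using imT.a_rcos_self[OF e[of n]] by (rule subst)
    then obtain x where x: "x \<in> carrier Ind" "e n = T x \<oplus>\<^bsub>Ind\<^esub> (\<Oplus>\<^bsub>Ind\<^esub>b\<in>B. c b \<odot>\<^bsub>Ind\<^esub> v b)"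
      unfolding mem_coset_iff unfolding imT_def by blast
    have cv: "(\<lambda>b. c b \<odot>\<^bsub>Ind\<^esub> v b) \<in> B \<rightarrow> carrier Ind" using v(1) by (auto simp: Ind_smult)
    have "co (e n) m \<mu> i = co (T x) m \<mu> i + (\<Sum>b\<in>B. c b * co (v b) m \<mu> i)" for m \<mu> i
    proof -
      have "co (e n) m \<mu> i = co (T x) m \<mu> i + co (\<Oplus>\<^bsub>Ind\<^esub>b\<in>B. c b \<odot>\<^bsub>Ind\<^esub> v b) m \<mu> i"
        unfolding x(2) Ind_simps(1) using co_add[OF T_closed[OF x(1)] Ind.finsum_closed[OF cv]] by
          simp
      also have "co (\<Oplus>\<^bsub>Ind\<^esub>b\<in>B. c b \<odot>\<^bsub>Ind\<^esub> v b) m \<mu> i = (\<Sum>b\<in>B. co (c b \<odot>\<^bsub>Ind\<^esub> v b) m \<mu> i)"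
        by (simp only: co_finsum[OF fin_B cv])
      also have "\<dots> = (\<Sum>b\<in>B. c b * co (v b) m \<mu> i)"
        using v(1) by (intro sum.cong) (simp_all add: co_smult)
      finally show ?thesis .
    qed
    then show ?thesis using x(1) by blast
  qed
  then have "\<forall>n. \<exists>c x. x \<in> carrier Ind \<and>
    (\<forall>m \<mu> i. co (e n) m \<mu> i = co (T x) m \<mu> i + (\<Sum>b\<in>B. c b * co (v b) m \<mu> i))" by (rule allI)
  from choice[OF this] obtain c where "\<forall>n. \<exists>x. x \<in> carrier Ind \<and>
    (\<forall>m \<mu> i. co (e n) m \<mu> i = co (T x) m \<mu> i + (\<Sum>b\<in>B. c n b * co (v b) m \<mu> i))" by (elim exE)
  from choice[OF this] obtain x where x: "\<forall>n. x n \<in> carrier Ind \<and>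
    (\<forall>m \<mu> i. co (e n) m \<mu> i = co (T (x n)) m \<mu> i + (\<Sum>b\<in>B. c n b * co (v b) m \<mu> i))" by (elim exE)
  then have cx: "\<And>n. x n \<in> carrier Ind"
    "\<And>n m \<mu> i. co (e n) m \<mu> i = co (T (x n)) m \<mu> i + (\<Sum>b\<in>B. c n b * co (v b) m \<mu> i)"
    by simp_all
  \<comment> \<open>One index more than \<open>B\<close> has elements, which forces a relation
    between the coefficient families \<open>c n\<close>; the same combination of the new vectors
    then lies in the image of \<open>T\<close>.\<close>
  define A where "A = {..card B}"
  obtain a where a: "\<exists>n\<in>A. a n \<noteq> 0" "\<And>b. b \<in> B \<Longrightarrow> (\<Sum>n\<in>A. a n * c n b) = 0"
    using ex_linear_relation[OF fin_B, of A c] by (auto simp: A_def)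
  obtain h where h: "h \<in> carrier Ind" "\<And>m \<mu> i. co (T h) m \<mu> i = (\<Sum>n\<in>A. a n * co (T (x n)) m \<mu> i)"
    using ex_T_combination[of A x a] cx(1) by (auto simp: A_def)
  have "co (T h) m \<mu> i = (\<Sum>n\<in>A. a n * co (emb (Suc (Suc n)) (F n)) m \<mu> i)" for m \<mu> i
  proof -
    have "(\<Sum>n\<in>A. a n * co (e n) m \<mu> i) =
      (\<Sum>n\<in>A. a n * co (T (x n)) m \<mu> i) + (\<Sum>n\<in>A. \<Sum>b\<in>B. a n * c n b * co (v b) m \<mu> i)"
      by (simp add: cx(2) distrib_left sum.distrib sum_distrib_left mult.assoc)
    also have "(\<Sum>n\<in>A. \<Sum>b\<in>B. a n * c n b * co (v b) m \<mu> i) = (\<Sum>b\<in>B. (\<Sum>n\<in>A. a n * c n b) * co (v b)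
      m \<mu> i)"
      unfolding sum_distrib_right by (rule sum.swap)
    also have "\<dots> = 0" using a(2) by simp
    finally show ?thesis by (simp add: h(2) e_def)
  qed
  then have "a n = 0" if "n \<in> A" for n
    using new_vectors_independent[of A F h a n] F h(1) that by (simp add: A_def)
  then show False using a(1) by blast
qed

end

context hecke_digits
begin

section \<open>New invariants on every level\<close>

lemma level_fun_scalar:
  assumes "\<And>\<mu> c. valint \<mu> \<Longrightarrow> valint c \<Longrightarrow> s (\<mu> + \<pi> ^ n * c) = s \<mu>"
  shows "level_fun n (\<lambda>\<mu> i. s \<mu> * xr i)"
  unfolding level_fun_def
proof (intro conjI allI impI)
  fix \<mu> i assume "s \<mu> * xr i \<noteq> 0"
  then show "i \<le> r" by (auto simp: monomial_def split: if_splits)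
qed (simp add: assms uact_smult_monomial uact_x)

lemma red_shift_mobius:
  "red ((shift ^^ n) (mobius h \<mu>)) = red ((shift ^^ n) \<mu>) + drift n (mobius h) \<mu>"
  by (simp add: drift_def)

lemma red_shift_periodic:
  assumes "valint \<mu>" "valint c"
  shows "red ((shift ^^ n) (\<mu> + \<pi> ^ Suc n * c)) = red ((shift ^^ n) \<mu>)"
  using red_shift_funpow_add[of \<mu> "\<pi> * c" n] assms \<pi>_integral
  by (simp add: red_\<pi>_mult valint_mult mult_ac)

text \<open>On the vertices next to (n + 1, 0) the digit takes the values d + a, where d is the
  digit of 0 and need not vanish. Up to a translation by \<open>d\<close> and a sign, the excluded
  form would make a^k the value function of a vector.\<close>

lemma digit_power_not_bottom:
  assumes k: "k < p ^ f" "k \<notin> weight p f ` {..r}"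
  shows "\<not> (\<exists>w. (\<forall>i. w i \<noteq> 0 \<longrightarrow> i \<le> r) \<and> (\<forall>a\<in>residues. \<forall>i.
    red ((shift ^^ Suc n) (\<pi> ^ Suc n * \<tau> a)) ^ k * xr i =
      uact (- a) w (\<lambda>_. 0) * xr i))"
proof (intro notI, elim exE conjE)
  fix w assume w: "\<forall>i. w i \<noteq> 0 \<longrightarrow> i \<le> r" and eq: "\<forall>a\<in>residues. \<forall>i.
    red ((shift ^^ Suc n) (\<pi> ^ Suc n * \<tau> a)) ^ k * xr i =
      uact (- a) w (\<lambda>_. 0) * xr i"
  define d where "d = red ((shift ^^ Suc n) 0)"
  have d: "d \<in> residues" unfolding d_def by (rule red_in_residues[OF valint_shift_funpow]) simp
  have val: "(d + a) ^ k = uact (- a) w (\<lambda>_. 0)" if a: "a \<in> residues" for a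
  proof -
    have "red ((shift ^^ Suc n) (\<pi> ^ Suc n * \<tau> a)) = d + a"
      using red_shift_funpow_add[of 0 "\<tau> a" "Suc n"] a by (simp add: d_def valint_\<tau> red_\<tau>)
    then show ?thesis using eq[rule_format, OF a, of "\<lambda>_. 0"] by (simp add: monomial_def)
  qed
  have "uact a (\<lambda>i. (- 1) ^ k * uact d w i) (\<lambda>_. 0) = a ^ k" if a: "a \<in> residues" for a
  proof -
    have "uact a (uact d w) (\<lambda>_. 0) = uact (a + d) w (\<lambda>_. 0)" using uact_uact[OF a d w] by simp
    also have "\<dots> = (d + - (a + d)) ^ k"
      using val[of "- (a + d)"] a d by (simp only: residues_closed minus_minus)
    also have "\<dots> = (- 1) ^ k * a ^ k" by (simp add: power_mult_distrib[symmetric])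
    finally have "uact a (uact d w) (\<lambda>_. 0) = (- 1) ^ k * a ^ k" .
    then show ?thesis unfolding uact_scale by (simp add: power_mult_distrib[symmetric])
  qed
  then show False using uact_bottom_not_power[OF k] by blast
qed

text \<open>For r = 0 value functions are constant, so the digit itself is new. Its drift depends
  only on lower digits and hence defines \<open>G\<close>; the level n part of T G is a sum of
  drifts over one digit, which \<open>sum_drift\<close> kills.\<close>

lemma new_vector_trivial:
  assumes r0: "r = (\<lambda>_. 0)"
  shows "new_vector n (\<lambda>\<mu> i. red ((shift ^^ Suc n) \<mu>) ^ 1 * xr i)"
  unfolding new_vector_def
proof (intro conjI ballI)
  show "level_fun (Suc (Suc n)) (\<lambda>\<mu> i. red ((shift ^^ Suc n) \<mu>) ^ 1 * xr i)"
    by (rule level_fun_scalar) (simp only: red_shift_periodic)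
  have "weight p f ` {..r} = {0}" by (auto simp: r0 weight_def le_fun_def)
  moreover have "1 < p ^ f" by (rule one_less_power[OF p_gt_1 f_gt_0])
  ultimately show "\<not> (\<exists>w. (\<forall>i. w i \<noteq> 0 \<longrightarrow> i \<le> r) \<and> (\<forall>a\<in>residues. \<forall>i.
      red ((shift ^^ Suc n) (\<pi> ^ Suc n * \<tau> a)) ^ 1 * xr i =
        uact (- a) w (\<lambda>_. 0) * xr i))"
    by (intro digit_power_not_bottom) auto
next
  fix h assume h: "h \<in> GL2_cong 2"
  note M = near_identity_mobius[OF h]
  let ?G = "\<lambda>\<mu> i. drift (Suc n) (mobius h) \<mu> * xr i"
  have "level_fun (Suc n) ?G" by (rule level_fun_scalar) (rule drift_periodic[OF M])
  moreover have "(\<Sum>a\<in>residues. ?G (\<mu> + \<pi> ^ n * \<tau> a) r * uact a (monomial r) i) = 0" if "valint \<mu>"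
    for \<mu> i
  proof -
    have "(\<Sum>a\<in>residues. ?G (\<mu> + \<pi> ^ n * \<tau> a) r * uact a (monomial r) i) =
        (\<Sum>a\<in>residues. drift (Suc n) (mobius h) (\<mu> + \<pi> ^ n * \<tau> a)) * xr i"
      unfolding r0 uact_x[unfolded r0] by (simp add: monomial_def sum_distrib_right)
    then show ?thesis by (simp add: sum_drift[OF M that])
  qed
  ultimately have "descends n ?G" by (simp add: descends_def)
  moreover have "red ((shift ^^ Suc n) (mobius h \<mu>)) ^ 1 * xr i =
      red ((shift ^^ Suc n) \<mu>) ^ 1 * xr i + ?G \<mu> (\<lambda>_. 0) * xr i" for \<mu> i
    unfolding red_shift_mobius by (simp add: monomial_def distrib_right)
  ultimately show "\<exists>G. descends n G \<and> (\<forall>\<mu> i. valint \<mu> \<longrightarrow>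
      red ((shift ^^ Suc n) (mobius h \<mu>)) ^ 1 * xr i =
      red ((shift ^^ Suc n) \<mu>) ^ 1 * xr i + G \<mu> (\<lambda>_. 0) * xr i)" by blast
qed

definition single :: "nat \<Rightarrow> nat \<Rightarrow> nat \<Rightarrow> nat" where
  "single j k = (\<lambda>l. if l = j then k else 0)"

lemma weight_single: "j < f \<Longrightarrow> weight p f (single j k) = p ^ j * k"
proof -
  assume "j < f"
  have "weight p f (single j k) = (\<Sum>l<f. if l = j then p ^ j * k else 0)"
    unfolding weight_def single_def by (rule sum.cong) auto
  then show ?thesis using \<open>j < f\<close> by simp
qed

text \<open>The exponent \<open>Suc (r j)\<close> at the index j is one more than
  \<open>Sym r\<close> offers, so this power of the digit is new. Its change under \<open>h\<close>
  involves only smaller exponents at j and is a value function; as r is positive at j', the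
  monomials used have no y^r coefficient, so the level n part vanishes.\<close>

lemma new_vector_two_indices:
  assumes j: "j < f" "r j < p - 1" and j': "j' < f" "0 < r j'" "j \<noteq> j'"
  shows "new_vector n (\<lambda>\<mu> i. red ((shift ^^ Suc n) \<mu>) ^ (p ^ j * Suc (r j)) * xr i)"
  unfolding new_vector_def
proof (intro conjI ballI)
  let ?N = "p ^ j * Suc (r j)"
  let ?D = "\<lambda>\<mu>. red ((shift ^^ Suc n) \<mu>)"
  show "level_fun (Suc (Suc n)) (\<lambda>\<mu> i. ?D \<mu> ^ ?N * xr i)"
    by (rule level_fun_scalar) (simp only: red_shift_periodic)
  have small: "\<forall>l<f. single j (Suc (r j)) l < p" using j p_gt_1 by (auto simp: single_def)
  have "?N \<notin> weight p f ` {..r}"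
  proof
    assume "?N \<in> weight p f ` {..r}"
    then obtain i where i: "i \<le> r" "weight p f (single j (Suc (r j))) = weight p f i"
      using j by (auto simp: weight_single)
    moreover have "\<forall>l\<ge>f. single j (Suc (r j)) l = 0" using j by (auto simp: single_def)
    ultimately have "single j (Suc (r j)) = i"
      using small by (intro inj_onD[OF weight_inj, OF i(2)]) (auto simp: le_r_less_p le_r_eq_0)
    then have "Suc (r j) \<le> r j" using i(1) by (auto simp: single_def dest: le_funD[of _ _ j])
    then show False by simp
  qed
  moreover have "?N < p ^ f" using weight_less[OF small] j by (simp add: weight_single)
  ultimately show "\<not> (\<exists>w. (\<forall>i. w i \<noteq> 0 \<longrightarrow> i \<le> r) \<and> (\<forall>a\<in>residues. \<forall>i.
      ?D (\<pi> ^ Suc n * \<tau> a) ^ ?N * xr i = uact (- a) w (\<lambda>_. 0) * xr i))"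
    by (intro digit_power_not_bottom)
  fix h assume h: "h \<in> GL2_cong 2"
  note M = near_identity_mobius[OF h]
  let ?b = "\<lambda>\<mu>. drift (Suc n) (mobius h) \<mu> ^ (p ^ j)"
  \<comment> \<open>The sign compensates for the translation by minus the digit in
    \<open>G\<close>.\<close>
  define coef where "coef \<mu> k =
    of_nat (Suc (r j) choose k) * ?b \<mu> ^ (Suc (r j) - k) * (- 1) ^ (p ^ j * k)" for \<mu> k
  define G where "G \<mu> i = (\<Sum>k\<le>r j. coef \<mu> k * uact (- ?D \<mu>) (monomial (single j k)) i)" for \<mu> i
  have le: "single j k \<le> r" if "k \<le> r j" for k using that by (auto simp: single_def le_fun_def)
  have supp: "\<forall>i. (monomial (single j k) i :: 'k) \<noteq> 0 \<longrightarrow> i \<le> r" if "k \<le> r j" for k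
    using le[OF that] by (auto simp: monomial_def)
  have "level_fun (Suc n) G"
    unfolding level_fun_def
  proof (intro conjI allI impI)
    fix \<mu> i assume "G \<mu> i \<noteq> 0"
    then obtain k where "uact (- ?D \<mu>) (monomial (single j k)) i \<noteq> 0"
      unfolding G_def by (metis (no_types, lifting) mult_zero_right sum.neutral)
    then show "i \<le> r" by (rule uact_in_Sym)
  next
    fix \<mu> c assume \<mu>: "valint \<mu>" and c: "valint c"
    have D: "?D \<mu> \<in> residues" by (rule red_in_residues[OF valint_shift_funpow[OF \<mu>]])
    have coef: "coef (\<mu> + \<pi> ^ Suc n * c) k = coef \<mu> k" for k
      unfolding coef_def drift_periodic[OF M \<mu> c] ..
    have "- ?D (\<mu> + \<pi> ^ Suc n * c) = - red c + - ?D \<mu>"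
      unfolding red_shift_funpow_add[OF \<mu> c] by simp
    then have "uact (- ?D (\<mu> + \<pi> ^ Suc n * c)) (monomial (single j k)) =
        uact (- red c) (uact (- ?D \<mu>) (monomial (single j k)))" if "k \<le> r j" for k
      using uact_uact[of "- red c" "- ?D \<mu>", OF _ _ supp[OF that]] D c by (simp only:
        residues_closed red_in_residues)
    then show "G (\<mu> + \<pi> ^ Suc n * c) = uact (- red c) (G \<mu>)"
      unfolding G_def[abs_def] uact_sum uact_scale coef by (intro ext sum.cong) auto
  qed
  moreover have "(\<Sum>a\<in>residues. G (\<mu> + \<pi> ^ n * \<tau> a) r * uact a (monomial r) i) = 0" for \<mu> i
  proof -
    have "monomial (single j k) r = (0 :: 'k)" for k
      using j' fun_cong[of r "single j k" j'] by (auto simp: monomial_def single_def)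
    then show ?thesis by (simp add: G_def uact_top)
  qed
  ultimately have "descends n G" by (simp add: descends_def)
  moreover have "?D (mobius h \<mu>) ^ ?N * xr i =
      ?D \<mu> ^ ?N * xr i + G \<mu> (\<lambda>_. 0) * xr i" for \<mu> i
  proof -
    \<comment> \<open>Expanding in p^j-th powers keeps all exponents at the index j.\<close>
    have frob: "(a + b) ^ (p ^ j) = a ^ (p ^ j) + b ^ (p ^ j)" for a b :: 'k
      using freshmans_dream'[of "p ^ j" j a b] prime_p by (simp add: char_k)
    have "?D (mobius h \<mu>) ^ ?N = (?b \<mu> + ?D \<mu> ^ (p ^ j)) ^ Suc (r j)"
      unfolding red_shift_mobius by (simp only: power_mult frob add.commute)
    also have "\<dots> = (\<Sum>k\<le>Suc (r j). of_nat (Suc (r j) choose k) * (?D \<mu> ^ (p ^ j)) ^ k * ?b \<mu> ^ (Suc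
      (r j) - k))"
      by (subst add.commute) (rule binomial_ring)
    also have "\<dots> = (\<Sum>k\<le>r j. of_nat (Suc (r j) choose k) * (?D \<mu> ^ (p ^ j)) ^ k * ?b \<mu> ^ (Suc (r j)
      - k)) + ?D \<mu> ^ ?N"
      unfolding power_mult sum.atMost_Suc by simp
    also have "(\<Sum>k\<le>r j. of_nat (Suc (r j) choose k) * (?D \<mu> ^ (p ^ j)) ^ k * ?b \<mu> ^ (Suc (r j) -
      k)) = G \<mu> (\<lambda>_. 0)"
      unfolding G_def
    proof (rule sum.cong)
      fix k assume "k \<in> {..r j}"
      then have k: "k \<le> r j" by simp
      have "(- 1) ^ (p ^ j * k) * (- ?D \<mu>) ^ (p ^ j * k) = (?D \<mu> ^ (p ^ j)) ^ k"
        unfolding power_mult_distrib[symmetric] by (simp add: power_mult)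
      then show "of_nat (Suc (r j) choose k) * (?D \<mu> ^ (p ^ j)) ^ k * ?b \<mu> ^ (Suc (r j) - k) =
          coef \<mu> k * uact (- ?D \<mu>) (monomial (single j k)) (\<lambda>_. 0)"
        unfolding coef_def uact_monomial_bottom[OF le[OF k]] weight_single[OF j(1)]
        by (metis (no_types, lifting) mult.assoc mult.commute)
    qed simp
    finally show ?thesis by (simp only: distrib_right add.commute)
  qed
  ultimately show "\<exists>G. descends n G \<and> (\<forall>\<mu> i. valint \<mu> \<longrightarrow> ?D (mobius h \<mu>) ^ ?N * xr i =
      ?D \<mu> ^ ?N * xr i + G \<mu> (\<lambda>_. 0) * xr i)" by blast
qed

text \<open>\<open>y_vector\<close> describes the element \<open>\<Sum>\<^sub>\<mu> [g\<^sub>\<mu>, x\<^bsup>r - e\<^esup> y\<^sup>e]\<close> with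
  \<open>e = (1, 0, \<dots>, 0)\<close>, where \<open>\<mu>\<close> runs through the standard representatives.\<close>

definition y_vector :: "nat \<Rightarrow> 'f \<Rightarrow> (nat \<Rightarrow> nat) \<Rightarrow> 'k" where
  "y_vector n \<mu> i = monomial e0 i + (- red ((shift ^^ Suc (Suc n)) \<mu>)) * xr i"

text \<open>The coefficient at \<open>e0\<close> is not on the line of x^r, which gives the last
  clause of \<open>new_vector\<close> at once. What remains is to realise by some \<open>G\<close>
  the drift of the digit just beyond the level.\<close>

lemma new_vector_y:
  assumes r0: "0 < r 0"
    and G: "\<And>h. h \<in> GL2_cong 2 \<Longrightarrow> \<exists>G. descends n G \<and>
      (\<forall>\<mu>. valint \<mu> \<longrightarrow> G \<mu> (\<lambda>_. 0) = - drift (Suc (Suc n)) (mobius h) \<mu>)"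
  shows "new_vector n (y_vector n)"
  unfolding new_vector_def
proof (intro conjI ballI)
  have e0: "e0 \<le> r" "e0 \<noteq> (\<lambda>_. 0)" using r0 by (auto simp: e0_def le_fun_def fun_eq_iff)
  show "level_fun (Suc (Suc n)) (y_vector n)"
    unfolding level_fun_def
  proof (intro conjI allI impI)
    fix \<mu> i assume "y_vector n \<mu> i \<noteq> 0"
    then show "i \<le> r" using e0 by (auto simp: y_vector_def monomial_def split: if_splits)
  next
    fix \<mu> c assume \<mu>: "valint \<mu>" and c: "valint c"
    show "y_vector n (\<mu> + \<pi> ^ Suc (Suc n) * c) = uact (- red c) (y_vector n \<mu>)"
      unfolding y_vector_def[abs_def] uact_add uact_scale uact_x uact_y0[OF r0]
        red_shift_funpow_add[OF \<mu> c]
      by (simp add: algebra_simps)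
  qed
  show "\<not> (\<exists>w. (\<forall>i. w i \<noteq> 0 \<longrightarrow> i \<le> r) \<and> (\<forall>a\<in>residues. \<forall>i.
      y_vector n (\<pi> ^ Suc n * \<tau> a) i = uact (- a) w (\<lambda>_. 0) * xr i))"
  proof
    assume "\<exists>w. (\<forall>i. w i \<noteq> 0 \<longrightarrow> i \<le> r) \<and> (\<forall>a\<in>residues. \<forall>i.
      y_vector n (\<pi> ^ Suc n * \<tau> a) i = uact (- a) w (\<lambda>_. 0) * xr i)"
    then obtain w where "y_vector n (\<pi> ^ Suc n * \<tau> 0) e0 = uact (- 0) w (\<lambda>_. 0) * xr e0"
      using residues_closed(1) by blast
    then show False using e0(2) by (simp add: y_vector_def monomial_def)
  qed
  fix h assume "h \<in> GL2_cong 2"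
  then obtain G where G: "descends n G"
    "\<And>\<mu>. valint \<mu> \<Longrightarrow> G \<mu> (\<lambda>_. 0) = - drift (Suc (Suc n)) (mobius h) \<mu>" using G by blast
  have "y_vector n (mobius h \<mu>) i = y_vector n \<mu> i + G \<mu> (\<lambda>_. 0) * xr i" if "valint \<mu>" for \<mu> i
    unfolding y_vector_def red_shift_mobius G(2)[OF that] by (simp add: algebra_simps)
  then show "\<exists>G. descends n G \<and> (\<forall>\<mu> i. valint \<mu> \<longrightarrow>
      y_vector n (mobius h \<mu>) i = y_vector n \<mu> i + G \<mu> (\<lambda>_. 0) * xr i)"
    using G(1) by blast
qed

text \<open>By \<open>drift_Suc_periodic\<close> the drift at \<pi>^(n+2) depends only on \<mu>
  modulo \<pi>^(n+1), so a multiple of x^r serves as \<open>G\<close>; it has no y^r coefficient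
  since r \<noteq> 0.\<close>

lemma new_vector_additive:
  assumes r0: "0 < r 0"
    and add: "\<And>a b. a \<in> residues \<Longrightarrow> b \<in> residues \<Longrightarrow> nrm (\<tau> a + \<tau> b - \<tau> (a + b)) \<le> nrm \<pi> ^ 2"
  shows "new_vector n (y_vector n)"
proof (rule new_vector_y[OF r0])
  fix h assume h: "h \<in> GL2_cong 2"
  note M = near_identity_mobius[OF h]
  let ?G = "\<lambda>\<mu> i. (- drift (Suc (Suc n)) (mobius h) \<mu>) * xr i"
  have "level_fun (Suc n) ?G" by (rule level_fun_scalar) (simp only: drift_Suc_periodic[OF add M])
  moreover have "xr r = (0 :: 'k)" using r0 by (auto simp: monomial_def fun_eq_iff)
  ultimately have "descends n ?G" by (simp add: descends_def)
  then show "\<exists>G. descends n G \<and> (\<forall>\<mu>. valint \<mu> \<longrightarrow> G \<mu> (\<lambda>_. 0) = - drift (Suc (Suc n)) (mobius h) \<mu>)"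
    by (intro exI[of _ ?G]) (simp add: monomial_def)
qed

lemma weight_r_max: assumes "\<forall>j<f. r j = p - 1" shows "weight p f r = p ^ f - 1"
proof -
  have "(\<Sum>j<n. p ^ j * (p - 1)) + 1 = p ^ n" for n
  proof (induction n)
    case (Suc n)
    have "(\<Sum>j<Suc n. p ^ j * (p - 1)) + 1 = p ^ n + p ^ n * (p - 1)" using Suc by simp
    also have "\<dots> = p ^ n * (1 + (p - 1))" by (simp only: distrib_left mult_1_right)
    also have "\<dots> = p ^ Suc n" using p_gt_1 by (simp add: mult.commute)
    finally show ?case .
  qed simp
  from this[of f] have "(\<Sum>j<f. p ^ j * (p - 1)) = p ^ f - 1" by simp
  then show ?thesis using assms by (simp add: weight_def)
qed

text \<open>For \<open>r = (p - 1, \<dots>, p - 1)\<close> every function on the residue field is the value function of a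
  vector; \<open>x\<^sup>r - y\<^sup>r\<close> gives the delta function at \<open>0\<close>, which is used to interpolate.\<close>

lemma new_vector_steinberg:
  assumes max: "\<forall>j<f. r j = p - 1" shows "new_vector n (y_vector n)"
proof (rule new_vector_y)
  show "0 < r 0" using max f_gt_0 p_gt_1 by simp
  then have r0: "r \<noteq> (\<lambda>_. 0)" by (auto simp: fun_eq_iff)
  fix h assume h: "h \<in> GL2_cong 2"
  note M = near_identity_mobius[OF h]
  let ?d = "drift (Suc (Suc n)) (mobius h)"
  define w :: "(nat \<Rightarrow> nat) \<Rightarrow> 'k" where "w i = xr i + (- 1) * monomial r i" for i
  have w: "\<forall>i. w i \<noteq> 0 \<longrightarrow> i \<le> r" by (auto simp: w_def monomial_def split: if_splits)
  have w_top: "w r = - 1" using r0 by (simp add: w_def monomial_def)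
  have w_bottom: "uact a w (\<lambda>_. 0) = (if a = 0 then 1 else 0)" if a: "a \<in> residues" for a
  proof -
    have "p ^ f - 1 \<noteq> 0" using p_gt_1 f_gt_0 one_less_power[of p f] by simp
    moreover have "uact a w (\<lambda>_. 0) = 1 - a ^ (p ^ f - 1)"
      unfolding w_def[abs_def] uact_add uact_scale uact_x uact_monomial_bottom[OF order_refl]
        weight_r_max[OF max]
      by (simp add: monomial_def)
    ultimately show ?thesis using residues_power_card[OF a] by auto
  qed
  \<comment> \<open>Interpolation: translates of the delta vector \<open>w\<close>, weighted with
    the values wanted at the q neighbours on level n + 2.\<close>
  define G where "G \<mu> i = (\<Sum>a\<in>residues. (- ?d (\<mu> + \<pi> ^ Suc n * \<tau> a)) * uact a w i)" for \<mu> i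
  have digit: "?d (\<mu> + \<pi> ^ Suc n * x) = ?d (\<mu> + \<pi> ^ Suc n * y)"
    if \<mu>: "valint \<mu>" and xy: "valint x" "valint y" "red x = red y" for \<mu> x y
  proof -
    define e where "e = (x - y) / \<pi>"
    have "nrm (x - y) < 1" using xy red_eq_iff by blast
    then have e: "valint e" unfolding e_def by (rule valint_divide_\<pi>)
    have "\<mu> + \<pi> ^ Suc n * x = (\<mu> + \<pi> ^ Suc n * y) + \<pi> ^ Suc (Suc n) * e"
    proof -
      have "\<pi> ^ Suc (Suc n) * e = \<pi> ^ Suc n * (x - y)" by (simp add: e_def)
      also have "\<dots> = \<pi> ^ Suc n * x - \<pi> ^ Suc n * y" by (rule right_diff_distrib)
      finally have "\<pi> ^ Suc (Suc n) * e = \<pi> ^ Suc n * x - \<pi> ^ Suc n * y" .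
      then show ?thesis by simp
    qed
    then show ?thesis using drift_periodic[OF M valint_translate[OF \<mu> xy(2)] e] by metis
  qed
  have "level_fun (Suc n) G"
    unfolding level_fun_def
  proof (intro conjI allI impI)
    fix \<mu> i assume "G \<mu> i \<noteq> 0"
    then obtain a where "uact a w i \<noteq> 0"
      unfolding G_def by (metis (no_types, lifting) mult_zero_right sum.neutral)
    then show "i \<le> r" by (rule uact_in_Sym)
  next
    fix \<mu> c assume \<mu>: "valint \<mu>" and c: "valint c"
    show "G (\<mu> + \<pi> ^ Suc n * c) = uact (- red c) (G \<mu>)"
    proof
      fix i
      have "G (\<mu> + \<pi> ^ Suc n * c) i =
          (\<Sum>a\<in>residues. (- ?d (\<mu> + \<pi> ^ Suc n * \<tau> (red c + a))) * uact (- red c + (red c + a)) w i)"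
        unfolding G_def
      proof (rule sum.cong)
        fix a assume a: "a \<in> residues"
        have "?d (\<mu> + \<pi> ^ Suc n * c + \<pi> ^ Suc n * \<tau> a) = ?d (\<mu> + \<pi> ^ Suc n * (c + \<tau> a))"
          by (simp only: distrib_left add.assoc)
        also have "\<dots> = ?d (\<mu> + \<pi> ^ Suc n * \<tau> (red c + a))"
          using a c \<mu> by (intro digit) (auto simp: valint_\<tau> red_\<tau> red_add residues_closed
            valint_add)
        finally show "(- ?d (\<mu> + \<pi> ^ Suc n * c + \<pi> ^ Suc n * \<tau> a)) * uact a w i =
          (- ?d (\<mu> + \<pi> ^ Suc n * \<tau> (red c + a))) * uact (- red c + (red c + a)) w i" by simp
      qed simp
      also have "\<dots> = (\<Sum>a\<in>residues. (- ?d (\<mu> + \<pi> ^ Suc n * \<tau> a)) * uact (- red c + a) w i)"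
        by (rule sum_residues_translate) (simp add: c)
      also have "\<dots> = (\<Sum>a\<in>residues. (- ?d (\<mu> + \<pi> ^ Suc n * \<tau> a)) * uact (- red c) (uact a w) i)"
        using c w by (intro sum.cong) (simp_all add: uact_uact residues_closed)
      also have "\<dots> = uact (- red c) (G \<mu>) i"
        unfolding G_def[abs_def] uact_sum uact_scale ..
      finally show "G (\<mu> + \<pi> ^ Suc n * c) i = uact (- red c) (G \<mu>) i" .
    qed
  qed
  \<comment> \<open>All translates of \<open>w\<close> have y^r coefficient -1, so that of
    \<open>G\<close> is a sum of drifts over one digit.\<close>
  moreover have "G \<mu> r = 0" if "valint \<mu>" for \<mu>
    using sum_drift[OF M that] by (simp add: G_def uact_top w_top del: power_Suc)
  then have "(\<Sum>a\<in>residues. G (\<mu> + \<pi> ^ n * \<tau> a) r * uact a (monomial r) i) = 0" if "valint \<mu>" for \<mu> i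
    using that by (simp add: valint_translate valint_\<tau>)
  ultimately have "descends n G" by (simp add: descends_def)
  moreover have "G \<mu> (\<lambda>_. 0) = - ?d \<mu>" if \<mu>: "valint \<mu>" for \<mu>
  proof -
    have "G \<mu> (\<lambda>_. 0) = (\<Sum>a\<in>residues. if a = 0 then - ?d (\<mu> + \<pi> ^ Suc n * \<tau> 0) else 0)"
      unfolding G_def by (rule sum.cong) (auto simp: w_bottom)
    also have "\<dots> = - ?d (\<mu> + \<pi> ^ Suc n * \<tau> 0)" using residues_closed(1) by simp
    also have "\<dots> = - ?d (\<mu> + \<pi> ^ Suc n * 0)"
      using digit[OF \<mu>, of "\<tau> 0" 0] residues_closed(1) by (simp only: valint_\<tau> red_\<tau>) simp
    finally show ?thesis by simp
  qed
  ultimately show "\<exists>G. descends n G \<and> (\<forall>\<mu>. valint \<mu> \<longrightarrow> G \<mu> (\<lambda>_. 0) = - ?d \<mu>)" by blast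
qed

end

section \<open>The choice of new vectors according to r and f\<close>

context hecke_setting
begin

text \<open>Special digits are taken only for f = 1 and r \<noteq> 0. Otherwise r \<noteq> 0 forces
  f > 1, and unless r is maximal there are distinct indices, one with r below p - 1 and one with r
  positive.\<close>

theorem quotient_not_admissible: "\<not> admissible nrm Q (quot_action right_translation)"
proof (cases "f = 1 \<and> 0 < r 0")
  case True
  then obtain \<tau> where \<tau>: "digit_system p nrm f \<pi> \<iota> \<tau>"
    "\<forall>a\<in>residues. \<forall>b\<in>residues. nrm (\<tau> a + \<tau> b - \<tau> (a + b)) \<le> nrm \<pi> ^ 2"
    using ex_additive_digit_system by blast
  interpret digit_system p nrm f \<pi> \<iota> \<tau> by (rule \<tau>)
  interpret hecke_digits p nrm f \<pi> \<iota> V \<rho> \<eta> r \<nu> \<phi> T \<tau> ..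
  show ?thesis using not_admissible new_vector_additive True \<tau>(2) by blast
next
  case not_1: False
  obtain \<tau> where \<tau>: "digit_system p nrm f \<pi> \<iota> \<tau>" using ex_digit_system by blast
  interpret digit_system p nrm f \<pi> \<iota> \<tau> by (rule \<tau>)
  interpret hecke_digits p nrm f \<pi> \<iota> V \<rho> \<eta> r \<nu> \<phi> T \<tau> ..
  show ?thesis
  proof (cases "r = (\<lambda>_. 0)")
    case True
    then show ?thesis using not_admissible new_vector_trivial by blast
  next
    case nonzero: False
    then obtain j0 where "r j0 \<noteq> 0" by auto
    then have j0: "j0 < f" "0 < r j0" using r_eq_0[of j0] by (cases "j0 < f"; simp)+
    then have f2: "f \<noteq> 1" using not_1 by auto
    show ?thesis
    proof (cases "\<forall>j<f. r j = p - 1")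
      case True
      then show ?thesis using not_admissible new_vector_steinberg by blast
    next
      case False
      then obtain j1 where j1: "j1 < f" "r j1 < p - 1" using r_less_p p_gt_1
        by (metis Suc_pred' less_Suc_eq order_less_trans zero_less_one)
      have "\<exists>j j'. j < f \<and> r j < p - 1 \<and> j' < f \<and> 0 < r j' \<and> j \<noteq> j'"
      proof (cases "j0 = j1")
        case True
        \<comment> \<open>If the same index was found for both roles, any second index can take over
          one of them: the first if r vanishes there, the second if it does not.\<close>
        obtain k where k: "k < f" "k \<noteq> j0"
          using f2 f_gt_0 by (cases "j0 = 0") (metis One_nat_def less_one nat_neq_iff not_less_eq,
            blast)
        show ?thesis
        proof (cases "r k = 0")
          case True
          then show ?thesis using k j0 p_gt_1 by (intro exI[of _ k] exI[of _ j0]) auto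
        next
          case False
          then show ?thesis using k j0 j1 \<open>j0 = j1\<close> by (intro exI[of _ j0] exI[of _ k]) auto
        qed
      qed (use j0 j1 in blast)
      then show ?thesis using not_admissible new_vector_two_indices by blast
    qed
  qed
qed

end

theorem corollary1p2:
  fixes p f :: nat
    and nrm :: "'f::field_char_0 \<Rightarrow> real" and \<pi> :: 'f
    and \<iota> :: "'f set \<Rightarrow> 'k::alg_closed_field"
    and V :: "('k, 'v) module" and \<rho> :: "'f^2^2 \<Rightarrow> 'v \<Rightarrow> 'v"
    and \<eta> :: "'f set \<Rightarrow> 'k" and r :: "nat \<Rightarrow> nat" and \<nu> :: 'k
    and \<phi> :: "'v \<Rightarrow> (nat \<Rightarrow> nat) \<Rightarrow> 'k"
    and T :: "('f^2^2 \<Rightarrow> 'v) \<Rightarrow> 'f^2^2 \<Rightarrow> 'v"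
  assumes F: "padic_field p nrm"
    and F_neq_Qp: "Qp nrm \<noteq> (UNIV :: 'f set)"
    and unif: "uniformizer nrm \<pi>"
    and res_card: "card (carrier (residue_field nrm)) = p ^ f"
    and char_k: "CHAR('k) = p"
    and embedding: "\<iota> \<in> ring_hom (residue_field nrm) (ring_of_type_algebra :: 'k ring)"
    and smooth: "smooth_rep nrm (KZ nrm) V \<rho>"
    and irred: "irreducible_rep (GL2\<lparr>carrier := KZ nrm\<rparr>) V \<rho>"
    and ident: "sym_identification p f nrm \<pi> \<iota> V \<rho> \<eta> r \<nu> \<phi>"
    and hecke: "hecke_operator p f nrm \<pi> \<iota> V \<rho> r \<phi> T"
  shows "\<not> admissible nrm
            (quot_space (cind nrm V \<rho>) (T ` carrier (cind nrm V \<rho>)))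
            (quot_action right_translation)"
proof -
  interpret padic_field p nrm by (rule F)
  interpret hecke_setting p nrm f \<pi> \<iota> V \<rho> \<eta> r \<nu> \<phi> T
    using irred by unfold_locales (auto simp: irreducible_rep_def F_neq_Qp unif res_card char_k
      embedding ident hecke)
  show ?thesis using quotient_not_admissible unfolding imT_def .
qed

end
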